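(* Let $(M,\mathfrak{F})$ be a compact $(\mathsf{L}(n),\mathbb{R}^{n+1})$-foliated manifold. Let $\mathcal{V}$ be the $1$-dimensional foliation tangent to the line field induced by this structure on any leaf of $\mathfrak{F}$. Then the leaves of $\mathfrak{F}$ are $(\mathsf{L}(n),\mathbb{R}^{n+1})$-complete if and only if all geodesics tangent to the leaves of $\mathcal{V}$ are affinely (i.e. geodesically) complete.
   Context: $\mathsf{L}(n)$ is the subgroup of the affine group of $\mathbb{R}^{n+1}$ consisting of all affine maps with arbitrary translation part and linear part of the form $\begin{pmatrix}\lambda&\alpha^{\top}\\0&A\end{pmatrix}$, $\lambda\in\mathbb{R}_{>0}$, $\alpha\in\mathbb{R}^n$, $A\in \mathsf{O}(n)$. It preserves the flat affine connection of $\mathbb{R}^{n+1}$ and the line field spanned by $\partial_{x_1}$. Let $G$ be a Lie group acting transitively by real analytic diffeomorphisms on $X$. A $(G,X)$-structure on a manifold is an atlas of charts into $X$ whose transition maps are restrictions of elements of $G$. It yields a developing map, a local diffeomorphism $\mathsf{Dev}$ from the universal cover to $X$, equivariant with respect to a holonomy representation of the fundamental group into $G$. A $(G,X)$-manifold is $(G,X)$-complete if $\mathsf{Dev}$ is a covering map onto $X$. A $(G,X)$-foliated manifold $(M,\mathfrak{F})$ is a smooth manifold $M$ with a foliation $\mathfrak{F}$ of codimension $k$ such that every $p\in M$ has an open neighborhood $U$ and a diffeomorphism onto its image $\varphi:U\to\mathbb{R}^k\times X$ mapping every leaf of the foliation induced by $\mathfrak{F}$ on $U$ to a level $\{t\}\times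 V_t$, $V_t\subset X$, and such that for two such maps $\varphi_i,\varphi_j$ the transition map $\varphi_j\varphi_i^{-1}$ has the form $(t,x)\mapsto(\psi(t),g_t(x))$ with $g_t\in G$. In particular each leaf of $\mathfrak{F}$ inherits a $(G,X)$-structure. For $(G,X)=(\mathsf{L}(n),\mathbb{R}^{n+1})$, pulling back by the charts the flat affine connection of $\mathbb{R}^{n+1}$ and the line field $\mathbb{R}\partial_{x_1}$ gives each leaf a flat affine connection and a line field; the leaves of the resulting foliation $\mathcal{V}$ are geodesics of this connection. A geodesic is complete if its maximal affinely parametrized extension is defined on $\mathbb{R}$. *)

theory Defs
  imports "HOL-Analysis.Analysis"
begin

text \<open>
  The space \<open>\<real>\<^sup>N\<close> is the library's \<open>Euclidean_space N\<close>, i.e. the functions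
  \<open>nat \<Rightarrow> real\<close> vanishing at all indices \<open>i \<ge> N\<close>.  Unlike \<open>real ^ 'n\<close> this includes \<open>\<real>\<^sup>0\<close>, hence
  foliations of codimension \<open>0\<close>.  Coordinates are numbered from \<open>0\<close>, so \<open>x\<^sub>1\<close> is the
  coordinate with index \<open>0\<close>.
\<close>

section \<open>Smooth manifolds\<close>

text \<open>Functions of class \<open>C\<^sup>r\<close> on an open subset \<open>U\<close> of \<open>\<real>\<^sup>N\<close>, by iterated continuous partial
  derivatives.\<close>

primrec Ck_on :: "nat \<Rightarrow> nat \<Rightarrow> (nat \<Rightarrow> real) set \<Rightarrow> ((nat \<Rightarrow> real) \<Rightarrow> real) \<Rightarrow> bool" where
  "Ck_on 0 N U f \<longleftrightarrow> continuous_map (subtopology (Euclidean_space N) U) euclideanreal f"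
| "Ck_on (Suc r) N U f \<longleftrightarrow>
     continuous_map (subtopology (Euclidean_space N) U) euclideanreal f \<and>
     (\<forall>i<N. \<exists>f'. Ck_on r N U f' \<and>
        (\<forall>x\<in>U. ((\<lambda>s. f (x(i := s))) has_real_derivative f' x) (at (x i))))"

definition smooth_map_on ::
    "nat \<Rightarrow> (nat \<Rightarrow> real) set \<Rightarrow> ((nat \<Rightarrow> real) \<Rightarrow> (nat \<Rightarrow> real)) \<Rightarrow> bool" where
  "smooth_map_on N U f \<longleftrightarrow> (\<forall>i<N. \<forall>r. Ck_on r N U (\<lambda>x. f x i))"

type_synonym 'm chart = "'m set \<times> ('m \<Rightarrow> nat \<Rightarrow> real)"

definition topological_chart :: "nat \<Rightarrow> 'm topology \<Rightarrow> 'm chart \<Rightarrow> bool" where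
  "topological_chart N T = (\<lambda>(U, \<phi>).
     openin T U \<and> openin (Euclidean_space N) (\<phi> ` U) \<and>
     homeomorphic_map (subtopology T U) (subtopology (Euclidean_space N) (\<phi> ` U)) \<phi>)"

definition smoothly_compatible :: "nat \<Rightarrow> 'm chart \<Rightarrow> 'm chart \<Rightarrow> bool" where
  "smoothly_compatible N = (\<lambda>(U, \<phi>) (V, \<psi>).
     smooth_map_on N (\<phi> ` (U \<inter> V)) (\<psi> \<circ> inv_into U \<phi>) \<and>
     smooth_map_on N (\<psi> ` (U \<inter> V)) (\<phi> \<circ> inv_into V \<psi>))"

definition smooth_manifold :: "nat \<Rightarrow> 'm topology \<Rightarrow> 'm chart set \<Rightarrow> bool" where
  "smooth_manifold N T \<A> \<longleftrightarrow>
     Hausdorff_space T \<and> second_countable T \<and>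
     (\<forall>c\<in>\<A>. topological_chart N T c) \<and>
     (\<forall>c\<in>\<A>. \<forall>d\<in>\<A>. smoothly_compatible N c d) \<and>
     (\<Union>(U, \<phi>)\<in>\<A>. U) = topspace T"

text \<open>A diffeomorphism from an open subset of the manifold onto an open subset of \<open>\<real>\<^sup>N\<close>.\<close>

definition smooth_chart :: "nat \<Rightarrow> 'm topology \<Rightarrow> 'm chart set \<Rightarrow> 'm chart \<Rightarrow> bool" where
  "smooth_chart N T \<A> c \<longleftrightarrow>
     topological_chart N T c \<and> (\<forall>d\<in>\<A>. smoothly_compatible N c d)"

section \<open>Foliations\<close>

text \<open>Maps \<open>U \<rightarrow> \<real>\<^sup>k \<times> \<real>\<^sup>p\<close>, with \<open>\<real>\<^sup>k \<times> \<real>\<^sup>p\<close> identified with \<open>\<real>\<^sup>k\<^sup>+\<^sup>p\<close> by concatenating coordinates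
  when smoothness is concerned.\<close>

type_synonym 'm prod_chart = "'m set \<times> ('m \<Rightarrow> (nat \<Rightarrow> real) \<times> (nat \<Rightarrow> real))"

definition append_coords :: "nat \<Rightarrow> (nat \<Rightarrow> real) \<times> (nat \<Rightarrow> real) \<Rightarrow> nat \<Rightarrow> real" where
  "append_coords k = (\<lambda>(t, x) i. if i < k then t i else x (i - k))"

definition smooth_prod_chart ::
    "nat \<Rightarrow> nat \<Rightarrow> 'm topology \<Rightarrow> 'm chart set \<Rightarrow> 'm prod_chart \<Rightarrow> bool" where
  "smooth_prod_chart k p T \<A> = (\<lambda>(U, \<phi>).
     \<phi> ` U \<subseteq> topspace (Euclidean_space k) \<times> topspace (Euclidean_space p) \<and>
     smooth_chart (k + p) T \<A> (U, append_coords k \<circ> \<phi>))"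

text \<open>The leaves of the foliation that \<open>\<FF>\<close> induces on an open set \<open>U\<close>.  The path components are
  taken in the subspace topology of \<open>T\<close>; a path of \<open>T\<close> that stays in a leaf of a
  foliation is also continuous for the leaf topology.\<close>

definition induced_leaves :: "'m topology \<Rightarrow> 'm set set \<Rightarrow> 'm set \<Rightarrow> 'm set set" where
  "induced_leaves T \<FF> U = (\<Union>L\<in>\<FF>. path_components_of (subtopology T (L \<inter> U)))"

text \<open>A foliation of codimension \<open>k\<close> with \<open>p\<close>-dimensional leaves: a partition into path connected
  sets admitting, around each point, a smooth chart onto a product \<open>A \<times> B\<close> in which the plaques
  are the sets \<open>{t} \<times> B\<close>.\<close>

definition foliation ::
    "nat \<Rightarrow> nat \<Rightarrow> 'm topology \<Rightarrow> 'm chart set \<Rightarrow> 'm set set \<Rightarrow> bool" where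
  "foliation k p T \<A> \<FF> \<longleftrightarrow>
     \<Union>\<FF> = topspace T \<and> {} \<notin> \<FF> \<and> pairwise disjnt \<FF> \<and>
     (\<forall>L\<in>\<FF>. path_connectedin T L) \<and>
     (\<forall>q\<in>topspace T. \<exists>U \<phi> A B.
        q \<in> U \<and> smooth_prod_chart k p T \<A> (U, \<phi>) \<and> \<phi> ` U = A \<times> B \<and>
        openin (Euclidean_space k) A \<and>
        openin (Euclidean_space p) B \<and> path_connectedin (Euclidean_space p) B \<and>
        (\<forall>P\<in>induced_leaves T \<FF> U. \<exists>t. \<phi> ` P = {t} \<times> B))"

text \<open>The leaf topology on a leaf \<open>L\<close> is generated by the plaques.\<close>

definition leaf_topology :: "'m topology \<Rightarrow> 'm set \<Rightarrow> 'm topology" where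
  "leaf_topology T L =
     topology_generated_by (\<Union>U\<in>{U. openin T U}. path_components_of (subtopology T (L \<inter> U)))"

section \<open>\<open>(G,X)\<close>-foliated manifolds, for \<open>X = \<real>\<^sup>p\<close>\<close>

text \<open>The set \<open>\<Phi>\<close> is the atlas of \<open>(G,X)\<close>-foliated charts.  Elements of \<open>G\<close> matter only through
  their values on \<open>\<real>\<^sup>p\<close>.\<close>

definition GX_foliated_manifold ::
    "((nat \<Rightarrow> real) \<Rightarrow> (nat \<Rightarrow> real)) set \<Rightarrow> nat \<Rightarrow> nat \<Rightarrow> 'm topology \<Rightarrow> 'm chart set \<Rightarrow>
     'm set set \<Rightarrow> 'm prod_chart set \<Rightarrow> bool" where
  "GX_foliated_manifold G p k T \<A> \<FF> \<Phi> \<longleftrightarrow>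
     smooth_manifold (k + p) T \<A> \<and>
     foliation k p T \<A> \<FF> \<and>
     (\<forall>q\<in>topspace T. \<exists>(U, \<phi>)\<in>\<Phi>. q \<in> U) \<and>
     (\<forall>(U, \<phi>)\<in>\<Phi>. smooth_prod_chart k p T \<A> (U, \<phi>) \<and>
        (\<forall>P\<in>induced_leaves T \<FF> U. \<exists>t V. openin (Euclidean_space p) V \<and> \<phi> ` P = {t} \<times> V)) \<and>
     (\<forall>(U, \<phi>)\<in>\<Phi>. \<forall>(V, \<psi>)\<in>\<Phi>. \<exists>h g. (\<forall>t. g t \<in> G) \<and>
        (\<forall>q\<in>U \<inter> V. \<psi> q = (h (fst (\<phi> q)), g (fst (\<phi> q)) (snd (\<phi> q)))))"

text \<open>The \<open>(G,X)\<close>-atlas inherited by a leaf \<open>L\<close>: the domains are the plaques of \<open>L\<close> in the domains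
  of the charts in \<open>\<Phi>\<close>.\<close>

definition leaf_atlas ::
    "'m topology \<Rightarrow> 'm prod_chart set \<Rightarrow> 'm set \<Rightarrow> 'm chart set" where
  "leaf_atlas T \<Phi> L =
     {(P, snd \<circ> \<phi>) |P U \<phi>. (U, \<phi>) \<in> \<Phi> \<and> P \<in> path_components_of (subtopology T (L \<inter> U))}"

section \<open>Developing maps and completeness of \<open>(G,X)\<close>-manifolds\<close>

text \<open>The library's \<open>covering_space\<close> and \<open>simply_connected\<close>, for abstract topologies.\<close>

definition covering_map_of :: "'a topology \<Rightarrow> 'b topology \<Rightarrow> ('a \<Rightarrow> 'b) \<Rightarrow> bool" where
  "covering_map_of E X p \<longleftrightarrow>
     continuous_map E X p \<and> p ` topspace E = topspace X \<and>
     (\<forall>x\<in>topspace X. \<exists>W. x \<in> W \<and> openin X W \<and>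
        (\<exists>\<V>. \<Union>\<V> = {e \<in> topspace E. p e \<in> W} \<and>
             (\<forall>V\<in>\<V>. openin E V) \<and> pairwise disjnt \<V> \<and>
             (\<forall>V\<in>\<V>. homeomorphic_map (subtopology E V) (subtopology X W) p)))"

definition simply_connected_space_of :: "'a topology \<Rightarrow> bool" where
  "simply_connected_space_of E \<longleftrightarrow>
     path_connected_space E \<and>
     (\<forall>\<gamma>. pathin E \<gamma> \<and> \<gamma> 1 = \<gamma> 0 \<longrightarrow>
        homotopic_with (\<lambda>\<sigma>. \<sigma> 1 = \<sigma> 0) (top_of_set {0..1}) E \<gamma> (\<lambda>s. \<gamma> 0))"

definition universal_covering :: "'e topology \<Rightarrow> 'm topology \<Rightarrow> ('e \<Rightarrow> 'm) \<Rightarrow> bool" where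
  "universal_covering E S \<pi> \<longleftrightarrow> simply_connected_space_of E \<and> covering_map_of E S \<pi>"

text \<open>A developing map is a map from the universal covering that, read in the \<open>(G,X)\<close>-charts \<open>\<C>\<close> of
  the base, is locally given by elements of \<open>G\<close>.  Such maps are local diffeomorphisms, are unique
  up to composition with an element of \<open>G\<close>, and are equivariant for the resulting holonomy
  representation.\<close>

definition developing_map ::
    "((nat \<Rightarrow> real) \<Rightarrow> (nat \<Rightarrow> real)) set \<Rightarrow> 'm chart set \<Rightarrow> 'e topology \<Rightarrow> ('e \<Rightarrow> 'm) \<Rightarrow>
     ('e \<Rightarrow> nat \<Rightarrow> real) \<Rightarrow> bool" where
  "developing_map G \<C> E \<pi> Dev \<longleftrightarrow>
     (\<forall>e\<in>topspace E. \<exists>W. e \<in> W \<and> openin E W \<and>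
        (\<exists>(P, c)\<in>\<C>. \<exists>g\<in>G. \<pi> ` W \<subseteq> P \<and> (\<forall>w\<in>W. Dev w = g (c (\<pi> w)))))"

text \<open>The points of the universal covering live in the type of sets of paths of the base, which
  contains its standard model of path homotopy classes.  By uniqueness of universal coverings
  and developing maps, it does not matter which ones are chosen.\<close>

definition GX_complete ::
    "((nat \<Rightarrow> real) \<Rightarrow> (nat \<Rightarrow> real)) set \<Rightarrow> nat \<Rightarrow> 'm topology \<Rightarrow> 'm chart set \<Rightarrow> bool" where
  "GX_complete G p S \<C> \<longleftrightarrow>
     (\<exists>(E :: (real \<Rightarrow> 'm) set topology) \<pi> Dev.
        universal_covering E S \<pi> \<and> developing_map G \<C> E \<pi> Dev \<and>
        covering_map_of E (Euclidean_space p) Dev)"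

section \<open>The group \<open>\<^bold>L(n)\<close> acting on \<open>\<real>\<^sup>n\<^sup>+\<^sup>1\<close>\<close>

definition orthogonal_group :: "nat \<Rightarrow> (nat \<Rightarrow> nat \<Rightarrow> real) set" where
  "orthogonal_group n =
     {A. \<forall>i<n. \<forall>j<n. (\<Sum>l<n. A l i * A l j) = (if i = j then 1 else 0)}"

text \<open>Index \<open>0\<close> is the \<open>x\<^sub>1\<close> direction, indices \<open>1, \<dots>, n\<close> carry the block \<open>A\<close>.\<close>

definition L_map ::
    "nat \<Rightarrow> real \<Rightarrow> (nat \<Rightarrow> real) \<Rightarrow> (nat \<Rightarrow> nat \<Rightarrow> real) \<Rightarrow> (nat \<Rightarrow> real) \<Rightarrow>
     (nat \<Rightarrow> real) \<Rightarrow> nat \<Rightarrow> real" where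
  "L_map n l \<alpha> A b x = (\<lambda>i.
     if i = 0 then l * x 0 + (\<Sum>j<n. \<alpha> j * x (Suc j)) + b 0
     else if i \<le> n then (\<Sum>j<n. A (i - 1) j * x (Suc j)) + b i
     else 0)"

definition L_group :: "nat \<Rightarrow> ((nat \<Rightarrow> real) \<Rightarrow> (nat \<Rightarrow> real)) set" where
  "L_group n = {L_map n l \<alpha> A b |l \<alpha> A b. 0 < l \<and> A \<in> orthogonal_group n}"

section \<open>Geodesics of the flat connection of a leaf\<close>

text \<open>In an affine chart the pulled back connection is the flat one of \<open>\<real>\<^sup>p\<close>, so the geodesic equation says
  that the velocity is locally a constant vector \<open>v\<close>.  The parameter is affine by definition, and
  constant curves are allowed.\<close>

definition affine_geodesic ::
    "nat \<Rightarrow> 'm chart set \<Rightarrow> real set \<Rightarrow> (real \<Rightarrow> 'm) \<Rightarrow> bool" where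
  "affine_geodesic p \<C> I \<gamma> \<longleftrightarrow>
     open I \<and> is_interval I \<and> I \<noteq> {} \<and>
     (\<forall>s\<in>I. \<exists>(P, c)\<in>\<C>. \<exists>J v. s \<in> J \<and> J \<subseteq> I \<and> open J \<and> \<gamma> ` J \<subseteq> P \<and>
        (\<forall>u\<in>J. \<forall>i<p. ((\<lambda>r. c (\<gamma> r) i) has_real_derivative v i) (at u)))"

text \<open>The velocity lies in the line field spanned by \<open>\<partial>\<close>/\<open>\<partial>x\<^sub>1\<close>, i.e. is tangent to a leaf of the
  one-dimensional foliation that integrates it.\<close>

definition tangent_to_line_field ::
    "nat \<Rightarrow> 'm chart set \<Rightarrow> real set \<Rightarrow> (real \<Rightarrow> 'm) \<Rightarrow> bool" where
  "tangent_to_line_field p \<C> I \<gamma> \<longleftrightarrow>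
     (\<forall>s\<in>I. \<forall>(P, c)\<in>\<C>. \<gamma> s \<in> P \<longrightarrow>
        (\<forall>i. 0 < i \<and> i < p \<longrightarrow> ((\<lambda>r. c (\<gamma> r) i) has_real_derivative 0) (at s)))"

definition geodesically_complete ::
    "nat \<Rightarrow> 'm chart set \<Rightarrow> real set \<Rightarrow> (real \<Rightarrow> 'm) \<Rightarrow> bool" where
  "geodesically_complete p \<C> I \<gamma> \<longleftrightarrow>
     (\<exists>\<delta>. affine_geodesic p \<C> UNIV \<delta> \<and> (\<forall>s\<in>I. \<delta> s = \<gamma> s))"

end

theory Submission
  imports Defs "Jordan_Normal_Form.Determinant"
begin

text \<open>
  Let \<open>S\<close> be a leaf with its leaf topology.  The structure on \<open>S\<close> is a connected Hausdorff
  \<open>(L(n), \<real>\<^sup>n\<^sup>+\<^sup>1)\<close>-manifold, and both completeness notions concern maps into \<open>S\<close> that a chart turns, locally,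
  into an element of a rigid family: affine lines in the case of geodesics, elements of \<open>L(n)\<close> in the case
  of local inverses of a developing map.  Since two members of either family that agree on a nonempty open
  set are equal, such maps obey unique continuation (\<open>charted_on_unique\<close>), and compatible ones can be
  glued (\<open>charted_on_glue\<close>).

  If the developing map of the universal covering of \<open>S\<close> is a covering of \<open>\<real>\<^sup>n\<^sup>+\<^sup>1\<close>, a geodesic of \<open>S\<close> develops
  to a piece of an affine line.  Lifting the whole line through the developing map and projecting to \<open>S\<close>
  gives a geodesic on \<open>\<real>\<close>, which continues the given one by unique continuation
  (\<open>geodesic_extends_if_developing_covering\<close>).

  Conversely, compactness gives a single \<open>\<eta> > 0\<close> such that around every point some chart of the leaf contains
  the box of radius \<open>\<eta>\<close> (\<open>uniform_plaque_size\<close>).  Call the \<open>x\<^sub>1\<close>-direction vertical.  If the vertical geodesics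
  are complete, the inverse of a chart
  can be flowed along them from that box to the whole cylinder \<open>\<real> \<times> B(y, \<eta>)\<close> (\<open>flow_chart_to_cylinder\<close>).
  An element of \<open>L(n)\<close> may stretch the vertical direction arbitrarily, but it acts on \<open>\<real>\<^sup>n\<close> by a Euclidean
  isometry.  It therefore maps such cylinders to cylinders of the same radius, so every local inverse
  germ extends to a cylinder of the uniform radius \<open>\<eta>\<close> (\<open>germ_extends_to_cylinder\<close>).  Hence an inverse defined on
  \<open>\<real> \<times> B(y, r)\<close> extends to \<open>\<real> \<times> B(y, r + \<eta>)\<close>, and by iteration to a map \<open>F\<close> on \<open>\<real>\<^sup>n\<^sup>+\<^sup>1\<close>
  (\<open>global_chart_inverse\<close>).  By unique continuation on convex sets, \<open>F\<close> is a covering of \<open>S\<close>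
  (\<open>covering_map_of_global\<close>).  So \<open>\<real>\<^sup>n\<^sup>+\<^sup>1\<close> is the universal covering of \<open>S\<close>, with the identity as
  developing map.
\<close>

section \<open>Segments and boxes in Euclidean space\<close>

definition lerp :: "(nat \<Rightarrow> real) \<Rightarrow> (nat \<Rightarrow> real) \<Rightarrow> real \<Rightarrow> nat \<Rightarrow> real" where
  "lerp x y s = (\<lambda>i. (1 - s) * x i + s * y i)"

definition cube :: "nat \<Rightarrow> (nat \<Rightarrow> real) \<Rightarrow> real \<Rightarrow> (nat \<Rightarrow> real) set" where
  "cube N x r = {y \<in> topspace (Euclidean_space N). \<forall>i<N. \<bar>y i - x i\<bar> < r}"

text \<open>
  Convexity, in coordinates.
\<close>

definition lerp_closed :: "(nat \<Rightarrow> real) set \<Rightarrow> bool" where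
  "lerp_closed W \<longleftrightarrow> (\<forall>x\<in>W. \<forall>y\<in>W. \<forall>s\<in>{0..1}. lerp x y s \<in> W)"

lemma lerp_ends [simp]: "lerp x y 0 = x" "lerp x y 1 = y"
  by (auto simp: lerp_def)

lemma lerp_in_topspace:
  "x \<in> topspace (Euclidean_space N) \<Longrightarrow> y \<in> topspace (Euclidean_space N) \<Longrightarrow>
    lerp x y s \<in> topspace (Euclidean_space N)"
  by (auto simp: topspace_Euclidean_space lerp_def)

lemma continuous_map_coordinate:
  "continuous_map (Euclidean_space N) euclideanreal (\<lambda>x. x i)"
  unfolding Euclidean_space_def
  by (intro continuous_map_from_subtopology continuous_map_product_coordinates) simp

lemma continuous_map_into_Euclidean_space:
  "continuous_map X (Euclidean_space N) f \<longleftrightarrow>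
    f ` topspace X \<subseteq> topspace (Euclidean_space N) \<and>
    (\<forall>i<N. continuous_map X euclideanreal (\<lambda>x. f x i))" (is "?L \<longleftrightarrow> ?R")
proof
  assume L: ?L
  then have "continuous_map X euclideanreal (\<lambda>x. f x i)" for i
    using continuous_map_compose[OF L continuous_map_coordinate] by (simp add: o_def)
  with L show ?R by (simp add: continuous_map_image_subset_topspace)
next
  assume R: ?R
  then have *: "continuous_map X (Euclidean_space N) (\<lambda>x i. if i < N then f x i else 0)"
    by (simp add: continuous_map_componentwise_Euclidean_space)
  show ?L
  proof (rule continuous_map_eq[OF *])
    fix x assume "x \<in> topspace X"
    then have "f x \<in> topspace (Euclidean_space N)" using R by auto
    then show "(\<lambda>i. if i < N then f x i else 0) = f x"
      by (auto simp: topspace_Euclidean_space fun_eq_iff)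
  qed
qed

lemma continuous_map_lerp:
  assumes "continuous_map X (Euclidean_space N) f" "continuous_map X (Euclidean_space N) g"
    and "continuous_map X euclideanreal s"
  shows "continuous_map X (Euclidean_space N) (\<lambda>z. lerp (f z) (g z) (s z))"
  unfolding continuous_map_into_Euclidean_space
proof (intro conjI allI impI)
  show "(\<lambda>z. lerp (f z) (g z) (s z)) ` topspace X \<subseteq> topspace (Euclidean_space N)"
    using assms(1,2) by (auto intro!: lerp_in_topspace simp: continuous_map_into_Euclidean_space)
  show "continuous_map X euclideanreal (\<lambda>z. lerp (f z) (g z) (s z) i)" if "i < N" for i
    using assms that unfolding lerp_def continuous_map_into_Euclidean_space
    by (intro continuous_intros) auto
qed

lemma continuous_map_lerp_line:
  assumes "x \<in> topspace (Euclidean_space N)" "y \<in> topspace (Euclidean_space N)"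
  shows "continuous_map euclideanreal (Euclidean_space N) (lerp x y)"
  using continuous_map_lerp[of euclideanreal N "\<lambda>_. x" "\<lambda>_. y" "\<lambda>s. s"] assms by simp

lemma Euclidean_space_eq_top_of_set:
  "Euclidean_space N = top_of_set (topspace (Euclidean_space N))"
  unfolding topspace_Euclidean_space unfolding Euclidean_space_def
  by (simp add: euclidean_product_topology)

lemma openin_cube: "openin (Euclidean_space N) (cube N x r)"
proof -
  have "open {y::nat\<Rightarrow>real. \<bar>y i - x i\<bar> < r}" for i
    by (intro open_Collect_less continuous_intros continuous_on_product_coordinates)
  then have "open (\<Inter>i\<in>{..<N}. {y. \<bar>y i - x i\<bar> < r})"
    by (intro open_INT) auto
  moreover have "cube N x r = topspace (Euclidean_space N) \<inter> (\<Inter>i\<in>{..<N}. {y. \<bar>y i - x i\<bar> < r})"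
    by (auto simp: cube_def)
  ultimately show ?thesis
    by (subst Euclidean_space_eq_top_of_set) (auto simp: openin_open)
qed

lemma centre_in_cube: "x \<in> topspace (Euclidean_space N) \<Longrightarrow> r > 0 \<Longrightarrow> x \<in> cube N x r"
  by (auto simp: cube_def)

text \<open>
  A basic open set of the product topology restricts only finitely many coordinates, so a least radius
  exists; the coordinates beyond \<open>N\<close> vanish on both sides.
\<close>

lemma cube_subset_open:
  assumes "openin (Euclidean_space N) W" "x \<in> W"
  obtains r where "r > 0" "cube N x r \<subseteq> W"
proof -
  obtain O' where O': "open O'" "W = O' \<inter> topspace (Euclidean_space N)"
    using assms(1) by (subst (asm) Euclidean_space_eq_top_of_set) (auto simp: openin_open)
  then obtain X where X: "x \<in> (\<Pi>\<^sub>E i\<in>UNIV. X i)" "\<And>i. open (X i)" "finite {i. X i \<noteq> UNIV}"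
      "(\<Pi>\<^sub>E i\<in>UNIV. X i) \<subseteq> O'"
    using product_topology_open_contains_basis[of "\<lambda>_. euclidean" UNIV O' x] assms(2)
    by (auto simp: open_fun_def)
  have "\<forall>i. \<exists>e>0. ball (x i) e \<subseteq> X i"
    using X(1,2) by (auto simp: open_contains_ball PiE_iff)
  then obtain e where e: "\<And>i. e i > 0" "\<And>i. ball (x i) (e i) \<subseteq> X i" by metis
  define r where "r = Min (insert 1 (e ` {i. X i \<noteq> UNIV}))"
  have fin: "finite (insert 1 (e ` {i. X i \<noteq> UNIV}))" using X(3) by simp
  have "r > 0" using fin e(1) unfolding r_def by (subst Min_gr_iff) auto
  moreover have "cube N x r \<subseteq> W"
  proof
    fix y assume y: "y \<in> cube N x r"
    have "y i \<in> X i" for i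
    proof (cases "i < N")
      case True
      have "X i = UNIV \<or> r \<le> e i" using fin unfolding r_def by (auto intro!: Min_le)
      then show ?thesis
      proof
        assume "r \<le> e i"
        then have "y i \<in> ball (x i) (e i)"
          using y True by (force simp: cube_def dist_real_def abs_minus_commute)
        then show ?thesis using e(2) by blast
      qed simp
    next
      case False
      have "x \<in> topspace (Euclidean_space N)" using assms openin_subset by blast
      then have "x i = 0" "y i = 0"
        using y False by (auto simp: cube_def topspace_Euclidean_space)
      then show ?thesis using X(1) by (metis PiE_mem UNIV_I)
    qed
    then have "y \<in> O'" using X(4) by auto
    then show "y \<in> W" using O'(2) y by (auto simp: cube_def)
  qed
  ultimately show thesis using that by blast
qed

lemma lerp_closed_cube: "lerp_closed (cube N x r)"
  unfolding lerp_closed_def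
proof (intro ballI)
  fix y z s assume yz: "y \<in> cube N x r" "z \<in> cube N x r" and s: "s \<in> {0..1::real}"
  have "\<bar>lerp y z s i - x i\<bar> < r" if "i < N" for i
  proof -
    have "y i \<in> ball (x i) r" "z i \<in> ball (x i) r"
      using yz that by (auto simp: cube_def dist_real_def abs_minus_commute)
    then have "(1 - s) *\<^sub>R y i + s *\<^sub>R z i \<in> ball (x i) r"
      using s by (intro convexD_alt) auto
    then show ?thesis by (auto simp: lerp_def dist_real_def abs_minus_commute)
  qed
  then show "lerp y z s \<in> cube N x r"
    using yz by (auto simp: cube_def lerp_in_topspace)
qed

lemma lerp_closed_Int: "lerp_closed V \<Longrightarrow> lerp_closed W \<Longrightarrow> lerp_closed (V \<inter> W)"
  by (auto simp: lerp_closed_def)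

lemma lerp_closed_topspace: "lerp_closed (topspace (Euclidean_space N))"
  by (auto simp: lerp_closed_def lerp_in_topspace)

lemma path_connectedin_lerp_closed:
  assumes "lerp_closed W" "W \<subseteq> topspace (Euclidean_space N)"
  shows "path_connectedin (Euclidean_space N) W"
  unfolding path_connectedin
proof (intro conjI ballI)
  fix x y assume xy: "x \<in> W" "y \<in> W"
  show "\<exists>g. pathin (Euclidean_space N) g \<and> g \<in> {0..1} \<rightarrow> W \<and> g 0 = x \<and> g 1 = y"
  proof (intro exI conjI)
    show "pathin (Euclidean_space N) (lerp x y)"
      unfolding pathin_def using xy assms(2)
      by (intro continuous_map_from_subtopology continuous_map_lerp_line) auto
    show "lerp x y \<in> {0..1} \<rightarrow> W" using assms(1) xy by (auto simp: lerp_closed_def)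
  qed auto
qed (use assms in auto)

lemma connectedin_lerp_closed:
  "lerp_closed W \<Longrightarrow> W \<subseteq> topspace (Euclidean_space N) \<Longrightarrow> connectedin (Euclidean_space N) W"
  by (simp add: path_connectedin_imp_connectedin path_connectedin_lerp_closed)

lemma lerp_eq_at_two_points:
  assumes "lerp x y s = lerp x' y' s" "lerp x y t = lerp x' y' t" "s \<noteq> t"
  shows "lerp x y = lerp x' y'"
proof -
  have "x i = x' i \<and> y i = y' i" for i
  proof -
    have "(1 - s) * (x i - x' i) + s * (y i - y' i) = 0"
      "(1 - t) * (x i - x' i) + t * (y i - y' i) = 0"
      using fun_cong[OF assms(1), of i] fun_cong[OF assms(2), of i]
      by (auto simp: lerp_def algebra_simps)
    moreover define u v where "u = x i - x' i" and "v = y i - y' i"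
    ultimately have 1: "(1 - s) * u + s * v = 0" "(1 - t) * u + t * v = 0" by auto
    then have "u + s * (v - u) = 0" "u + t * (v - u) = 0" by (auto simp: algebra_simps)
    then have "(s - t) * (v - u) = 0" by (auto simp: algebra_simps)
    then have vu: "v = u" using assms(3) by simp
    have "u = 0" using 1(1) unfolding vu by (simp only: distrib_right[symmetric]) simp
    with vu have "x i - x' i = 0" "y i - y' i = 0" unfolding u_def v_def by auto
    then show ?thesis by simp
  qed
  then have "x = x'" "y = y'" by auto
  then show ?thesis by simp
qed

section \<open>The group L(n)\<close>

lemma L_map_in_topspace: "L_map n l \<alpha> A b x \<in> topspace (Euclidean_space (Suc n))"
  by (auto simp: topspace_Euclidean_space L_map_def)

lemma L_group_in_topspace: "g \<in> L_group n \<Longrightarrow> g x \<in> topspace (Euclidean_space (Suc n))"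
  by (auto simp: L_group_def L_map_in_topspace)

text \<open>
  Elements of \<open>L(n)\<close> are affine.  This is what makes preimages of boxes convex and what reduces the
  rigidity of \<open>L(n)\<close> to that of affine lines.
\<close>

lemma L_group_lerp:
  assumes "g \<in> L_group n"
  shows "g (lerp x y s) = lerp (g x) (g y) s"
proof -
  obtain l \<alpha> A b where g: "g = L_map n l \<alpha> A b" using assms by (auto simp: L_group_def)
  have *: "(\<Sum>j<n. a j * lerp x y s (Suc j)) =
      (1 - s) * (\<Sum>j<n. a j * x (Suc j)) + s * (\<Sum>j<n. a j * y (Suc j))" for a :: "nat \<Rightarrow> real"
    by (simp add: lerp_def sum_distrib_left sum.distrib[symmetric] algebra_simps)
  show ?thesis
    unfolding g L_map_def * by (auto simp: lerp_def fun_eq_iff algebra_simps)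
qed

lemma continuous_map_L_group:
  assumes "g \<in> L_group n"
  shows "continuous_map (Euclidean_space (Suc n)) (Euclidean_space (Suc n)) g"
  unfolding continuous_map_into_Euclidean_space
proof (intro conjI allI impI)
  show "g ` topspace (Euclidean_space (Suc n)) \<subseteq> topspace (Euclidean_space (Suc n))"
    using L_group_in_topspace[OF assms] by auto
  obtain l \<alpha> A b where g: "g = L_map n l \<alpha> A b" using assms by (auto simp: L_group_def)
  have *: "continuous_map (Euclidean_space (Suc n)) euclideanreal (\<lambda>x. \<Sum>j<n. a j * x (Suc j))"
    for a :: "nat \<Rightarrow> real"
    by (intro continuous_intros continuous_map_coordinate) auto
  show "continuous_map (Euclidean_space (Suc n)) euclideanreal (\<lambda>x. g x i)" for i
    unfolding g L_map_def
    by (cases "i = 0"; cases "i \<le> n") (auto intro!: continuous_intros continuous_map_coordinate *)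
qed

lemma L_group_id:
  obtains g where "g \<in> L_group n" "\<And>x. x \<in> topspace (Euclidean_space (Suc n)) \<Longrightarrow> g x = x"
proof
  let ?I = "\<lambda>i j::nat. if i = j then 1 else 0::real"
  show "L_map n 1 (\<lambda>_. 0) ?I (\<lambda>_. 0) \<in> L_group n"
  proof -
    have "(\<Sum>r<n. ?I r i * ?I r j) = ?I i j" if "i < n" for i j
    proof -
      have "(\<Sum>r<n. ?I r i * ?I r j) = (\<Sum>r<n. if r = i then ?I r j else 0)"
        by (intro sum.cong) auto
      then show ?thesis using that by simp
    qed
    then have "?I \<in> orthogonal_group n" by (simp add: orthogonal_group_def)
    then show ?thesis unfolding L_group_def by (intro CollectI exI conjI) (rule refl, simp_all)
  qed
  fix x assume x: "x \<in> topspace (Euclidean_space (Suc n))"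
  show "L_map n 1 (\<lambda>_. 0) ?I (\<lambda>_. 0) x = x"
  proof
    fix i
    have "(\<Sum>j<n. ?I m j * x (Suc j)) = x (Suc m)" if "m < n" for m
    proof -
      have "(\<Sum>j<n. ?I m j * x (Suc j)) = (\<Sum>j<n. if j = m then x (Suc j) else 0)"
        by (intro sum.cong) auto
      then show ?thesis using that by simp
    qed
    then show "L_map n 1 (\<lambda>_. 0) ?I (\<lambda>_. 0) x i = x i"
      using x by (cases i) (simp_all add: L_map_def topspace_Euclidean_space)
  qed
qed

lemma sum_mult_assoc:
  fixes a s :: "nat \<Rightarrow> real"
  shows "(\<Sum>m<n. a m * (\<Sum>j<k. b m j * s j)) = (\<Sum>j<k. (\<Sum>m<n. a m * b m j) * s j)"
  by (simp add: sum_distrib_left sum_distrib_right mult.assoc) (rule sum.swap)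

lemma L_group_comp:
  assumes "g \<in> L_group n" "h \<in> L_group n"
  shows "g \<circ> h \<in> L_group n"
proof -
  obtain l \<alpha> A b where g: "g = L_map n l \<alpha> A b" "0 < l" "A \<in> orthogonal_group n"
    using assms(1) by (auto simp: L_group_def)
  obtain l' \<alpha>' A' b' where h: "h = L_map n l' \<alpha>' A' b'" "0 < l'" "A' \<in> orthogonal_group n"
    using assms(2) by (auto simp: L_group_def)
  define A'' where "A'' = (\<lambda>i j. \<Sum>m<n. A i m * A' m j)"
  define \<alpha>'' where "\<alpha>'' = (\<lambda>j. l * \<alpha>' j + (\<Sum>m<n. \<alpha> m * A' m j))"
  define b'' where "b'' = (\<lambda>i. if i = 0 then l * b' 0 + (\<Sum>m<n. \<alpha> m * b' (Suc m)) + b 0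
     else (\<Sum>m<n. A (i - 1) m * b' (Suc m)) + b i)"
  have "g \<circ> h = L_map n (l * l') \<alpha>'' A'' b''"
  proof (intro ext)
    fix x i
    have hS: "h x (Suc m) = (\<Sum>j<n. A' m j * x (Suc j)) + b' (Suc m)" if "m < n" for m
      using that by (simp add: h L_map_def)
    have tail: "(\<Sum>m<n. a m * h x (Suc m)) =
        (\<Sum>j<n. (\<Sum>m<n. a m * A' m j) * x (Suc j)) + (\<Sum>m<n. a m * b' (Suc m))" for a
      by (simp only: sum_mult_assoc[symmetric] sum.distrib[symmetric] distrib_left[symmetric]) (simp add: hS)
    have h0: "h x 0 = l' * x 0 + (\<Sum>j<n. \<alpha>' j * x (Suc j)) + b' 0"
      by (simp add: h L_map_def)
    consider "i = 0" | "i \<noteq> 0" "i \<le> n" | "i > n" by linarith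
    then show "(g \<circ> h) x i = L_map n (l * l') \<alpha>'' A'' b'' x i"
    proof cases
      case 1
      then show ?thesis
        by (simp add: g L_map_def tail h0)
          (simp add: \<alpha>''_def b''_def algebra_simps sum.distrib sum_distrib_left)
    next
      case 2
      then show ?thesis by (simp add: g L_map_def tail) (simp add: A''_def b''_def)
    qed (simp add: g L_map_def)
  qed
  moreover have "A'' \<in> orthogonal_group n"
  proof -
    have "(\<Sum>r<n. A'' r i * A'' r j) = (if i = j then 1 else 0)" if ij: "i < n" "j < n" for i j
    proof -
      have "(\<Sum>r<n. A'' r i * A'' r j) = (\<Sum>r<n. \<Sum>m<n. \<Sum>m'<n. A r m * A' m i * (A r m' * A' m' j))"
        by (simp add: A''_def sum_product)
      also have "\<dots> = (\<Sum>m<n. \<Sum>r<n. \<Sum>m'<n. A r m * A' m i * (A r m' * A' m' j))"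
        by (rule sum.swap)
      also have "\<dots> = (\<Sum>m<n. \<Sum>m'<n. \<Sum>r<n. A r m * A' m i * (A r m' * A' m' j))"
        by (intro sum.cong refl sum.swap)
      also have "\<dots> = (\<Sum>m<n. \<Sum>m'<n. (\<Sum>r<n. A r m * A r m') * (A' m i * A' m' j))"
        by (intro sum.cong refl) (simp add: sum_distrib_left sum_distrib_right mult_ac)
      also have "\<dots> = (\<Sum>m<n. \<Sum>m'<n. (if m = m' then 1 else 0) * (A' m i * A' m' j))"
        using g(3) by (intro sum.cong refl) (simp add: orthogonal_group_def)
      also have "\<dots> = (\<Sum>m<n. \<Sum>m'<n. if m' = m then A' m i * A' m' j else 0)"
        by (intro sum.cong refl) simp
      also have "\<dots> = (\<Sum>m<n. A' m i * A' m j)" by simp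
      also have "\<dots> = (if i = j then 1 else 0)" using h(3) ij by (simp add: orthogonal_group_def)
      finally show ?thesis .
    qed
    then show ?thesis by (simp add: orthogonal_group_def)
  qed
  ultimately show ?thesis using g(2) h(2) by (auto simp: L_group_def intro!: exI mult_pos_pos)
qed

text \<open>
  The defining condition says that the columns are orthonormal.  A one-sided inverse of a square matrix
  is two-sided, so the rows are orthonormal as well, which is needed to invert elements of \<open>L(n)\<close>.
\<close>

lemma orthogonal_group_transpose:
  assumes "A \<in> orthogonal_group n" "i < n" "j < n"
  shows "(\<Sum>l<n. A i l * A j l) = (if i = j then 1 else 0)"
proof -
  define M where "M = mat n n (\<lambda>(i, j). A i j)"
  have "transpose_mat M * M = 1\<^sub>m n"
    using assms(1) by (intro eq_matI) (auto simp: M_def scalar_prod_def orthogonal_group_def atLeast0LessThan)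
  then have "M * transpose_mat M = 1\<^sub>m n"
    by (rule mat_mult_left_right_inverse[rotated 2]) (auto simp: M_def)
  from arg_cong[OF this, of "\<lambda>B. B $$ (i, j)"] show ?thesis
    using assms(2,3) by (simp add: M_def scalar_prod_def atLeast0LessThan)
qed

text \<open>
  The inverse of \<open>x \<mapsto> (l x\<^sub>1 + \<alpha>\<cdot>x' + b\<^sub>1, A x' + b')\<close> is obtained by solving the second component for \<open>x'\<close>
  with \<open>A\<^sup>T\<close> and inserting the result into the first; it is again block triangular with linear part
  \<open>(1/l, \<beta>, A\<^sup>T)\<close>.
\<close>

lemma L_group_inverse:
  assumes "g \<in> L_group n"
  obtains h where "h \<in> L_group n"
    "\<And>x. x \<in> topspace (Euclidean_space (Suc n)) \<Longrightarrow> g (h x) = x"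
    "\<And>x. x \<in> topspace (Euclidean_space (Suc n)) \<Longrightarrow> h (g x) = x"
proof -
  obtain l \<alpha> A b where g: "g = L_map n l \<alpha> A b" "0 < l" "A \<in> orthogonal_group n"
    using assms by (auto simp: L_group_def)
  define B where "B = (\<lambda>i j. A j i)"
  define \<beta> where "\<beta> = (\<lambda>j. - (\<Sum>m<n. \<alpha> m * B m j) / l)"
  define d where "d = (\<lambda>i. if i = 0 then - (b 0 + l * (\<Sum>j<n. \<beta> j * b (Suc j))) / l
    else - (\<Sum>j<n. B (i - 1) j * b (Suc j)))"
  define h where "h = L_map n (1 / l) \<beta> B d"
  have BO: "B \<in> orthogonal_group n"
    using orthogonal_group_transpose[OF g(3)] by (auto simp: orthogonal_group_def B_def)
  have "h \<in> L_group n"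
    using BO g(2) unfolding h_def L_group_def by (auto intro!: exI)
  have orth: "(\<Sum>m<n. C i m * (\<Sum>j<n. D m j * c j)) = c i"
    if "i < n" "C = A \<and> D = B \<or> C = B \<and> D = A" for C D i and c :: "nat \<Rightarrow> real"
  proof -
    have "(\<Sum>m<n. C i m * (\<Sum>j<n. D m j * c j)) = (\<Sum>j<n. (\<Sum>m<n. C i m * D m j) * c j)"
      by (rule sum_mult_assoc)
    also have "\<dots> = (\<Sum>j<n. (if i = j then 1 else 0) * c j)"
    proof (intro sum.cong refl)
      fix j assume "j \<in> {..<n}"
      then show "(\<Sum>m<n. C i m * D m j) * c j = (if i = j then 1 else 0) * c j"
        using that orthogonal_group_transpose[OF g(3), of i j] g(3)
        by (auto simp: B_def orthogonal_group_def)
    qed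
    also have "\<dots> = (\<Sum>j<n. if j = i then c j else 0)" by (intro sum.cong refl) simp
    also have "\<dots> = c i" using that(1) by simp
    finally show ?thesis .
  qed
  note orthAB = orth[of _ A B, simplified] and orthBA = orth[of _ B A, simplified]
  have \<beta>A: "(\<Sum>m<n. \<beta> m * (\<Sum>j<n. A m j * c j)) = - (\<Sum>m<n. \<alpha> m * c m) / l" for c :: "nat \<Rightarrow> real"
  proof -
    have "(\<Sum>m<n. \<beta> m * (\<Sum>j<n. A m j * c j)) = - (\<Sum>m<n. (\<Sum>r<n. \<alpha> r * B r m) * (\<Sum>j<n. A m j * c j)) / l"
    proof -
      have "(\<Sum>m<n. \<beta> m * (\<Sum>j<n. A m j * c j))
          = (\<Sum>m<n. (- 1 / l) * ((\<Sum>r<n. \<alpha> r * B r m) * (\<Sum>j<n. A m j * c j)))"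
        by (intro sum.cong refl) (simp add: \<beta>_def)
      then show ?thesis by (simp only: sum_distrib_left[symmetric]) simp
    qed
    also have "(\<Sum>m<n. (\<Sum>r<n. \<alpha> r * B r m) * (\<Sum>j<n. A m j * c j))
        = (\<Sum>r<n. \<alpha> r * (\<Sum>m<n. B r m * (\<Sum>j<n. A m j * c j)))"
      by (rule sum_mult_assoc[where s = "\<lambda>m. \<Sum>j<n. A m j * c j", symmetric])
    also have "\<dots> = (\<Sum>m<n. \<alpha> m * c m)" by (intro sum.cong refl) (simp add: orthAB orthBA)
    finally show ?thesis .
  qed
  have \<alpha>B: "(\<Sum>m<n. \<alpha> m * (\<Sum>j<n. B m j * c j)) = - l * (\<Sum>m<n. \<beta> m * c m)" for c :: "nat \<Rightarrow> real"
  proof -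
    have "(\<Sum>m<n. \<alpha> m * (\<Sum>j<n. B m j * c j)) = (\<Sum>j<n. (\<Sum>m<n. \<alpha> m * B m j) * c j)"
      by (rule sum_mult_assoc)
    also have "\<dots> = (\<Sum>j<n. - l * \<beta> j * c j)" using g(2) by (simp add: \<beta>_def)
    finally show ?thesis by (simp add: sum_distrib_left mult.assoc)
  qed
  have dS: "d (Suc m) = - (\<Sum>j<n. B m j * b (Suc j))" for m by (simp add: d_def)
  have "g (h x) = x \<and> h (g x) = x" if x: "x \<in> topspace (Euclidean_space (Suc n))" for x
  proof -
    have hS: "h x (Suc m) = (\<Sum>j<n. B m j * x (Suc j)) + d (Suc m)" if "m < n" for m
      using that by (simp add: h_def L_map_def)
    have gS: "g x (Suc m) = (\<Sum>j<n. A m j * x (Suc j)) + b (Suc m)" if "m < n" for m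
      using that by (simp add: g L_map_def)
    have x0: "x i = 0" if "i > n" for i using x that by (auto simp: topspace_Euclidean_space)
    have "g (h x) i = x i" for i
    proof (cases i)
      case 0
      have "(\<Sum>m<n. \<alpha> m * h x (Suc m)) = (\<Sum>m<n. \<alpha> m * (\<Sum>j<n. B m j * x (Suc j)))
         - (\<Sum>m<n. \<alpha> m * (\<Sum>j<n. B m j * b (Suc j)))"
        by (simp add: hS dS algebra_simps sum_subtractf)
      also have "\<dots> = - l * (\<Sum>m<n. \<beta> m * x (Suc m)) + l * (\<Sum>m<n. \<beta> m * b (Suc m))"
        by (simp add: \<alpha>B)
      finally have "g (h x) 0 = l * h x 0 - l * (\<Sum>m<n. \<beta> m * x (Suc m)) + l * (\<Sum>m<n. \<beta> m * b (Suc m)) + b 0"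
        by (simp add: g L_map_def)
      moreover have "l * h x 0 = x 0 + l * (\<Sum>m<n. \<beta> m * x (Suc m)) + l * d 0"
        using g(2) by (simp add: h_def L_map_def distrib_left)
      moreover have "l * d 0 = - (b 0 + l * (\<Sum>j<n. \<beta> j * b (Suc j)))"
        using g(2) by (simp add: d_def)
      ultimately show ?thesis using 0 by simp
    next
      case (Suc m)
      show ?thesis
      proof (cases "m < n")
        case True
        have "(\<Sum>r<n. A m r * h x (Suc r)) = (\<Sum>r<n. A m r * (\<Sum>j<n. B r j * x (Suc j)))
         - (\<Sum>r<n. A m r * (\<Sum>j<n. B r j * b (Suc j)))"
          by (simp add: hS dS algebra_simps sum_subtractf)
        also have "\<dots> = x (Suc m) - b (Suc m)" using True by (simp add: orthAB orthBA)
        finally show ?thesis using True Suc by (simp add: g L_map_def)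
      qed (simp add: g L_map_def x0 Suc)
    qed
    moreover have "h (g x) i = x i" for i
    proof (cases i)
      case 0
      have "(\<Sum>m<n. \<beta> m * g x (Suc m)) = (\<Sum>m<n. \<beta> m * (\<Sum>j<n. A m j * x (Suc j)))
         + (\<Sum>m<n. \<beta> m * b (Suc m))"
        by (simp add: gS algebra_simps sum.distrib)
      also have "\<dots> = - (\<Sum>m<n. \<alpha> m * x (Suc m)) / l + (\<Sum>m<n. \<beta> m * b (Suc m))"
        by (simp add: \<beta>A)
      finally have "h (g x) 0 = g x 0 / l - (\<Sum>m<n. \<alpha> m * x (Suc m)) / l + (\<Sum>m<n. \<beta> m * b (Suc m)) + d 0"
        by (simp add: h_def L_map_def)
      moreover have "g x 0 / l = x 0 + (\<Sum>m<n. \<alpha> m * x (Suc m)) / l + b 0 / l"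
        using g(2)[THEN less_imp_neq, symmetric] by (simp add: g L_map_def add_divide_distrib)
      moreover have "d 0 = - b 0 / l - (\<Sum>j<n. \<beta> j * b (Suc j))"
        using g(2) by (simp add: d_def diff_divide_distrib add_divide_distrib)
      ultimately show ?thesis using 0 by simp
    next
      case (Suc m)
      show ?thesis
      proof (cases "m < n")
        case True
        have "(\<Sum>r<n. B m r * g x (Suc r)) = (\<Sum>r<n. B m r * (\<Sum>j<n. A r j * x (Suc j)))
         + (\<Sum>r<n. B m r * b (Suc r))"
          by (simp add: gS algebra_simps sum.distrib)
        also have "\<dots> = x (Suc m) - d (Suc m)" using True by (simp add: orthAB orthBA dS)
        finally show ?thesis using True Suc by (simp add: h_def L_map_def)
      qed (simp add: h_def L_map_def x0 Suc)
    qed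
    ultimately show ?thesis by auto
  qed
  then show thesis using that \<open>h \<in> L_group n\<close> by blast
qed

section \<open>Transverse distance and cylinders\<close>

text \<open>
  The Euclidean distance of the projections to \<open>\<real>\<^sup>n\<close>, forgetting \<open>x\<^sub>1\<close>.
\<close>

definition hdist :: "nat \<Rightarrow> (nat \<Rightarrow> real) \<Rightarrow> (nat \<Rightarrow> real) \<Rightarrow> real" where
  "hdist n x y = L2_set (\<lambda>i. x (Suc i) - y (Suc i)) {..<n}"

text \<open>
  The set \<open>\<real> \<times> B(y, r)\<close>, where \<open>y\<close> is the projection of the centre.
\<close>

definition cylinder :: "nat \<Rightarrow> (nat \<Rightarrow> real) \<Rightarrow> real \<Rightarrow> (nat \<Rightarrow> real) set" where
  "cylinder n x r = {y \<in> topspace (Euclidean_space (Suc n)). hdist n x y < r}"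

text \<open>
  The \<open>O(n)\<close> block is the only part of an element of \<open>L(n)\<close> seen by the projection to \<open>\<real>\<^sup>n\<close>.  This
  invariance is where the shape of the group enters: it keeps the radius of cylinders uniform.
\<close>

lemma hdist_L_group:
  assumes "g \<in> L_group n"
  shows "hdist n (g x) (g y) = hdist n x y"
proof -
  obtain l \<alpha> A b where g: "g = L_map n l \<alpha> A b" "A \<in> orthogonal_group n"
    using assms by (auto simp: L_group_def)
  define u where "u = (\<lambda>j. x (Suc j) - y (Suc j))"
  have "(\<Sum>i<n. (g x (Suc i) - g y (Suc i))\<^sup>2) = (\<Sum>i<n. (\<Sum>j<n. A i j * u j)\<^sup>2)"
    by (intro sum.cong refl) (simp add: g L_map_def u_def algebra_simps sum_subtractf)
  also have "\<dots> = (\<Sum>i<n. \<Sum>j<n. \<Sum>j'<n. A i j * u j * (A i j' * u j'))"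
    by (simp add: power2_eq_square sum_product)
  also have "\<dots> = (\<Sum>j<n. \<Sum>i<n. \<Sum>j'<n. A i j * u j * (A i j' * u j'))"
    by (rule sum.swap)
  also have "\<dots> = (\<Sum>j<n. \<Sum>j'<n. \<Sum>i<n. A i j * u j * (A i j' * u j'))"
    by (intro sum.cong refl sum.swap)
  also have "\<dots> = (\<Sum>j<n. \<Sum>j'<n. (\<Sum>i<n. A i j * A i j') * (u j * u j'))"
    by (intro sum.cong refl) (simp add: sum_distrib_left sum_distrib_right mult_ac)
  also have "\<dots> = (\<Sum>j<n. \<Sum>j'<n. (if j = j' then 1 else 0) * (u j * u j'))"
    using g(2) by (intro sum.cong refl) (simp add: orthogonal_group_def)
  also have "\<dots> = (\<Sum>j<n. (u j)\<^sup>2)"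
  proof (intro sum.cong refl)
    fix j assume "j \<in> {..<n}"
    have "(\<Sum>j'<n. (if j = j' then 1 else 0) * (u j * u j')) = (\<Sum>j'<n. if j' = j then u j * u j' else 0)"
      by (intro sum.cong refl) simp
    with \<open>j \<in> {..<n}\<close> show "(\<Sum>j'<n. (if j = j' then 1 else 0) * (u j * u j')) = (u j)\<^sup>2"
      by (simp add: power2_eq_square)
  qed
  finally show ?thesis by (simp add: hdist_def L2_set_def u_def)
qed

lemma hdist_same [simp]: "hdist n x x = 0"
  by (simp add: hdist_def L2_set_def)

lemma hdist_commute: "hdist n x y = hdist n y x"
  by (simp add: hdist_def L2_set_def power2_commute)

lemma hdist_triangle: "hdist n x z \<le> hdist n x y + hdist n y z"
  using L2_set_triangle_ineq[of "\<lambda>i. x (Suc i) - y (Suc i)" "\<lambda>i. y (Suc i) - z (Suc i)" "{..<n}"]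
  by (simp add: hdist_def)

lemma hdist_lerp: 
  "hdist n x (lerp x y s) = \<bar>s\<bar> * hdist n x y" "hdist n y (lerp x y s) = \<bar>1 - s\<bar> * hdist n x y"
proof -
  have "hdist n x (lerp x y s) = L2_set (\<lambda>i. s * (x (Suc i) - y (Suc i))) {..<n}"
    unfolding hdist_def by (intro L2_set_cong) (auto simp: lerp_def algebra_simps)
  then show "hdist n x (lerp x y s) = \<bar>s\<bar> * hdist n x y"
    by (simp add: hdist_def L2_set_def power_mult_distrib real_sqrt_mult flip: sum_distrib_left)
  have "hdist n y (lerp x y s) = L2_set (\<lambda>i. (s - 1) * (x (Suc i) - y (Suc i))) {..<n}"
    unfolding hdist_def by (intro L2_set_cong) (auto simp: lerp_def algebra_simps)
  then show "hdist n y (lerp x y s) = \<bar>1 - s\<bar> * hdist n x y"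
    by (simp add: hdist_def L2_set_def power_mult_distrib real_sqrt_mult abs_minus_commute flip: sum_distrib_left)
qed

lemma hdist_lerp_le:
  assumes "s \<in> {0..1}"
  shows "hdist n z (lerp x y s) \<le> (1 - s) * hdist n z x + s * hdist n z y"
proof -
  have "hdist n z (lerp x y s) = L2_set (\<lambda>i. (1 - s) * (z (Suc i) - x (Suc i)) + s * (z (Suc i) - y (Suc i))) {..<n}"
    unfolding hdist_def by (intro L2_set_cong) (auto simp: lerp_def algebra_simps)
  also have "\<dots> \<le> L2_set (\<lambda>i. (1 - s) * (z (Suc i) - x (Suc i))) {..<n} + L2_set (\<lambda>i. s * (z (Suc i) - y (Suc i))) {..<n}"
    by (rule L2_set_triangle_ineq)
  also have "\<dots> = (1 - s) * hdist n z x + s * hdist n z y"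
    using assms by (simp add: hdist_def L2_set_def power_mult_distrib real_sqrt_mult flip: sum_distrib_left)
  finally show ?thesis .
qed

lemma openin_cylinder: "openin (Euclidean_space (Suc n)) (cylinder n x r)"
proof -
  have "continuous_map (Euclidean_space (Suc n)) euclideanreal (\<lambda>y. hdist n x y)"
    unfolding hdist_def L2_set_def 
    by (intro continuous_intros continuous_map_coordinate) auto
  from openin_continuous_map_preimage[OF this, of "{..<r}"] show ?thesis
    by (simp add: cylinder_def)
qed

lemma lerp_closed_cylinder: "lerp_closed (cylinder n x r)"
  unfolding lerp_closed_def
proof (intro ballI)
  fix y z s assume yz: "y \<in> cylinder n x r" "z \<in> cylinder n x r" and s: "s \<in> {0..1::real}"
  have "hdist n x (lerp y z s) \<le> (1 - s) * hdist n x y + s * hdist n x z"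
    by (rule hdist_lerp_le[OF s])
  also have "\<dots> < r" using yz s by (intro convex_bound_lt) (auto simp: cylinder_def)
  finally show "lerp y z s \<in> cylinder n x r"
    using yz by (auto simp: cylinder_def lerp_in_topspace)
qed

section \<open>Continuation of maps read in charts\<close>

definition lines :: "nat \<Rightarrow> (real \<Rightarrow> nat \<Rightarrow> real) set" where
  "lines n = {lerp x y |x y. x \<in> topspace (Euclidean_space (Suc n)) \<and> y \<in> topspace (Euclidean_space (Suc n))}"

text \<open>
  The conditions on a family of local models under which continuation works: continuity, stability under
  changes of charts, and rigidity, i.e. a member is determined by its values on any nonempty open set.
\<close>

definition continuation_family :: "nat \<Rightarrow> 'x topology \<Rightarrow> ('x \<Rightarrow> nat \<Rightarrow> real) set \<Rightarrow> bool" where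
  "continuation_family n X \<G> \<longleftrightarrow>
     (\<forall>g\<in>\<G>. continuous_map X (Euclidean_space (Suc n)) g) \<and>
     (\<forall>g\<in>\<G>. \<forall>h\<in>L_group n. \<exists>g'\<in>\<G>. \<forall>x\<in>topspace X. g' x = h (g x)) \<and>
     (\<forall>g\<in>\<G>. \<forall>g'\<in>\<G>. \<forall>D. openin X D \<and> D \<noteq> {} \<and> (\<forall>x\<in>D. g x = g' x) \<longrightarrow>
        (\<forall>x\<in>topspace X. g x = g' x))"

lemma continuation_family_comp:
  assumes "continuation_family n X \<G>" "g \<in> \<G>" "h \<in> L_group n"
  obtains g' where "g' \<in> \<G>" "\<And>x. x \<in> topspace X \<Longrightarrow> g' x = h (g x)"
proof -
  have "\<forall>g\<in>\<G>. \<forall>h\<in>L_group n. \<exists>g'\<in>\<G>. \<forall>x\<in>topspace X. g' x = h (g x)"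
    using assms(1) unfolding continuation_family_def by (elim conjE)
  from bspec[OF bspec[OF this assms(2)] assms(3)] obtain g' where "g' \<in> \<G>" and "\<forall>x\<in>topspace X. g' x = h (g x)" by (rule bexE)
  then show thesis using that[of g'] by blast
qed

lemma continuation_family_eq:
  assumes "continuation_family n X \<G>" "g \<in> \<G>" "g' \<in> \<G>" "openin X D" "z \<in> D"
    "\<And>x. x \<in> D \<Longrightarrow> g x = g' x" "x \<in> topspace X"
  shows "g x = g' x"
  using assms unfolding continuation_family_def by (metis empty_iff)

lemma lines_eq_if_eq_on_open:
  assumes "g \<in> lines n" "g' \<in> lines n" "open D" "D \<noteq> {}" "\<And>s. s \<in> D \<Longrightarrow> g s = g' s"
  shows "g = g'"
proof -
  obtain s where s: "s \<in> D" using assms(4) by auto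
  then obtain e where e: "e > 0" "ball s e \<subseteq> D" using assms(3) open_contains_ball by blast
  then have "s + e / 2 \<in> D" by (auto simp: dist_real_def)
  moreover obtain x y x' y' where "g = lerp x y" "g' = lerp x' y'"
    using assms(1,2) by (auto simp: lines_def)
  ultimately show ?thesis
    using lerp_eq_at_two_points[of x y s x' y' "s + e / 2"] assms(5) s e(1) by auto
qed

lemma continuation_family_lines: "continuation_family n euclideanreal (lines n)"
  unfolding continuation_family_def
proof (intro conjI ballI allI impI)
  show "continuous_map euclideanreal (Euclidean_space (Suc n)) g" if "g \<in> lines n" for g
    using that continuous_map_lerp_line by (auto simp: lines_def)
  show "\<exists>g'\<in>lines n. \<forall>s\<in>topspace euclideanreal. g' s = h (g s)"
    if "g \<in> lines n" "h \<in> L_group n" for g h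
  proof -
    obtain x y where "g = lerp x y" using \<open>g \<in> lines n\<close> by (auto simp: lines_def)
    then have "\<forall>s. lerp (h x) (h y) s = h (g s)" by (simp add: L_group_lerp[OF that(2)])
    moreover have "lerp (h x) (h y) \<in> lines n"
      using L_group_in_topspace[OF that(2)] by (auto simp: lines_def)
    ultimately show ?thesis by blast
  qed
  show "g s = g' s" if "g \<in> lines n" "g' \<in> lines n"
    "openin euclideanreal D \<and> D \<noteq> {} \<and> (\<forall>x\<in>D. g x = g' x)" for g g' D s
    using lines_eq_if_eq_on_open[of g n g' D] that by auto
qed

lemma L_group_lerp_in_lines:
  assumes "g \<in> L_group n" "x \<in> topspace (Euclidean_space (Suc n))" "y \<in> topspace (Euclidean_space (Suc n))"
  shows "(\<lambda>s. g (lerp x y s)) \<in> lines n"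
proof -
  have "(\<lambda>s. g (lerp x y s)) = lerp (g x) (g y)" by (simp add: L_group_lerp[OF assms(1)] fun_eq_iff)
  then show ?thesis using L_group_in_topspace[OF assms(1)] unfolding lines_def by blast
qed

text \<open>
  For the rigidity of \<open>L(n)\<close>, join a point of the open set to the given point by a line: along it both maps
  are affine and agree for small parameters.
\<close>

lemma continuation_family_L_group:
  "continuation_family n (Euclidean_space (Suc n)) (L_group n)"
  unfolding continuation_family_def
proof (intro conjI ballI allI impI)
  show "continuous_map (Euclidean_space (Suc n)) (Euclidean_space (Suc n)) g" if "g \<in> L_group n" for g
    using that by (rule continuous_map_L_group)
  show "\<exists>g'\<in>L_group n. \<forall>x\<in>topspace (Euclidean_space (Suc n)). g' x = h (g x)"
    if "g \<in> L_group n" "h \<in> L_group n" for g h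
    using L_group_comp[OF that(2,1)] by (intro bexI[of _ "h \<circ> g"]) auto
  show "g y = g' y" if "g \<in> L_group n" "g' \<in> L_group n" "y \<in> topspace (Euclidean_space (Suc n))"
    "openin (Euclidean_space (Suc n)) D \<and> D \<noteq> {} \<and> (\<forall>x\<in>D. g x = g' x)" for g g' D y
  proof -
    note gD = that
    obtain x where x: "x \<in> D" "x \<in> topspace (Euclidean_space (Suc n))"
      using gD(4) openin_subset by blast
    have o: "openin euclideanreal {s \<in> topspace euclideanreal. lerp x y s \<in> D}"
      using that(4) by (intro openin_continuous_map_preimage[OF continuous_map_lerp_line[OF x(2) that(3)]]) auto
    have "(\<lambda>s. g (lerp x y s)) = (\<lambda>s. g' (lerp x y s))"
    proof (rule lines_eq_if_eq_on_open)
      show "(\<lambda>s. g (lerp x y s)) \<in> lines n" "(\<lambda>s. g' (lerp x y s)) \<in> lines n"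
        using L_group_lerp_in_lines x gD by auto
      show "open {s. lerp x y s \<in> D}" using o by simp
      have "0 \<in> {s. lerp x y s \<in> D}" using x by simp
      then show "{s. lerp x y s \<in> D} \<noteq> {}" by blast
    qed (use gD in auto)
    from fun_cong[OF this, of 1] show ?thesis by simp
  qed
qed

text \<open>
  A connected Hausdorff \<open>(L(n), \<real>\<^sup>n\<^sup>+\<^sup>1)\<close>-manifold.  The transition condition is imposed on the whole overlap
  rather than on its components, as holds for plaques of foliated charts.
\<close>

locale L_structure =
  fixes n :: nat and S :: "'a topology" and C :: "'a chart set"
  assumes hausdorff: "Hausdorff_space S"
    and connected: "connected_space S"
    and chart: "(P, c) \<in> C \<Longrightarrow> topological_chart (Suc n) S (P, c)"
    and transition: "(P, c) \<in> C \<Longrightarrow> (Q, d) \<in> C \<Longrightarrow> \<exists>g\<in>L_group n. \<forall>q\<in>P \<inter> Q. d q = g (c q)"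
    and charts_cover: "q \<in> topspace S \<Longrightarrow> \<exists>(P, c)\<in>C. q \<in> P"
begin

abbreviation model :: "(nat \<Rightarrow> real) topology" where
  "model \<equiv> Euclidean_space (Suc n)"

lemma chart_open: "(P, c) \<in> C \<Longrightarrow> openin S P"
  and chart_image_open: "(P, c) \<in> C \<Longrightarrow> openin model (c ` P)"
  and chart_homeomorphic: "(P, c) \<in> C \<Longrightarrow> homeomorphic_map (subtopology S P) (subtopology model (c ` P)) c"
  using chart by (auto simp: topological_chart_def)

lemma chart_inj: "(P, c) \<in> C \<Longrightarrow> inj_on c P"
  using homeomorphic_imp_injective_map[OF chart_homeomorphic] openin_subset[OF chart_open]
  by (simp add: Int_absorb1)

lemma chart_in_model: "(P, c) \<in> C \<Longrightarrow> q \<in> P \<Longrightarrow> c q \<in> topspace model"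
  using openin_subset[OF chart_image_open] by auto

lemma open_chart_image:
  assumes "(P, c) \<in> C" "openin S Q"
  shows "openin model (c ` (P \<inter> Q))"
proof -
  have "openin (subtopology S P) (P \<inter> Q)"
    using assms(2) by (auto simp: openin_subtopology)
  then have "openin (subtopology model (c ` P)) (c ` (P \<inter> Q))"
    using homeomorphic_map_openness[OF chart_homeomorphic[OF assms(1)]] openin_subset by blast
  then show ?thesis
    using chart_image_open[OF assms(1)] openin_trans_full by blast
qed

text \<open>
  The maps \<open>f\<close> on an open set that, read in charts of the manifold, belong locally to \<open>\<G>\<close>.  With \<open>lines n\<close> these
  are the geodesics, with \<open>L_group n\<close> the local inverses of developing maps.
\<close>

definition charted_on :: "'x topology \<Rightarrow> ('x \<Rightarrow> nat \<Rightarrow> real) set \<Rightarrow> 'x set \<Rightarrow> ('x \<Rightarrow> 'a) \<Rightarrow> bool" where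
  "charted_on X \<G> W f \<longleftrightarrow>
     (\<forall>z\<in>W. \<exists>(P, c)\<in>C. \<exists>g\<in>\<G>. \<exists>N. openin X N \<and> z \<in> N \<and> N \<subseteq> W \<and> (\<forall>w\<in>N. f w \<in> P \<and> c (f w) = g w))"

lemma charted_onE:
  assumes "charted_on X \<G> W f" "z \<in> W"
  obtains P c g N where "(P, c) \<in> C" "g \<in> \<G>" "openin X N" "z \<in> N" "N \<subseteq> W"
    "\<And>w. w \<in> N \<Longrightarrow> f w \<in> P" "\<And>w. w \<in> N \<Longrightarrow> c (f w) = g w"
proof -
  obtain x where "x \<in> C" and x: "case x of (P, c) \<Rightarrow> \<exists>g\<in>\<G>. \<exists>N. openin X N \<and> z \<in> N \<and> N \<subseteq> W \<and> (\<forall>w\<in>N. f w \<in> P \<and> c (f w) = g w)"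
    by (rule bexE[OF bspec[OF assms(1)[unfolded charted_on_def] assms(2)]])
  obtain P c where "x = (P, c)" by (cases x)
  with x obtain g N where "g \<in> \<G>" "openin X N" "z \<in> N" "N \<subseteq> W" "\<forall>w\<in>N. f w \<in> P \<and> c (f w) = g w"
    by auto
  with \<open>x \<in> C\<close> \<open>x = (P, c)\<close> show thesis using that by blast
qed

lemma charted_onI:
  assumes "\<And>z. z \<in> W \<Longrightarrow> \<exists>P c g N. (P, c) \<in> C \<and> g \<in> \<G> \<and> openin X N \<and> z \<in> N \<and> N \<subseteq> W \<and>
    (\<forall>w\<in>N. f w \<in> P \<and> c (f w) = g w)"
  shows "charted_on X \<G> W f"
  unfolding charted_on_def
proof
  fix z assume "z \<in> W"
  from assms[OF this] obtain P c g N where "(P, c) \<in> C" "g \<in> \<G>" "openin X N" "z \<in> N" "N \<subseteq> W"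
    "\<forall>w\<in>N. f w \<in> P \<and> c (f w) = g w" by blast
  then show "\<exists>(P, c)\<in>C. \<exists>g\<in>\<G>. \<exists>N. openin X N \<and> z \<in> N \<and> N \<subseteq> W \<and> (\<forall>w\<in>N. f w \<in> P \<and> c (f w) = g w)"
    by (intro bexI[of _ "(P, c)"]) auto
qed

lemma charted_on_in_topspace:
  assumes "charted_on X \<G> W f" "z \<in> W"
  shows "f z \<in> topspace S"
proof (rule charted_onE[OF assms])
  fix P c g N assume "(P, c) \<in> C" "z \<in> N" "\<And>w. w \<in> N \<Longrightarrow> f w \<in> P"
  then show ?thesis using openin_subset[OF chart_open] by blast
qed

lemma charted_on_openin:
  assumes "charted_on X \<G> W f"
  shows "openin X W"
proof (subst openin_subopen, intro ballI)
  fix z assume "z \<in> W"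
  with assms show "\<exists>N. openin X N \<and> z \<in> N \<and> N \<subseteq> W" by (elim charted_onE) blast+
qed

lemma charted_on_subset:
  assumes "charted_on X \<G> W f" "openin X V" "V \<subseteq> W"
  shows "charted_on X \<G> V f"
proof (rule charted_onI)
  fix z assume "z \<in> V"
  then have "z \<in> W" using assms(3) by blast
  obtain P c g N where "(P, c) \<in> C" "g \<in> \<G>" "openin X N" "z \<in> N" "N \<subseteq> W"
    "\<And>w. w \<in> N \<Longrightarrow> f w \<in> P" "\<And>w. w \<in> N \<Longrightarrow> c (f w) = g w"
    by (rule charted_onE[OF assms(1) \<open>z \<in> W\<close>], rule that)
  then show "\<exists>P c g N. (P, c) \<in> C \<and> g \<in> \<G> \<and> openin X N \<and> z \<in> N \<and> N \<subseteq> V \<and> (\<forall>w\<in>N. f w \<in> P \<and> c (f w) = g w)"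
    using \<open>z \<in> V\<close> assms(2) by (intro exI[of _ P] exI[of _ c] exI[of _ g] exI[of _ "N \<inter> V"]) auto
qed

lemma charted_on_chart:
  assumes "(P, c) \<in> C" "g \<in> \<G>" "openin X W" "\<And>w. w \<in> W \<Longrightarrow> f w \<in> P" "\<And>w. w \<in> W \<Longrightarrow> c (f w) = g w"
  shows "charted_on X \<G> W f"
proof (rule charted_onI)
  fix z assume "z \<in> W"
  with assms show "\<exists>P c g N. (P, c) \<in> C \<and> g \<in> \<G> \<and> openin X N \<and> z \<in> N \<and> N \<subseteq> W \<and> (\<forall>w\<in>N. f w \<in> P \<and> c (f w) = g w)"
    by (intro exI[of _ P] exI[of _ c] exI[of _ g] exI[of _ W]) auto
qed

lemma charted_on_cong:
  assumes "charted_on X \<G> W f" "\<And>w. w \<in> W \<Longrightarrow> f' w = f w"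
  shows "charted_on X \<G> W f'"
proof (rule charted_onI)
  fix z assume "z \<in> W"
  obtain P c g N where "(P, c) \<in> C" "g \<in> \<G>" "openin X N" "z \<in> N" "N \<subseteq> W"
    "\<And>w. w \<in> N \<Longrightarrow> f w \<in> P" "\<And>w. w \<in> N \<Longrightarrow> c (f w) = g w"
    by (rule charted_onE[OF assms(1) \<open>z \<in> W\<close>], rule that)
  then show "\<exists>P c g N. (P, c) \<in> C \<and> g \<in> \<G> \<and> openin X N \<and> z \<in> N \<and> N \<subseteq> W \<and> (\<forall>w\<in>N. f' w \<in> P \<and> c (f' w) = g w)"
    using assms(2) by (intro exI[of _ P] exI[of _ c] exI[of _ g] exI[of _ N]) (auto simp: subset_iff)
qed

lemma charted_on_preimage_open:
  assumes "continuation_family n X \<G>" "charted_on X \<G> W f" "openin S Q"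
  shows "openin X {w \<in> W. f w \<in> Q}"
proof (subst openin_subopen, intro ballI)
  fix z assume z: "z \<in> {w \<in> W. f w \<in> Q}"
  then have "z \<in> W" by simp
  obtain P c g N where *: "(P, c) \<in> C" "g \<in> \<G>" "openin X N" "z \<in> N" "N \<subseteq> W"
    "\<And>w. w \<in> N \<Longrightarrow> f w \<in> P" "\<And>w. w \<in> N \<Longrightarrow> c (f w) = g w"
    by (rule charted_onE[OF assms(2) \<open>z \<in> W\<close>], rule that)
  let ?N = "N \<inter> {w \<in> topspace X. g w \<in> c ` (P \<inter> Q)}"
  have "continuous_map X model g"
    using assms(1) *(2) by (auto simp: continuation_family_def)
  then have "openin X ?N"
    using open_chart_image[OF *(1) assms(3)] *(3) by (intro openin_Int openin_continuous_map_preimage)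
  moreover have "z \<in> ?N" using z *(3,4,6) openin_subset[OF *(3)] by (auto simp: *(7)[symmetric])
  moreover have "f w \<in> Q" if "w \<in> ?N" for w
  proof -
    from that have "w \<in> N" "g w \<in> c ` (P \<inter> Q)" by auto
    then obtain q where q: "q \<in> P \<inter> Q" "g w = c q" by blast
    have "f w = q"
      using q *(6,7)[OF \<open>w \<in> N\<close>] by (intro inj_onD[OF chart_inj[OF *(1)]]) auto
    then show ?thesis using q by simp
  qed
  ultimately show "\<exists>N. openin X N \<and> z \<in> N \<and> N \<subseteq> {w \<in> W. f w \<in> Q}" using *(5) by (intro exI[of _ ?N]) auto
qed

text \<open>
  Any chart around the image point may be used, because \<open>\<G>\<close> is stable under transition maps.
\<close>

lemma charted_on_in_chart:
  assumes X: "continuation_family n X \<G>" and f: "charted_on X \<G> W f" and z: "z \<in> W" "f z \<in> Q" and d: "(Q, d) \<in> C"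
  obtains g N where "g \<in> \<G>" "openin X N" "z \<in> N" "N \<subseteq> W"
    "\<And>w. w \<in> N \<Longrightarrow> f w \<in> Q" "\<And>w. w \<in> N \<Longrightarrow> d (f w) = g w"
proof -
  obtain P c g N where *: "(P, c) \<in> C" "g \<in> \<G>" "openin X N" "z \<in> N" "N \<subseteq> W"
    "\<And>w. w \<in> N \<Longrightarrow> f w \<in> P" "\<And>w. w \<in> N \<Longrightarrow> c (f w) = g w"
    by (rule charted_onE[OF f z(1)], rule that)
  obtain h where h: "h \<in> L_group n" "\<And>q. q \<in> P \<Longrightarrow> q \<in> Q \<Longrightarrow> d q = h (c q)"
    using transition[OF *(1) d] by auto
  obtain g' where g': "g' \<in> \<G>" "\<And>x. x \<in> topspace X \<Longrightarrow> g' x = h (g x)"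
    by (rule continuation_family_comp[OF X *(2) h(1)], rule that)
  let ?N = "N \<inter> {w \<in> W. f w \<in> Q}"
  have "openin X ?N"
    using *(3) charted_on_preimage_open[OF X f chart_open[OF d]] by auto
  then show thesis
  proof (rule that[OF g'(1)])
    fix w assume w: "w \<in> ?N"
    then have "d (f w) = h (c (f w))" using h(2) *(6) by auto
    also have "\<dots> = g' w" using w *(7) g'(2) openin_subset[OF *(3)] by auto
    finally show "d (f w) = g' w" .
  qed (use *(4) z in auto)
qed

text \<open>
  Let \<open>A\<close> be the interior of the set where the maps agree.  At a limit point of \<open>A\<close> the maps agree since
  \<open>S\<close> is Hausdorff; read in a common chart they are members of \<open>\<G>\<close> that agree on a nonempty open set, hence
  near that point.  So \<open>A\<close> is closed in the connected set \<open>W\<close>.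
\<close>

lemma charted_on_unique:
  assumes X: "continuation_family n X \<G>"
    and f: "charted_on X \<G> W\<^sub>1 f" "charted_on X \<G> W\<^sub>2 f'"
    and W: "openin X W" "connectedin X W" "W \<subseteq> W\<^sub>1" "W \<subseteq> W\<^sub>2"
    and D: "openin X D" "D \<noteq> {}" "D \<subseteq> W" "\<And>x. x \<in> D \<Longrightarrow> f x = f' x"
    and "x \<in> W"
  shows "f x = f' x"
proof -
  define A where "A = \<Union>{N. openin X N \<and> N \<subseteq> W \<and> (\<forall>w\<in>N. f w = f' w)}"
  define B where "B = \<Union>{N. openin X N \<and> N \<subseteq> W \<and> N \<inter> A = {}}"
  have "openin X A" "openin X B" by (auto simp: A_def B_def)
  have "W \<subseteq> A \<union> B"
  proof
    fix z assume z: "z \<in> W"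
    then have z1: "z \<in> W\<^sub>1" and z2: "z \<in> W\<^sub>2" using W(3,4) by auto
    show "z \<in> A \<union> B"
    proof (cases "f z = f' z")
      case True
      obtain P c g\<^sub>1 N\<^sub>1 where 1: "(P, c) \<in> C" "g\<^sub>1 \<in> \<G>" "openin X N\<^sub>1" "z \<in> N\<^sub>1" "N\<^sub>1 \<subseteq> W\<^sub>1"
        "\<And>w. w \<in> N\<^sub>1 \<Longrightarrow> f w \<in> P" "\<And>w. w \<in> N\<^sub>1 \<Longrightarrow> c (f w) = g\<^sub>1 w"
        by (rule charted_onE[OF f(1) z1], rule that)
      have f'P: "f' z \<in> P" using 1(4,6) True by force
      obtain g\<^sub>2 N\<^sub>2 where 2: "g\<^sub>2 \<in> \<G>" "openin X N\<^sub>2" "z \<in> N\<^sub>2"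
        "\<And>w. w \<in> N\<^sub>2 \<Longrightarrow> f' w \<in> P" "\<And>w. w \<in> N\<^sub>2 \<Longrightarrow> c (f' w) = g\<^sub>2 w"
        by (rule charted_on_in_chart[OF X f(2) z2 f'P 1(1)], rule that)
      let ?N = "N\<^sub>1 \<inter> N\<^sub>2 \<inter> W"
      have N: "openin X ?N" "z \<in> ?N" using 1 2 W z by auto
      show ?thesis
      proof (cases "?N \<inter> A = {}")
        case True
        then have "z \<in> B" using N unfolding B_def by blast
        then show ?thesis ..
      next
        case False
        then obtain N' where N': "openin X N'" "\<forall>w\<in>N'. f w = f' w" "?N \<inter> N' \<noteq> {}"
          unfolding A_def by blast
        have "g\<^sub>1 w = g\<^sub>2 w" if "w \<in> ?N \<inter> N'" for w
          using that 1(7) 2(5) N'(2) by (metis IntD1 IntD2)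
        moreover have "openin X (?N \<inter> N')" using N N' by blast
        moreover obtain z' where "z' \<in> ?N \<inter> N'" using N'(3) by auto
        ultimately have "\<forall>w\<in>topspace X. g\<^sub>1 w = g\<^sub>2 w"
          using continuation_family_eq[OF X 1(2) 2(1), of "?N \<inter> N'" z'] by blast
        then have "c (f w) = c (f' w)" if "w \<in> ?N" for w
          using that 1(3,7) 2(5) openin_subset by (metis IntD1 IntD2 subsetD)
        then have "\<forall>w\<in>?N. f w = f' w"
          using 1(6) 2(4) chart_inj[OF 1(1)] by (meson IntD1 IntD2 inj_onD)
        then have "z \<in> A" using N unfolding A_def by blast
        then show ?thesis ..
      qed
    next
      case False
      have "f z \<in> topspace S" by (rule charted_on_in_topspace[OF f(1) z1])
      moreover have "f' z \<in> topspace S" by (rule charted_on_in_topspace[OF f(2) z2])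
      ultimately      obtain Q Q' where Q: "openin S Q" "openin S Q'" "f z \<in> Q" "f' z \<in> Q'" "disjnt Q Q'"
        using hausdorff False unfolding Hausdorff_space_def by blast
      let ?N = "W \<inter> {w \<in> W\<^sub>1. f w \<in> Q} \<inter> {w \<in> W\<^sub>2. f' w \<in> Q'}"
      have "openin X ?N"
        using W(1) charted_on_preimage_open[OF X] f Q(1,2) by blast
      moreover have "?N \<inter> A = {}" using Q(5) unfolding A_def disjnt_def by fastforce
      moreover have "z \<in> ?N" using z W Q by auto
      ultimately have "z \<in> B" unfolding B_def by blast
      then show ?thesis ..
    qed
  qed
  moreover have "A \<inter> B \<inter> W = {}" by (auto simp: B_def)
  moreover have "D \<subseteq> A" using D(1,3,4) unfolding A_def by blast
  then have "A \<inter> W \<noteq> {}" using D(2,3) by blast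
  ultimately have "B \<inter> W = {}"
    using W(2) \<open>openin X A\<close> \<open>openin X B\<close> unfolding connectedin by blast
  then have "x \<in> A" using \<open>x \<in> W\<close> \<open>W \<subseteq> A \<union> B\<close> by blast
  then show ?thesis by (auto simp: A_def)
qed

lemma charted_on_glue:
  assumes f: "\<And>i. i \<in> I \<Longrightarrow> charted_on X \<G> (W i) (f i)"
    and agree: "\<And>i j x. i \<in> I \<Longrightarrow> j \<in> I \<Longrightarrow> x \<in> W i \<Longrightarrow> x \<in> W j \<Longrightarrow> f i x = f j x"
  obtains F where "charted_on X \<G> (\<Union>i\<in>I. W i) F" "\<And>i x. i \<in> I \<Longrightarrow> x \<in> W i \<Longrightarrow> F x = f i x"
proof
  define F where "F x = f (SOME i. i \<in> I \<and> x \<in> W i) x" for x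
  show F: "F x = f i x" if "i \<in> I" "x \<in> W i" for i x
    using someI[of "\<lambda>i. i \<in> I \<and> x \<in> W i" i] that agree unfolding F_def by blast
  show "charted_on X \<G> (\<Union>i\<in>I. W i) F"
  proof (rule charted_onI)
    fix z assume "z \<in> (\<Union>i\<in>I. W i)"
    then obtain i where i: "i \<in> I" "z \<in> W i" by blast
    have Fi: "charted_on X \<G> (W i) F" by (rule charted_on_cong[OF f[OF i(1)] F[OF i(1)]])
    obtain P c g N where "(P, c) \<in> C" "g \<in> \<G>" "openin X N" "z \<in> N" "N \<subseteq> W i"
      "\<And>w. w \<in> N \<Longrightarrow> F w \<in> P" "\<And>w. w \<in> N \<Longrightarrow> c (F w) = g w"
      by (rule charted_onE[OF Fi i(2)], rule that)
    then show "\<exists>P c g N. (P, c) \<in> C \<and> g \<in> \<G> \<and> openin X N \<and> z \<in> N \<and> N \<subseteq> (\<Union>i\<in>I. W i) \<and>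
        (\<forall>w\<in>N. F w \<in> P \<and> c (F w) = g w)"
      using i(1) by blast
  qed
qed

text \<open>
  A coordinate function with constant derivative on an interval is affine.
\<close>

lemma affine_geodesic_iff:
  "affine_geodesic (n + 1) C I \<gamma> \<longleftrightarrow>
    open I \<and> is_interval I \<and> I \<noteq> {} \<and> charted_on euclideanreal (lines n) I \<gamma>" (is "?L \<longleftrightarrow> ?R")
proof
  assume L: ?L
  have "charted_on euclideanreal (lines n) I \<gamma>"
  proof (rule charted_onI)
    fix s assume "s \<in> I"
    with L obtain x where x: "x \<in> C" "case x of (P, c) \<Rightarrow> \<exists>J v. s \<in> J \<and> J \<subseteq> I \<and> open J \<and> \<gamma> ` J \<subseteq> P \<and>
        (\<forall>u\<in>J. \<forall>i<n + 1. ((\<lambda>r. c (\<gamma> r) i) has_real_derivative v i) (at u))"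
      unfolding affine_geodesic_def by blast
    obtain P c where Pc: "x = (P, c)" by (cases x)
    with x(2) obtain J v where "s \<in> J \<and> J \<subseteq> I \<and> open J \<and> \<gamma> ` J \<subseteq> P \<and>
        (\<forall>u\<in>J. \<forall>i<n + 1. ((\<lambda>r. c (\<gamma> r) i) has_real_derivative v i) (at u))" by auto
    with x(1) Pc have *: "(P, c) \<in> C" "s \<in> J" "J \<subseteq> I" "open J" "\<gamma> ` J \<subseteq> P"
      "\<And>u i. u \<in> J \<Longrightarrow> i < n + 1 \<Longrightarrow> ((\<lambda>r. c (\<gamma> r) i) has_real_derivative v i) (at u)"
      by auto
    obtain e where e: "e > 0" "ball s e \<subseteq> J" using *(2,4) open_contains_ball by blast
    define a where "a = (\<lambda>i. if i < n + 1 then c (\<gamma> s) i - s * v i else 0)"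
    define b where "b = (\<lambda>i. if i < n + 1 then c (\<gamma> s) i + (1 - s) * v i else 0)"
    have "c (\<gamma> r) = lerp a b r" if r: "r \<in> ball s e" for r
    proof
      fix i
      show "c (\<gamma> r) i = lerp a b r i"
      proof (cases "i < n + 1")
        case True
        have "c (\<gamma> r) i - v i * r = c (\<gamma> s) i - v i * s"
        proof (rule DERIV_isconst3[of "s - e" "s + e" r s "\<lambda>r. c (\<gamma> r) i - v i * r"])
          show "((\<lambda>r. c (\<gamma> r) i - v i * r) has_real_derivative 0) (at u)" if "u \<in> {s - e<..<s + e}" for u
          proof -
            have "u \<in> J" using that e(2) by (auto simp: dist_real_def)
            then show ?thesis using *(6)[of u i] True by (auto intro!: derivative_eq_intros)
          qed
        qed (use r e(1) in \<open>auto simp: dist_real_def\<close>)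
        then show ?thesis using True by (simp add: lerp_def a_def b_def algebra_simps)
      next
        case False
        have "\<gamma> r \<in> P" using r e(2) *(5) by blast
        from chart_in_model[OF *(1) this] show ?thesis
          using False by (simp add: topspace_Euclidean_space lerp_def a_def b_def)
      qed
    qed
    moreover have "\<gamma> r \<in> P" if "r \<in> ball s e" for r using that e(2) *(5) by blast
    moreover have "a \<in> topspace model" "b \<in> topspace model"
      by (auto simp: topspace_Euclidean_space a_def b_def)
    then have "lerp a b \<in> lines n" unfolding lines_def by blast
    ultimately show "\<exists>P c g N. (P, c) \<in> C \<and> g \<in> lines n \<and> openin euclideanreal N \<and> s \<in> N \<and> N \<subseteq> I \<and>
        (\<forall>w\<in>N. \<gamma> w \<in> P \<and> c (\<gamma> w) = g w)"
      using * e by (intro exI[of _ P] exI[of _ c] exI[of _ "lerp a b"] exI[of _ "ball s e"]) auto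
  qed
  with L show ?R by (simp add: affine_geodesic_def)
next
  assume R: ?R
  have "\<exists>(P, c)\<in>C. \<exists>J v. s \<in> J \<and> J \<subseteq> I \<and> open J \<and> \<gamma> ` J \<subseteq> P \<and>
        (\<forall>u\<in>J. \<forall>i<n + 1. ((\<lambda>r. c (\<gamma> r) i) has_real_derivative v i) (at u))" if s: "s \<in> I" for s
  proof -
    have \<gamma>: "charted_on euclideanreal (lines n) I \<gamma>" using R by blast
    obtain P c g N where *: "(P, c) \<in> C" "g \<in> lines n" "openin euclideanreal N" "s \<in> N" "N \<subseteq> I"
      "\<And>w. w \<in> N \<Longrightarrow> \<gamma> w \<in> P" "\<And>w. w \<in> N \<Longrightarrow> c (\<gamma> w) = g w"
      by (rule charted_onE[OF \<gamma> s], rule that)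
    obtain a b where g: "g = lerp a b" using *(2) by (auto simp: lines_def)
    have "((\<lambda>r. c (\<gamma> r) i) has_real_derivative b i - a i) (at u)" if "u \<in> N" for u i
    proof (rule has_field_derivative_transform_within_open)
      show "((\<lambda>r. lerp a b r i) has_real_derivative b i - a i) (at u)"
        unfolding lerp_def by (auto intro!: derivative_eq_intros)
    qed (use * that g in auto)
    then show ?thesis
      using * by (intro bexI[of _ "(P, c)"]) (auto intro!: exI[of _ N] exI[of _ "\<lambda>i. b i - a i"])
  qed
  then show ?L using R by (simp add: affine_geodesic_def)
qed

end

section \<open>Complete leaves have complete geodesics\<close>

text \<open>
  Compact intervals with the lifting property for arbitrary base points are closed under concatenation,
  and short intervals have it because their image lies in an evenly covered set.
\<close>

lemma covering_map_of_lift_interval: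
  fixes l :: "real \<Rightarrow> 'b"
  assumes p: "covering_map_of E X p" and l: "continuous_map euclideanreal X l"
    and e: "e \<in> topspace E" "p e = l r" and r: "r \<in> {a..b}"
  obtains \<sigma> where "continuous_map (top_of_set {a..b}) E \<sigma>" "\<sigma> r = e" "\<And>s. s \<in> {a..b} \<Longrightarrow> p (\<sigma> s) = l s"
proof -
  define Q where "Q a b \<longleftrightarrow> (\<forall>r\<in>{a..b}. \<forall>e\<in>topspace E. p e = l r \<longrightarrow>
    (\<exists>\<sigma>. continuous_map (top_of_set {a..b}) E \<sigma> \<and> \<sigma> r = e \<and> (\<forall>s\<in>{a..b}. p (\<sigma> s) = l s)))" for a b
  have join: "\<exists>\<sigma>. continuous_map (top_of_set {a..c}) E \<sigma> \<and> (\<forall>s\<in>{a..b}. \<sigma> s = \<sigma>\<^sub>1 s) \<and> (\<forall>s\<in>{b..c}. \<sigma> s = \<sigma>\<^sub>2 s)"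
    if "continuous_map (top_of_set {a..b}) E \<sigma>\<^sub>1" "continuous_map (top_of_set {b..c}) E \<sigma>\<^sub>2"
      "\<sigma>\<^sub>1 b = \<sigma>\<^sub>2 b" "a \<le> b" "b \<le> c" for a b c :: real and \<sigma>\<^sub>1 \<sigma>\<^sub>2
  proof (intro exI conjI)
    have 1: "{a..c} \<inter> {x. a \<le> x \<and> x \<le> c \<and> x \<le> b} = {a..b}"
      and 2: "{a..c} \<inter> {x. a \<le> x \<and> x \<le> c \<and> b \<le> x} = {b..c}" using that(4,5) by auto
    show "continuous_map (top_of_set {a..c}) E (\<lambda>s. if s \<le> b then \<sigma>\<^sub>1 s else \<sigma>\<^sub>2 s)"
      by (rule continuous_map_cases_le) (use that in \<open>auto simp: subtopology_subtopology 1 2\<close>)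
  qed (use that in auto)
  have "a \<le> b" using r by simp
  then have "Q a b"
  proof (induction rule: Bolzano)
    case (trans a b c)
    show ?case
      unfolding Q_def
    proof (intro ballI impI)
      fix r e assume r: "r \<in> {a..c}" and e: "e \<in> topspace E" "p e = l r"
      show "\<exists>\<sigma>. continuous_map (top_of_set {a..c}) E \<sigma> \<and> \<sigma> r = e \<and> (\<forall>s\<in>{a..c}. p (\<sigma> s) = l s)"
      proof (cases "r \<le> b")
        case True
        then obtain \<sigma>\<^sub>1 where 1: "continuous_map (top_of_set {a..b}) E \<sigma>\<^sub>1" "\<sigma>\<^sub>1 r = e" "\<forall>s\<in>{a..b}. p (\<sigma>\<^sub>1 s) = l s"
          using trans(1) e r unfolding Q_def by (metis atLeastAtMost_iff)
        then have "\<sigma>\<^sub>1 b \<in> topspace E" "p (\<sigma>\<^sub>1 b) = l b"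
          using trans(3) by (auto simp: continuous_map_def Pi_iff)
        then obtain \<sigma>\<^sub>2 where 2: "continuous_map (top_of_set {b..c}) E \<sigma>\<^sub>2" "\<sigma>\<^sub>2 b = \<sigma>\<^sub>1 b" "\<forall>s\<in>{b..c}. p (\<sigma>\<^sub>2 s) = l s"
          using trans(2,4) unfolding Q_def by (metis atLeastAtMost_iff order_refl)
        obtain \<sigma> where "continuous_map (top_of_set {a..c}) E \<sigma>" "\<forall>s\<in>{a..b}. \<sigma> s = \<sigma>\<^sub>1 s" "\<forall>s\<in>{b..c}. \<sigma> s = \<sigma>\<^sub>2 s"
          using join[OF 1(1) 2(1) 2(2)[symmetric] trans(3,4)] by blast
        moreover have "{a..c} = {a..b} \<union> {b..c}" using trans(3,4) by auto
        ultimately show ?thesis using 1 2 True r by (intro exI[of _ \<sigma>]) auto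
      next
        case False
        then obtain \<sigma>\<^sub>2 where 2: "continuous_map (top_of_set {b..c}) E \<sigma>\<^sub>2" "\<sigma>\<^sub>2 r = e" "\<forall>s\<in>{b..c}. p (\<sigma>\<^sub>2 s) = l s"
          using trans(2) e r unfolding Q_def by (metis atLeastAtMost_iff linear)
        then have "\<sigma>\<^sub>2 b \<in> topspace E" "p (\<sigma>\<^sub>2 b) = l b"
          using trans(4) by (auto simp: continuous_map_def Pi_iff)
        then obtain \<sigma>\<^sub>1 where 1: "continuous_map (top_of_set {a..b}) E \<sigma>\<^sub>1" "\<sigma>\<^sub>1 b = \<sigma>\<^sub>2 b" "\<forall>s\<in>{a..b}. p (\<sigma>\<^sub>1 s) = l s"
          using trans(1,3) unfolding Q_def by (metis atLeastAtMost_iff order_refl)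
        obtain \<sigma> where "continuous_map (top_of_set {a..c}) E \<sigma>" "\<forall>s\<in>{a..b}. \<sigma> s = \<sigma>\<^sub>1 s" "\<forall>s\<in>{b..c}. \<sigma> s = \<sigma>\<^sub>2 s"
          using join[OF 1(1) 2(1) 1(2) trans(3,4)] by blast
        moreover have "{a..c} = {a..b} \<union> {b..c}" using trans(3,4) by auto
        ultimately show ?thesis using 1 2 False r by (intro exI[of _ \<sigma>]) auto
      qed
    qed
  next
    case (local x)
    have "l x \<in> topspace X" using l by (auto simp: continuous_map_def)
    then obtain W \<V> where W: "l x \<in> W" "openin X W" "\<Union>\<V> = {e \<in> topspace E. p e \<in> W}"
      "\<And>V. V \<in> \<V> \<Longrightarrow> homeomorphic_map (subtopology E V) (subtopology X W) p"
      using p unfolding covering_map_of_def by metis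
    have "open {s. l s \<in> W}"
      using openin_continuous_map_preimage[OF l W(2)] by simp
    then obtain d where d: "d > 0" "ball x d \<subseteq> {s. l s \<in> W}"
      using W(1) open_contains_ball by blast
    have "Q a b" if ab: "a \<le> x" "x \<le> b" "b - a < d" for a b
      unfolding Q_def
    proof (intro ballI impI)
      fix r e assume r: "r \<in> {a..b}" and e: "e \<in> topspace E" "p e = l r"
      have lW: "l s \<in> W" if "s \<in> {a..b}" for s
        using that ab d(2) by (auto simp: dist_real_def subset_iff)
      then have "e \<in> \<Union>\<V>" using W(3) e r by auto
      then obtain V where V: "V \<in> \<V>" "e \<in> V" by auto
      obtain q where q: "homeomorphic_maps (subtopology E V) (subtopology X W) p q"
        using W(4)[OF V(1)] by (auto simp: homeomorphic_map_maps)
      have "continuous_map (top_of_set {a..b}) (subtopology X W) l"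
        using l lW by (auto simp: continuous_map_in_subtopology intro: continuous_map_from_subtopology)
      then have "continuous_map (top_of_set {a..b}) (subtopology E V) (q \<circ> l)"
        using q by (auto simp: homeomorphic_maps_def intro: continuous_map_compose)
      then have "continuous_map (top_of_set {a..b}) E (q \<circ> l)"
        by (simp add: continuous_map_in_subtopology)
      moreover have "(q \<circ> l) r = e"
        using q V(2) e by (auto simp: homeomorphic_maps_def e(2)[symmetric])
      moreover have "p ((q \<circ> l) s) = l s" if "s \<in> {a..b}" for s
        using q lW[OF that] openin_subset[OF W(2)] by (auto simp: homeomorphic_maps_def)
      ultimately show "\<exists>\<sigma>. continuous_map (top_of_set {a..b}) E \<sigma> \<and> \<sigma> r = e \<and> (\<forall>s\<in>{a..b}. p (\<sigma> s) = l s)"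
        by blast
    qed
    then show ?case using d(1) by blast
  qed
  then obtain \<sigma> where "continuous_map (top_of_set {a..b}) E \<sigma>" "\<sigma> r = e" "\<forall>s\<in>{a..b}. p (\<sigma> s) = l s"
    using r e unfolding Q_def by blast
  then show thesis using that by blast
qed

context L_structure
begin

lemma developing_mapE:
  assumes "developing_map (L_group n) C E \<pi> Dev" "e \<in> topspace E"
  obtains P c g W where "(P, c) \<in> C" "g \<in> L_group n" "openin E W" "e \<in> W" "\<pi> ` W \<subseteq> P"
    "\<forall>w\<in>W. Dev w = g (c (\<pi> w))"
proof -
  from bspec[OF assms(1)[unfolded developing_map_def] assms(2)] obtain W where W: "e \<in> W" "openin E W"
    "\<exists>(P, c)\<in>C. \<exists>g\<in>L_group n. \<pi> ` W \<subseteq> P \<and> (\<forall>w\<in>W. Dev w = g (c (\<pi> w)))"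
    by (elim exE conjE) (rule that)
  from W(3) obtain x where x: "x \<in> C" "case x of (P, c) \<Rightarrow> \<exists>g\<in>L_group n. \<pi> ` W \<subseteq> P \<and> (\<forall>w\<in>W. Dev w = g (c (\<pi> w)))"
    by (rule bexE)
  obtain P c where Pc: "x = (P, c)" by (cases x)
  from x(2)[unfolded Pc prod.case] obtain g where g: "g \<in> L_group n" "\<pi> ` W \<subseteq> P" "\<forall>w\<in>W. Dev w = g (c (\<pi> w))"
    by (elim bexE conjE) (rule that)
  have "(P, c) \<in> C" using x(1) Pc by simp
  then show thesis by (rule that[OF _ g(1) W(2,1) g(2,3)])
qed

text \<open>
  Lifting the developed line \<open>l\<close> over each interval \<open>[s\<^sub>0 - m - 1, s\<^sub>0 + m + 1]\<close> and projecting gives geodesics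
  \<open>\<delta> m\<close>.  The lifts for different \<open>m\<close> are chosen independently; their projections are compatible because
  they are geodesics that agree with \<open>\<gamma>\<close> near \<open>s\<^sub>0\<close>.
\<close>

theorem geodesic_extends_if_developing_covering:
  assumes surj: "\<pi> ` topspace E = topspace S"
    and dev: "developing_map (L_group n) C E \<pi> Dev"
    and cov: "covering_map_of E model Dev"
    and I: "is_interval I" "s\<^sub>0 \<in> I" and \<gamma>: "charted_on euclideanreal (lines n) I \<gamma>"
  obtains \<delta> where "charted_on euclideanreal (lines n) UNIV \<delta>" "\<And>s. s \<in> I \<Longrightarrow> \<delta> s = \<gamma> s"
proof -
  note fam = continuation_family_lines[of n]
  have "\<gamma> s\<^sub>0 \<in> topspace S" by (rule charted_on_in_topspace[OF \<gamma> I(2)])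
  then obtain e\<^sub>0 where e0: "e\<^sub>0 \<in> topspace E" "\<pi> e\<^sub>0 = \<gamma> s\<^sub>0" using surj by (metis imageE)
  obtain P\<^sub>0 c\<^sub>0 g\<^sub>0 W\<^sub>0 where W0: "(P\<^sub>0, c\<^sub>0) \<in> C" "g\<^sub>0 \<in> L_group n" "openin E W\<^sub>0" "e\<^sub>0 \<in> W\<^sub>0" "\<pi> ` W\<^sub>0 \<subseteq> P\<^sub>0"
    "\<forall>w\<in>W\<^sub>0. Dev w = g\<^sub>0 (c\<^sub>0 (\<pi> w))"
    by (rule developing_mapE[OF dev e0(1)])
  have "\<gamma> s\<^sub>0 \<in> P\<^sub>0" using W0(4,5) e0(2) by force
  obtain a N where N: "a \<in> lines n" "openin euclideanreal N" "s\<^sub>0 \<in> N" "N \<subseteq> I"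
    "\<And>s. s \<in> N \<Longrightarrow> \<gamma> s \<in> P\<^sub>0" "\<And>s. s \<in> N \<Longrightarrow> c\<^sub>0 (\<gamma> s) = a s"
    by (rule charted_on_in_chart[OF fam \<gamma> I(2) \<open>\<gamma> s\<^sub>0 \<in> P\<^sub>0\<close> W0(1)], rule that)
  obtain l where l: "l \<in> lines n" "\<And>s. l s = g\<^sub>0 (a s)"
    using continuation_family_comp[OF fam N(1) W0(2)] by auto
  have Dev0: "Dev e\<^sub>0 = l s\<^sub>0" using W0(4,6) e0(2) N(3,6) l(2) by simp
  have lc: "continuous_map euclideanreal model l"
    using fam l(1) by (simp add: continuation_family_def)
  define K where "K m = {s\<^sub>0 - real m - 1..s\<^sub>0 + real m + 1}" for m
  define J where "J m = {s\<^sub>0 - real m - 1<..<s\<^sub>0 + real m + 1}" for m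
  have "\<exists>\<sigma>. continuous_map (top_of_set (K m)) E \<sigma> \<and> \<sigma> s\<^sub>0 = e\<^sub>0 \<and> (\<forall>s\<in>K m. Dev (\<sigma> s) = l s)" for m
    unfolding K_def
    by (rule covering_map_of_lift_interval[OF cov lc e0(1) Dev0, of "s\<^sub>0 - real m - 1" "s\<^sub>0 + real m + 1"]) auto
  then obtain \<sigma> where \<sigma>: "\<And>m. continuous_map (top_of_set (K m)) E (\<sigma> m)" "\<And>m. \<sigma> m s\<^sub>0 = e\<^sub>0"
    "\<And>m s. s \<in> K m \<Longrightarrow> Dev (\<sigma> m s) = l s" by metis
  have JK: "J m \<subseteq> K m" for m by (auto simp: J_def K_def)
  have \<sigma>_open: "open {s \<in> J m. \<sigma> m s \<in> W}" if "openin E W" for W m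
  proof -
    have "openin (top_of_set (K m)) {s \<in> topspace (top_of_set (K m)). \<sigma> m s \<in> W}"
      by (rule openin_continuous_map_preimage[OF \<sigma>(1) that])
    then obtain U where U: "open U" "{s \<in> K m. \<sigma> m s \<in> W} = K m \<inter> U" by (auto simp: openin_open)
    have "\<sigma> m s \<in> W \<longleftrightarrow> s \<in> U" if "s \<in> J m" for s
      using eqset_imp_iff[OF U(2), of s] subsetD[OF JK that] by simp
    then have eq: "{s \<in> J m. \<sigma> m s \<in> W} = J m \<inter> U" by auto
    have "open (J m)" by (simp add: J_def)
    then show ?thesis unfolding eq using U(1) by (rule open_Int)
  qed
  define \<delta> where "\<delta> m = \<pi> \<circ> \<sigma> m" for m
  have charted: "charted_on euclideanreal (lines n) (J m) (\<delta> m)" for m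
  proof (rule charted_onI)
    fix s assume s: "s \<in> J m"
    then have "s \<in> K m" using JK by blast
    then have sE: "\<sigma> m s \<in> topspace E" using \<sigma>(1)[of m] by (auto simp: continuous_map_def Pi_iff)
    obtain P c g W where W: "(P, c) \<in> C" "g \<in> L_group n" "openin E W" "\<sigma> m s \<in> W" "\<pi> ` W \<subseteq> P"
      "\<forall>w\<in>W. Dev w = g (c (\<pi> w))" by (rule developing_mapE[OF dev sE])
    obtain h where h: "h \<in> L_group n" "\<And>x. x \<in> topspace model \<Longrightarrow> g (h x) = x"
      "\<And>x. x \<in> topspace model \<Longrightarrow> h (g x) = x"
      by (rule L_group_inverse[OF W(2)], rule that)
    obtain b where b: "b \<in> lines n" "\<And>s. b s = h (l s)"
      using continuation_family_comp[OF fam l(1) h(1)] by auto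
    have "\<delta> m r \<in> P \<and> c (\<delta> m r) = b r" if r: "r \<in> {s \<in> J m. \<sigma> m s \<in> W}" for r
    proof -
      have P: "\<delta> m r \<in> P" using W(5) r by (auto simp: \<delta>_def)
      have "r \<in> K m" using r JK by blast
      then have "l r = g (c (\<delta> m r))" using W(6) r \<sigma>(3)[of r m] by (auto simp: \<delta>_def)
      then show ?thesis using h(3)[OF chart_in_model[OF W(1) P]] b(2) P by simp
    qed
    then show "\<exists>P c g N. (P, c) \<in> C \<and> g \<in> lines n \<and> openin euclideanreal N \<and> s \<in> N \<and> N \<subseteq> J m \<and>
        (\<forall>w\<in>N. \<delta> m w \<in> P \<and> c (\<delta> m w) = g w)"
      using s W(1,4) b(1) \<sigma>_open[OF W(3), of m]
      by (intro exI[of _ P] exI[of _ c] exI[of _ b] exI[of _ "{s \<in> J m. \<sigma> m s \<in> W}"]) auto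
  qed
  define D where "D m = {s \<in> J m. \<sigma> m s \<in> W\<^sub>0} \<inter> N" for m
  have D: "open (D m)" "s\<^sub>0 \<in> D m" "D m \<subseteq> J m" "D m \<subseteq> I" for m
    using \<sigma>_open[OF W0(3), of m] N(2,3,4) W0(4) \<sigma>(2)[of m] by (auto simp: D_def J_def)
  have \<delta>\<gamma>: "\<delta> m s = \<gamma> s" if s: "s \<in> D m" for m s
  proof -
    obtain h where "h \<in> L_group n" "\<And>x. x \<in> topspace model \<Longrightarrow> g\<^sub>0 (h x) = x"
      and h: "\<And>x. x \<in> topspace model \<Longrightarrow> h (g\<^sub>0 x) = x"
      by (rule L_group_inverse[OF W0(2)], rule that)
    have P: "\<delta> m s \<in> P\<^sub>0" "\<gamma> s \<in> P\<^sub>0" using W0(5) N(5) s by (auto simp: \<delta>_def D_def)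
    have "s \<in> K m" using s D(3) JK by blast
    then have "l s = g\<^sub>0 (c\<^sub>0 (\<delta> m s))" using W0(6) s \<sigma>(3)[of s m] by (auto simp: \<delta>_def D_def)
    moreover have "l s = g\<^sub>0 (c\<^sub>0 (\<gamma> s))" using l(2) N(6) s by (simp add: D_def)
    ultimately have "c\<^sub>0 (\<delta> m s) = c\<^sub>0 (\<gamma> s)" using h chart_in_model[OF W0(1)] P by metis
    then show ?thesis using inj_onD[OF chart_inj[OF W0(1)]] P by blast
  qed
  have agree: "\<delta> m s = \<delta> m' s" if "s \<in> J m" "s \<in> J m'" for m m' s
  proof (rule charted_on_unique[OF fam charted charted, of "J m \<inter> J m'" m m' "D m \<inter> D m'"])
    have "convex (J m \<inter> J m')" by (auto simp: J_def intro!: convex_Int)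
    then show "connectedin euclideanreal (J m \<inter> J m')"
      by (simp add: convex_connected)
  next
    show "\<delta> m x = \<delta> m' x" if "x \<in> D m \<inter> D m'" for x using that \<delta>\<gamma> by simp
  next
    show "D m \<inter> D m' \<noteq> {}" using D(2) by blast
  next
    show "openin euclideanreal (J m \<inter> J m')" by (auto simp: J_def)
  qed (use that D in auto)
  obtain F where F: "charted_on euclideanreal (lines n) (\<Union>m\<in>UNIV. J m) F"
      "\<And>m x. m \<in> UNIV \<Longrightarrow> x \<in> J m \<Longrightarrow> F x = \<delta> m x"
    by (rule charted_on_glue[of UNIV, OF charted agree], assumption, assumption, rule that)
  have "(\<Union>m\<in>UNIV. J m) = UNIV"
  proof -
    have "\<exists>m. x \<in> J m" for x
    proof -
      obtain m :: nat where "\<bar>x - s\<^sub>0\<bar> < real m" using reals_Archimedean2 by blast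
      then have "x \<in> J m" by (auto simp: J_def)
      then show ?thesis ..
    qed
    then show ?thesis by auto
  qed
  with F(1) have F1: "charted_on euclideanreal (lines n) UNIV F" by simp
  have "F s = \<gamma> s" if "s \<in> I" for s
  proof (rule charted_on_unique[OF fam F1 \<gamma>, of I "D 0"])
    show "connectedin euclideanreal I" using I(1) by (simp add: is_interval_connected_1)
  next
    show "F x = \<gamma> x" if "x \<in> D 0" for x
      using that F(2)[of 0 x] \<delta>\<gamma>[of x 0] D(3) by auto
  next
    show "D 0 \<noteq> {}" using D(2) by blast
  next
    show "openin euclideanreal I" by (rule charted_on_openin[OF \<gamma>])
  qed (use that D in auto)
  with F1 show thesis using that by blast
qed

end

section \<open>Flowing charts along vertical geodesics\<close>

lemma fun_upd_in_model:
  "x \<in> topspace (Euclidean_space (Suc n)) \<Longrightarrow> x(0 := s) \<in> topspace (Euclidean_space (Suc n))"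
  by (auto simp: topspace_Euclidean_space)

lemma fun_upd_eq_lerp: "x(0 := s) = lerp (x(0 := 0)) (x(0 := 1)) s"
  by (auto simp: lerp_def fun_eq_iff algebra_simps)

lemma fun_upd_in_cylinder: "w \<in> cylinder n x r \<Longrightarrow> w(0 := s) \<in> cylinder n x r"
  by (auto simp: cylinder_def fun_upd_in_model hdist_def)

lemma continuous_map_fun_upd:
  "continuous_map (Euclidean_space (Suc n)) (Euclidean_space (Suc n)) (\<lambda>w. w(0 := s))"
  unfolding continuous_map_into_Euclidean_space
  by (auto simp: fun_upd_in_model continuous_map_coordinate)

text \<open>
  Elements of \<open>L(n)\<close> preserve the field of lines parallel to the \<open>x\<^sub>1\<close>-axis.
\<close>

lemma L_group_fun_upd:
  assumes "g \<in> L_group n" "0 < i"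
  shows "g (x(0 := s)) i = g x i"
proof -
  obtain l \<alpha> A b where "g = L_map n l \<alpha> A b" using assms by (auto simp: L_group_def)
  then show ?thesis using assms(2) by (simp add: L_map_def)
qed

lemma cylinder_in_cube:
  assumes "w \<in> cylinder n x r" "\<bar>w 0 - x 0\<bar> < r"
  shows "w \<in> cube (Suc n) x r"
proof -
  have "\<bar>w i - x i\<bar> < r" if i: "i < Suc n" for i
  proof (cases i)
    case (Suc j)
    then have "\<bar>x (Suc j) - w (Suc j)\<bar> \<le> hdist n x w"
      unfolding hdist_def L2_set_def using i Suc
      by (intro real_le_rsqrt) (auto intro: member_le_sum[of j "{..<n}" "\<lambda>i. (x (Suc i) - w (Suc i))\<^sup>2"])
    with assms(1) Suc show ?thesis by (auto simp: cylinder_def abs_minus_commute)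
  qed (use assms in auto)
  with assms(1) show ?thesis by (auto simp: cube_def cylinder_def)
qed

context L_structure
begin

lemma chart_inv:
  assumes "(P, c) \<in> C" "x \<in> c ` P"
  shows "inv_into P c x \<in> P" "c (inv_into P c x) = x"
  using assms by (auto intro: inv_into_into f_inv_into_f)

lemma charted_on_chart_inv:
  assumes "(P, c) \<in> C" "g \<in> \<G>" "openin X W" "\<And>w. w \<in> W \<Longrightarrow> g w \<in> c ` P"
  shows "charted_on X \<G> W (\<lambda>w. inv_into P c (g w))"
  by (rule charted_on_chart[OF assms(1,2,3)]) (use chart_inv[OF assms(1) assms(4)] in auto)

lemma vertical_line_tangent:
  assumes P: "(P, c) \<in> C" and I: "open I" "\<And>s. s \<in> I \<Longrightarrow> \<gamma> s \<in> P" "\<And>s. s \<in> I \<Longrightarrow> c (\<gamma> s) = y(0 := s)"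
    and charted: "charted_on euclideanreal (lines n) I \<gamma>"
  shows "tangent_to_line_field (n + 1) C I \<gamma>"
  unfolding tangent_to_line_field_def
proof (intro ballI, clarify)
  fix s Q d and i :: nat
  assume s: "s \<in> I" and Q: "(Q, d) \<in> C" "\<gamma> s \<in> Q" and i: "0 < i"
  obtain h where h: "h \<in> L_group n" "\<forall>q\<in>P \<inter> Q. d q = h (c q)"
    using transition[OF P Q(1)] by (rule bexE)
  have o: "open {r \<in> I. \<gamma> r \<in> Q}"
    using charted_on_preimage_open[OF continuation_family_lines charted chart_open[OF Q(1)]] by simp
  show "((\<lambda>r. d (\<gamma> r) i) has_real_derivative 0) (at s)"
  proof (rule has_field_derivative_transform_within_open[of "\<lambda>_. h y i" 0 s])
    fix r assume r: "r \<in> {r \<in> I. \<gamma> r \<in> Q}"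
    then have "d (\<gamma> r) = h (c (\<gamma> r))" using h(2) I(2) by auto
    then show "h y i = d (\<gamma> r) i" using r I(3) L_group_fun_upd[OF h(1) i] by simp
  qed (use s Q(2) o in auto)
qed

end

text \<open>
  The radius \<open>\<eta>\<close> is uniform over the manifold; for leaves of a foliation it comes from the compactness of
  the ambient manifold, although the leaf itself need not be compact.
\<close>

locale vertically_complete_L_structure = L_structure +
  fixes \<eta> :: real
  assumes \<eta>_pos: "\<eta> > 0"
    and uniform_chart: "q \<in> topspace S \<Longrightarrow> \<exists>(P, c)\<in>C. q \<in> P \<and> cube (Suc n) (c q) \<eta> \<subseteq> c ` P"
    and vertical_complete: "affine_geodesic (n + 1) C I \<gamma> \<Longrightarrow> tangent_to_line_field (n + 1) C I \<gamma> \<Longrightarrow>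
      geodesically_complete (n + 1) C I \<gamma>"
begin

lemma vertical_line_extends:
  assumes P: "(P, c) \<in> C" and y: "y \<in> topspace model"
    and I: "open I" "is_interval I" "I \<noteq> {}" "\<And>s. s \<in> I \<Longrightarrow> y(0 := s) \<in> c ` P"
  obtains \<delta> where "charted_on euclideanreal (lines n) UNIV \<delta>"
    "\<And>s. s \<in> I \<Longrightarrow> \<delta> s = inv_into P c (y(0 := s))"
proof -
  let ?\<gamma> = "\<lambda>s. inv_into P c (y(0 := s))"
  have "(\<lambda>s. y(0 := s)) = lerp (y(0 := 0)) (y(0 := 1))" using fun_upd_eq_lerp by blast
  then have "(\<lambda>s. y(0 := s)) \<in> lines n" unfolding lines_def using fun_upd_in_model[OF y] by blast
  then have \<gamma>: "charted_on euclideanreal (lines n) I ?\<gamma>"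
    by (rule charted_on_chart_inv[OF P]) (use I in auto)
  have "affine_geodesic (n + 1) C I ?\<gamma>" using \<gamma> I by (simp only: affine_geodesic_iff simp_thms)
  moreover have "tangent_to_line_field (n + 1) C I ?\<gamma>"
    by (rule vertical_line_tangent[OF P I(1) _ _ \<gamma>]) (use chart_inv[OF P I(4)] in auto)
  ultimately have "geodesically_complete (n + 1) C I ?\<gamma>" by (rule vertical_complete)
  then obtain \<delta> where "affine_geodesic (n + 1) C UNIV \<delta>" "\<forall>s\<in>I. \<delta> s = ?\<gamma> s"
    unfolding geodesically_complete_def by (elim exE conjE) (rule that)
  then show thesis unfolding affine_geodesic_iff using that by blast
qed

text \<open>
  Extend the inverse of the chart by following, through each point of the box, the complete vertical
  geodesic.  On every vertical line, the set of parameters near which the resulting map \<open>F\<close> is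
  locally a chart inverse composed with an element of \<open>L(n)\<close> (the predicate \<open>good\<close>) is open, closed and
  nonempty.  For closedness, a geodesic segment lies in one chart \<open>d\<close>, where \<open>F\<close> is the inverse of \<open>d\<close> after some
  \<open>g\<close> near one point of the segment; by unique continuation of the neighbouring geodesics the same
  formula holds near the whole segment.
\<close>

lemma flow_chart_to_cylinder:
  assumes P: "(P, c) \<in> C" and q: "q \<in> P" and box: "cube (Suc n) (c q) \<eta> \<subseteq> c ` P"
  obtains F where "charted_on model (L_group n) (cylinder n (c q) \<eta>) F"
    "\<And>w. w \<in> cylinder n (c q) \<eta> \<Longrightarrow> \<bar>w 0 - c q 0\<bar> < \<eta> \<Longrightarrow> F w = inv_into P c w"
proof -
  note fam = continuation_family_lines[of n] and famL = continuation_family_L_group[of n]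
  define Z where "Z = cylinder n (c q) \<eta>"
  have Z_open: "openin model Z" by (simp add: Z_def openin_cylinder)
  have Z_sub: "Z \<subseteq> topspace model" by (auto simp: Z_def cylinder_def)
  define I where "I = {c q 0 - \<eta><..<c q 0 + \<eta>}"
  have I: "open I" "is_interval I" "I \<noteq> {}" "c q 0 \<in> I" using \<eta>_pos by (auto simp: I_def is_interval_oo)
  have in_chart: "w(0 := s) \<in> c ` P" if "w \<in> Z" "s \<in> I" for w s
    using that box cylinder_in_cube[of "w(0 := s)" n "c q" \<eta>] fun_upd_in_cylinder
    by (auto simp: Z_def I_def abs_diff_less_iff)
  have "\<exists>\<delta>. charted_on euclideanreal (lines n) UNIV \<delta> \<and> (\<forall>s\<in>I. \<delta> s = inv_into P c (y(0 := s)))"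
    if y: "y \<in> Z" for y
    by (rule vertical_line_extends[OF P subsetD[OF Z_sub y] I(1,2,3) in_chart[OF y]]) auto
  then obtain D where D: "\<And>y. y \<in> Z \<Longrightarrow> charted_on euclideanreal (lines n) UNIV (D y)"
    "\<And>y s. y \<in> Z \<Longrightarrow> s \<in> I \<Longrightarrow> D y s = inv_into P c (y(0 := s))" by metis
  define F where "F w = D (w(0 := 0)) (w 0)" for w
  have F_upd: "F (w(0 := s)) = D (w(0 := 0)) s" for w s by (simp add: F_def)
  have Z_upd: "w(0 := s) \<in> Z" if "w \<in> Z" for w s using that fun_upd_in_cylinder by (simp add: Z_def)
  have F_box: "F w = inv_into P c w" if "w \<in> Z" "w 0 \<in> I" for w
    using D(2)[OF Z_upd[OF that(1)] that(2), of 0] by (simp add: F_def)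
  define good where "good w \<longleftrightarrow> (\<exists>Q d g N. (Q, d) \<in> C \<and> g \<in> L_group n \<and> openin model N \<and> w \<in> N \<and> N \<subseteq> Z \<and>
    (\<forall>v\<in>N. F v \<in> Q \<and> d (F v) = g v))" for w
  have good_box: "good w" if w: "w \<in> Z" "w 0 \<in> I" for w
  proof -
    obtain g where g: "g \<in> L_group n" "\<And>x. x \<in> topspace model \<Longrightarrow> g x = x" using L_group_id by metis
    let ?N = "Z \<inter> {v \<in> topspace model. v 0 \<in> I}"
    have "openin model ?N"
      using Z_open I(1) by (intro openin_Int openin_continuous_map_preimage[OF continuous_map_coordinate]) auto
    moreover have "F v \<in> P \<and> c (F v) = g v" if "v \<in> ?N" for v
    proof -
      have "v \<in> c ` P" using in_chart[of v "v 0"] that by simp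
      then show ?thesis using chart_inv[OF P] F_box g(2) that by auto
    qed
    ultimately show ?thesis unfolding good_def using P g(1) w Z_sub
      by (intro exI[of _ P] exI[of _ c] exI[of _ g] exI[of _ ?N]) auto
  qed
  \<comment> \<open>On \<open>J\<close> the geodesic through \<open>y\<close> stays in one chart, with values in a box \<open>B\<close>; the convexity of \<open>B\<close> controls the
    neighbouring geodesics between the parameters \<open>s\<close> and \<open>t\<close>.\<close>
  have good_local: "\<exists>J. open J \<and> s\<^sub>0 \<in> J \<and> (\<forall>s\<in>J. \<forall>t\<in>J. good (y(0 := s)) \<longrightarrow> good (y(0 := t)))"
    if y: "y \<in> Z" "y 0 = 0" for y s\<^sub>0
  proof -
    have y0: "y(0 := 0) = y" using y(2) by (simp add: fun_eq_iff)
    obtain Q d a N where Q: "(Q, d) \<in> C" and a: "a \<in> lines n" "openin euclideanreal N" "s\<^sub>0 \<in> N" "N \<subseteq> UNIV"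
      "\<And>s. s \<in> N \<Longrightarrow> D y s \<in> Q" "\<And>s. s \<in> N \<Longrightarrow> d (D y s) = a s"
      by (rule charted_onE[OF D(1)[OF y(1)] UNIV_I[of s\<^sub>0]], rule that)
    have "a s\<^sub>0 \<in> d ` Q" using a(3,5,6) by (metis imageI)
    then obtain r where r: "r > 0" "cube (Suc n) (a s\<^sub>0) r \<subseteq> d ` Q"
      by (rule cube_subset_open[OF chart_image_open[OF Q]])
    define B where "B = cube (Suc n) (a s\<^sub>0) r"
    have a_cont: "continuous_map euclideanreal model a"
      using fam a(1) by (simp add: continuation_family_def)
    define J' where "J' = N \<inter> {s \<in> topspace euclideanreal. a s \<in> B}"
    have "open J'" using a(2) openin_continuous_map_preimage[OF a_cont openin_cube] by (simp add: J'_def B_def open_Int)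
    moreover have "a s\<^sub>0 \<in> topspace model" using a_cont by (auto simp: continuous_map_def)
    then have "s\<^sub>0 \<in> J'" using a(3) r(1) by (simp add: J'_def B_def centre_in_cube)
    ultimately obtain e where e: "e > 0" "ball s\<^sub>0 e \<subseteq> J'" using open_contains_ball by blast
    define J where "J = ball s\<^sub>0 e"
    have J: "open J" "s\<^sub>0 \<in> J" "\<And>s. s \<in> J \<Longrightarrow> s \<in> N" "\<And>s. s \<in> J \<Longrightarrow> a s \<in> B"
      using e by (auto simp: J_def J'_def)
    have "good (y(0 := t))" if st: "s \<in> J" "t \<in> J" and "good (y(0 := s))" for s t
    proof -
      obtain Q\<^sub>1 d\<^sub>1 g\<^sub>1 N\<^sub>1 where 1: "(Q\<^sub>1, d\<^sub>1) \<in> C" "g\<^sub>1 \<in> L_group n" "openin model N\<^sub>1" "y(0 := s) \<in> N\<^sub>1" "N\<^sub>1 \<subseteq> Z"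
        "\<forall>v\<in>N\<^sub>1. F v \<in> Q\<^sub>1 \<and> d\<^sub>1 (F v) = g\<^sub>1 v"
        using \<open>good (y(0 := s))\<close> unfolding good_def by (elim exE conjE) (rule that)
      have F1: "charted_on model (L_group n) N\<^sub>1 F"
        by (rule charted_on_chart[OF 1(1,2,3)]) (use 1(6) in auto)
      have Fys: "F (y(0 := s)) \<in> Q" using a(5)[OF J(3)[OF st(1)]] by (simp add: F_upd y0)
      obtain g N' where g: "g \<in> L_group n" and N': "openin model N'" "y(0 := s) \<in> N'" "N' \<subseteq> N\<^sub>1"
        "\<And>w. w \<in> N' \<Longrightarrow> F w \<in> Q" "\<And>w. w \<in> N' \<Longrightarrow> d (F w) = g w"
        by (rule charted_on_in_chart[where f = F and z = "y(0 := s)", OF famL F1 1(4) Fys Q], rule that)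
      have y_model: "y \<in> topspace model" using y(1) Z_sub by blast
      have line: "(\<lambda>s. g (w(0 := s))) \<in> lines n" if "w \<in> topspace model" for w
        using L_group_lerp_in_lines[OF g fun_upd_in_model[OF that] fun_upd_in_model[OF that], of 0 1]
        by (simp flip: fun_upd_eq_lerp)
      have upd_open: "open {r. w(0 := r) \<in> A}" if "w \<in> topspace model" "openin model A" for w A
      proof -
        have "continuous_map euclideanreal model (lerp (w(0 := 0)) (w(0 := 1)))"
          by (intro continuous_map_lerp_line fun_upd_in_model that)
        from openin_continuous_map_preimage[OF this that(2)] show ?thesis
          by (simp flip: fun_upd_eq_lerp)
      qed
      have "(\<lambda>s. g (y(0 := s))) = a"
      proof (rule lines_eq_if_eq_on_open[OF line[OF y_model] a(1)])
        show "open (J \<inter> {r. y(0 := r) \<in> N'})" using J(1) upd_open[OF y_model N'(1)] by (rule open_Int)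
        show "J \<inter> {r. y(0 := r) \<in> N'} \<noteq> {}" using st(1) N'(2) by blast
        fix r assume r: "r \<in> J \<inter> {r. y(0 := r) \<in> N'}"
        then have "g (y(0 := r)) = d (F (y(0 := r)))" using N'(5) by simp
        also have "\<dots> = a r" using a(6) J(3) r by (simp add: F_upd y0)
        finally show "g (y(0 := r)) = a r" .
      qed
      then have ga: "g (y(0 := r)) = a r" for r by (rule fun_cong)
      define R where "R = {w \<in> topspace model. g w \<in> B}"
      have R_open: "openin model R" unfolding R_def B_def
        by (rule openin_continuous_map_preimage[OF continuous_map_L_group[OF g] openin_cube])
      \<comment> \<open>Points whose vertical translate to height \<open>s\<close> lies where \<open>F\<close> is already known to be the inverse of \<open>d\<close> after \<open>g\<close>.\<close>
      define W where "W = R \<inter> Z \<inter> {w \<in> topspace model. w(0 := s) \<in> N' \<inter> R}"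
      have "openin model W" unfolding W_def
        using R_open Z_open N'(1) by (intro openin_Int openin_continuous_map_preimage[OF continuous_map_fun_upd]) auto
      moreover have "y(0 := t) \<in> W"
        unfolding W_def R_def using y(1) N'(2) J(4) st fun_upd_in_model[OF y_model] Z_upd by (auto simp: ga)
      moreover have "F w \<in> Q \<and> d (F w) = g w" if w: "w \<in> W" for w
      proof -
        have wZ: "w \<in> Z" and w_model: "w \<in> topspace model" using w by (auto simp: W_def)
        define u where "u = w(0 := 0)"
        have u: "u \<in> Z" "u \<in> topspace model" using Z_upd[OF wZ] Z_sub by (auto simp: u_def)
        have u_upd: "u(0 := r) = w(0 := r)" for r by (simp add: u_def)
        \<comment> \<open>\<open>K\<close> is an interval containing both \<open>s\<close> and the height of \<open>w\<close>, so agreement near \<open>s\<close> propagates to \<open>w\<close>.\<close>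
        define K where "K = {r. u(0 := r) \<in> R}"
        have K: "open K" "s \<in> K" "w 0 \<in> K"
          using upd_open[OF u(2) R_open] w by (auto simp: K_def u_upd W_def)
        have "convex K"
          unfolding convex_alt
        proof (intro ballI allI impI)
          fix r1 r2 t :: real assume r: "r1 \<in> K" "r2 \<in> K" and t: "0 \<le> t \<and> t \<le> 1"
          have "u(0 := (1 - t) *\<^sub>R r1 + t *\<^sub>R r2) = lerp (u(0 := r1)) (u(0 := r2)) t"
            by (auto simp: lerp_def fun_eq_iff algebra_simps)
          moreover have "lerp (g (u(0 := r1))) (g (u(0 := r2))) t \<in> B"
            using lerp_closed_cube[of "Suc n" "a s\<^sub>0" r] r t unfolding lerp_closed_def B_def K_def R_def by auto
          ultimately show "(1 - t) *\<^sub>R r1 + t *\<^sub>R r2 \<in> K"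
            using fun_upd_in_model[OF u(2)] by (simp add: K_def R_def L_group_lerp[OF g])
        qed
        then have conn: "connectedin euclideanreal K" by (simp add: convex_connected)
        have KQ: "g (u(0 := r)) \<in> d ` Q" if "r \<in> K" for r using that r(2) by (auto simp: K_def R_def B_def)
        have 2: "charted_on euclideanreal (lines n) K (\<lambda>r. inv_into Q d (g (u(0 := r))))"
          by (rule charted_on_chart_inv[OF Q line[OF u(2)]]) (use K(1) KQ in auto)
        have Du: "D u r = inv_into Q d (g (u(0 := r)))" if "r \<in> K \<inter> {r. u(0 := r) \<in> N'}" for r
        proof -
          have "F (u(0 := r)) = D u r" by (simp add: F_upd u_def)
          then have "D u r \<in> Q" "d (D u r) = g (u(0 := r))" using N'(4,5)[of "u(0 := r)"] that by auto
          then show ?thesis using inv_into_f_f[OF chart_inj[OF Q]] by metis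
        qed
        have "D u (w 0) = inv_into Q d (g (u(0 := w 0)))"
        proof (rule charted_on_unique[OF fam D(1)[OF u(1)] 2, of K "K \<inter> {r. u(0 := r) \<in> N'}"])
          show "openin euclideanreal (K \<inter> {r. u(0 := r) \<in> N'})"
            using K(1) upd_open[OF u(2) N'(1)] by (simp add: open_Int)
          have "s \<in> K \<inter> {r. u(0 := r) \<in> N'}" using K(2) w by (auto simp: u_upd W_def)
          then show "K \<inter> {r. u(0 := r) \<in> N'} \<noteq> {}" by blast
        qed (use K conn Du in auto)
        then have "F w = inv_into Q d (g w)" by (simp add: F_def u_def)
        then show ?thesis using chart_inv[OF Q KQ[OF K(3)]] by (simp add: u_def)
      qed
      ultimately show ?thesis unfolding good_def using Q g
        by (intro exI[of _ Q] exI[of _ d] exI[of _ g] exI[of _ W]) (auto simp: W_def)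
    qed
    then show ?thesis using J(1,2) by blast
  qed
  have good_line: "good (y(0 := s))" if y: "y \<in> Z" "y 0 = 0" for y s
  proof -
    define T where "T = {s. good (y(0 := s))}"
    have "open T"
    proof (subst open_subopen, intro ballI)
      fix s assume "s \<in> T"
      with good_local[OF y, of s] show "\<exists>U. open U \<and> s \<in> U \<and> U \<subseteq> T" unfolding T_def by blast
    qed
    moreover have "open (- T)"
    proof (subst open_subopen, intro ballI)
      fix s assume "s \<in> - T"
      with good_local[OF y, of s] show "\<exists>U. open U \<and> s \<in> U \<and> U \<subseteq> - T" unfolding T_def by blast
    qed
    ultimately have "T = {} \<or> T = UNIV" using clopen[of T] by (simp add: closed_def)
    moreover have "c q 0 \<in> T" using good_box[OF Z_upd[OF y(1)]] I(4) by (simp add: T_def)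
    ultimately show ?thesis unfolding T_def by blast
  qed
  have "charted_on model (L_group n) Z F"
  proof (rule charted_onI)
    fix z assume z: "z \<in> Z"
    have "good ((z(0 := 0))(0 := z 0))" by (rule good_line[OF Z_upd[OF z]]) simp
    then have "good z" by simp
    then show "\<exists>P c g N. (P, c) \<in> C \<and> g \<in> L_group n \<and> openin model N \<and> z \<in> N \<and> N \<subseteq> Z \<and> (\<forall>w\<in>N. F w \<in> P \<and> c (F w) = g w)"
      by (simp only: good_def)
  qed
  moreover have "F w = inv_into P c w" if "w \<in> Z" "\<bar>w 0 - c q 0\<bar> < \<eta>" for w
    using that F_box by (simp add: I_def abs_diff_less_iff)
  ultimately show thesis using that by (simp add: Z_def)
qed

text \<open>
  Near \<open>x\<close> the map \<open>f\<close> is a chart inverse after some \<open>g\<close> in \<open>L(n)\<close>.  The flowed chart inverse \<open>F\<close> lives on the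
  cylinder of radius \<open>\<eta>\<close> around \<open>g x\<close>, whose preimage under \<open>g\<close> is the cylinder of the same radius around \<open>x\<close>.
\<close>

lemma germ_extends_to_cylinder:
  assumes f: "charted_on model (L_group n) W f" and x: "x \<in> W"
  obtains F O' where "charted_on model (L_group n) (cylinder n x \<eta>) F" "openin model O'" "x \<in> O'"
    "O' \<subseteq> W" "O' \<subseteq> cylinder n x \<eta>" "\<And>w. w \<in> O' \<Longrightarrow> F w = f w"
proof -
  note famL = continuation_family_L_group[of n]
  have x_model: "x \<in> topspace model" using charted_on_openin[OF f] x openin_subset by blast
  obtain P c where P: "(P, c) \<in> C" and fx: "f x \<in> P" "cube (Suc n) (c (f x)) \<eta> \<subseteq> c ` P"
    using uniform_chart[OF charted_on_in_topspace[OF f x]] by auto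
  obtain g N where g: "g \<in> L_group n" and N: "openin model N" "x \<in> N" "N \<subseteq> W"
    "\<And>w. w \<in> N \<Longrightarrow> f w \<in> P" "\<And>w. w \<in> N \<Longrightarrow> c (f w) = g w"
    by (rule charted_on_in_chart[where f = f and z = x, OF famL f x fx(1) P], rule that)
  have cfx: "c (f x) = g x" using N(2,5) by simp
  obtain F where F: "charted_on model (L_group n) (cylinder n (c (f x)) \<eta>) F"
    "\<And>w. w \<in> cylinder n (c (f x)) \<eta> \<Longrightarrow> \<bar>w 0 - c (f x) 0\<bar> < \<eta> \<Longrightarrow> F w = inv_into P c w"
    by (rule flow_chart_to_cylinder[OF P fx], rule that)
  have g_cyl: "g w \<in> cylinder n (c (f x)) \<eta>" if "w \<in> cylinder n x \<eta>" for w
    using that L_group_in_topspace[OF g] hdist_L_group[OF g] by (simp add: cylinder_def cfx)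
  have g_cont: "continuous_map model model g" by (rule continuous_map_L_group[OF g])
  have "charted_on model (L_group n) (cylinder n x \<eta>) (F \<circ> g)"
  proof (rule charted_onI)
    fix z assume z: "z \<in> cylinder n x \<eta>"
    obtain Q d h V where Q: "(Q, d) \<in> C" "h \<in> L_group n" "openin model V" "g z \<in> V" "V \<subseteq> cylinder n (c (f x)) \<eta>"
      "\<And>w. w \<in> V \<Longrightarrow> F w \<in> Q" "\<And>w. w \<in> V \<Longrightarrow> d (F w) = h w"
      by (rule charted_onE[OF F(1) g_cyl[OF z]], rule that)
    let ?V = "cylinder n x \<eta> \<inter> {w \<in> topspace model. g w \<in> V}"
    have "openin model ?V"
      by (intro openin_Int openin_cylinder openin_continuous_map_preimage[OF g_cont Q(3)])
    then show "\<exists>P c k N. (P, c) \<in> C \<and> k \<in> L_group n \<and> openin model N \<and> z \<in> N \<and> N \<subseteq> cylinder n x \<eta> \<and>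
        (\<forall>w\<in>N. (F \<circ> g) w \<in> P \<and> c ((F \<circ> g) w) = k w)"
      using Q z L_group_comp[OF Q(2) g]
      by (intro exI[of _ Q] exI[of _ d] exI[of _ "h \<circ> g"] exI[of _ ?V]) (auto simp: cylinder_def)
  qed
  moreover define O' where "O' = N \<inter> cylinder n x \<eta> \<inter> {w \<in> topspace model. g w 0 \<in> {c (f x) 0 - \<eta><..<c (f x) 0 + \<eta>}}"
  have "openin model O'"
  proof -
    have "continuous_map model euclideanreal (\<lambda>w. g w 0)"
      using continuous_map_compose[OF g_cont continuous_map_coordinate, of 0] by (simp add: o_def)
    then show ?thesis unfolding O'_def
      by (intro openin_Int openin_cylinder openin_continuous_map_preimage N(1)) auto
  qed
  moreover have "x \<in> O'" using N(2) x_model \<eta>_pos by (auto simp: O'_def cylinder_def cfx)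
  moreover have "(F \<circ> g) w = f w" if w: "w \<in> O'" for w
  proof -
    have "F (g w) = inv_into P c (g w)"
      using w F(2)[OF g_cyl, of w] by (auto simp: O'_def abs_diff_less_iff)
    also have "\<dots> = inv_into P c (c (f w))" using N(5) w by (simp add: O'_def)
    also have "\<dots> = f w" using N(4) w chart_inj[OF P] by (simp add: O'_def)
    finally show ?thesis by simp
  qed
  ultimately show thesis using that[of "F \<circ> g" O'] N(3) by (auto simp: O'_def)
qed

end

section \<open>Global chart inverses are coverings\<close>

lemma covering_map_of_comp_homeomorphic:
  assumes p: "covering_map_of X S p" and h: "homeomorphic_map E X h"
  shows "covering_map_of E S (p \<circ> h)"
  unfolding covering_map_of_def
proof (intro conjI ballI)
  have h_cont: "continuous_map E X h" and h_surj: "h ` topspace E = topspace X"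
    using h by (simp_all add: homeomorphic_imp_continuous_map homeomorphic_imp_surjective_map)
  show "continuous_map E S (p \<circ> h)"
    using p h_cont by (auto simp: covering_map_of_def intro: continuous_map_compose)
  show "(p \<circ> h) ` topspace E = topspace S"
    using p unfolding covering_map_of_def image_comp[symmetric] h_surj by (elim conjE)
  have even: "\<forall>x\<in>topspace S. \<exists>W. x \<in> W \<and> openin S W \<and> (\<exists>\<V>. \<Union>\<V> = {e \<in> topspace X. p e \<in> W} \<and>
      (\<forall>V\<in>\<V>. openin X V) \<and> pairwise disjnt \<V> \<and>
      (\<forall>V\<in>\<V>. homeomorphic_map (subtopology X V) (subtopology S W) p))"
    using p unfolding covering_map_of_def by (elim conjE)
  fix x assume "x \<in> topspace S"
  from bspec[OF even this] obtain W \<V> where W: "x \<in> W" "openin S W" "\<Union>\<V> = {e \<in> topspace X. p e \<in> W}"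
    "\<forall>V\<in>\<V>. openin X V" "pairwise disjnt \<V>"
    "\<forall>V\<in>\<V>. homeomorphic_map (subtopology X V) (subtopology S W) p"
    by (elim exE conjE) (rule that)
  define pre where "pre V = {e \<in> topspace E. h e \<in> V}" for V
  have "\<Union>(pre ` \<V>) = {e \<in> topspace E. h e \<in> \<Union>\<V>}" by (auto simp: pre_def)
  also have "\<dots> = {e \<in> topspace E. (p \<circ> h) e \<in> W}"
    using h_surj by (auto simp: W(3))
  finally have 1: "\<Union>(pre ` \<V>) = {e \<in> topspace E. (p \<circ> h) e \<in> W}" .
  have 2: "\<forall>V\<in>pre ` \<V>. openin E V"
    using W(4) openin_continuous_map_preimage[OF h_cont] by (auto simp: pre_def)
  have 3: "pairwise disjnt (pre ` \<V>)"
  proof (rule pairwise_imageI)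
    fix V V' assume "V \<in> \<V>" "V' \<in> \<V>" "V \<noteq> V'"
    then have "disjnt V V'" using W(5) by (auto simp: pairwise_def)
    then show "disjnt (pre V) (pre V')" by (auto simp: pre_def disjnt_def)
  qed
  have 4: "homeomorphic_map (subtopology E (pre V)) (subtopology S W) (p \<circ> h)" if "V \<in> \<V>" for V
  proof (rule homeomorphic_map_compose)
    show "homeomorphic_map (subtopology E (pre V)) (subtopology X V) h"
      by (rule homeomorphic_map_subtopologies[OF h]) (use h_surj in \<open>auto simp: pre_def\<close>)
  qed (use W(6) that in auto)
  show "\<exists>W. x \<in> W \<and> openin S W \<and> (\<exists>\<V>. \<Union> \<V> = {e \<in> topspace E. (p \<circ> h) e \<in> W} \<and>
      (\<forall>V\<in>\<V>. openin E V) \<and> pairwise disjnt \<V> \<and>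
      (\<forall>V\<in>\<V>. homeomorphic_map (subtopology E V) (subtopology S W) (p \<circ> h)))"
    using W(1,2) 1 2 3 4 by (intro exI[of _ W] conjI exI[of _ "pre ` \<V>"]) auto
qed

lemma covering_map_of_homeomorphic:
  assumes "homeomorphic_map E X h"
  shows "covering_map_of E X h"
proof -
  have "covering_map_of X X id"
    unfolding covering_map_of_def
  proof (intro conjI ballI)
    fix x assume "x \<in> topspace X"
    then show "\<exists>W. x \<in> W \<and> openin X W \<and> (\<exists>\<V>. \<Union> \<V> = {e \<in> topspace X. id e \<in> W} \<and>
        (\<forall>V\<in>\<V>. openin X V) \<and> pairwise disjnt \<V> \<and>
        (\<forall>V\<in>\<V>. homeomorphic_map (subtopology X V) (subtopology X W) id))"
      by (intro exI[of _ "topspace X"] conjI exI[of _ "{topspace X}"]) auto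
  qed auto
  from covering_map_of_comp_homeomorphic[OF this assms] show ?thesis by simp
qed

lemma simply_connected_Euclidean_space: "simply_connected_space_of (Euclidean_space N)"
  unfolding simply_connected_space_of_def
proof (intro conjI allI impI)
  show "path_connected_space (Euclidean_space N)"
    unfolding path_connectedin_topspace[symmetric]
    by (rule path_connectedin_lerp_closed[OF lerp_closed_topspace]) simp
  fix \<gamma> assume \<gamma>: "pathin (Euclidean_space N) \<gamma> \<and> \<gamma> 1 = \<gamma> 0"
  then have cont: "continuous_map (top_of_set {0..1}) (Euclidean_space N) \<gamma>" by (simp add: pathin_def)
  then have \<gamma>0: "\<gamma> 0 \<in> topspace (Euclidean_space N)" by (auto simp: continuous_map_def Pi_iff)
  show "homotopic_with (\<lambda>\<sigma>. \<sigma> 1 = \<sigma> 0) (top_of_set {0..1}) (Euclidean_space N) \<gamma> (\<lambda>s. \<gamma> 0)"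
    unfolding homotopic_with_def
  proof (intro exI[of _ "\<lambda>z. lerp (\<gamma> (snd z)) (\<gamma> 0) (fst z)"] conjI ballI allI)
    let ?X = "prod_topology (top_of_set {0..1::real}) (top_of_set {0..1::real})"
    have "continuous_map ?X (Euclidean_space N) (\<gamma> \<circ> snd)"
      by (rule continuous_map_compose[OF continuous_map_snd cont])
    then have "continuous_map ?X (Euclidean_space N) (\<lambda>z. \<gamma> (snd z))" unfolding o_def .
    moreover have "continuous_map ?X euclideanreal fst"
      using continuous_map_fst[of "top_of_set {0..1::real}" "top_of_set {0..1::real}"]
      unfolding continuous_map_in_subtopology by blast
    ultimately show "continuous_map ?X (Euclidean_space N) (\<lambda>z. lerp (\<gamma> (snd z)) (\<gamma> 0) (fst z))"
      using \<gamma>0 by (intro continuous_map_lerp) auto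
  qed (use \<gamma> in auto)
qed

lemma simply_connected_space_of_homeomorphic:
  assumes X: "simply_connected_space_of X" and hk: "homeomorphic_maps E X h k"
  shows "simply_connected_space_of E"
  unfolding simply_connected_space_of_def
proof (intro conjI allI impI)
  have "X homeomorphic_space E" using hk homeomorphic_space_def homeomorphic_space_sym by blast
  then show "path_connected_space E"
    using X homeomorphic_path_connected_space_imp by (auto simp: simply_connected_space_of_def)
  fix \<gamma> assume \<gamma>: "pathin E \<gamma> \<and> \<gamma> 1 = \<gamma> 0"
  then have cont: "continuous_map (top_of_set {0..1}) E \<gamma>" by (simp add: pathin_def)
  have h: "continuous_map E X h" and k: "continuous_map X E k"
    and kh: "\<And>x. x \<in> topspace E \<Longrightarrow> k (h x) = x"
    using hk by (auto simp: homeomorphic_maps_def)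
  have kh\<gamma>: "k (h (\<gamma> s)) = \<gamma> s" if "s \<in> {0..1}" for s
    using kh cont that by (auto simp: continuous_map_def Pi_iff)
  have "pathin X (h \<circ> \<gamma>)" using continuous_map_compose[OF cont h] by (simp add: pathin_def)
  moreover have "(h \<circ> \<gamma>) 1 = (h \<circ> \<gamma>) 0" using \<gamma> by simp
  ultimately have "homotopic_with (\<lambda>\<sigma>. \<sigma> 1 = \<sigma> 0) (top_of_set {0..1}) X (h \<circ> \<gamma>) (\<lambda>s. (h \<circ> \<gamma>) 0)"
    using X unfolding simply_connected_space_of_def by blast
  then have "homotopic_with (\<lambda>\<sigma>. \<sigma> 1 = \<sigma> 0) (top_of_set {0..1}) E (k \<circ> (h \<circ> \<gamma>)) (k \<circ> (\<lambda>s. (h \<circ> \<gamma>) 0))"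
    by (rule homotopic_with_compose_continuous_map_left[OF _ k]) simp
  then show "homotopic_with (\<lambda>\<sigma>. \<sigma> 1 = \<sigma> 0) (top_of_set {0..1}) E \<gamma> (\<lambda>s. \<gamma> 0)"
    by (rule homotopic_with_eq) (use kh\<gamma> in auto)
qed

text \<open>
  An encoding of \<open>\<real>\<^sup>n\<^sup>+\<^sup>1\<close> in the type of sets of paths, where \<open>GX_complete\<close> takes the points of the
  universal covering.  The coordinate \<open>x i\<close> is stored as a path taking the value \<open>a\<close> at exactly two parameters,
  a negative one for the index and a positive one for the value, and the value \<open>b\<close> elsewhere.
\<close>

definition path_code :: "'a \<Rightarrow> 'a \<Rightarrow> (nat \<Rightarrow> real) \<Rightarrow> (real \<Rightarrow> 'a) set" where
  "path_code a b x = range (\<lambda>i s. if s = - real i - 1 \<or> s = exp (x i) then a else b)"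

lemma inj_path_code:
  assumes "a \<noteq> b"
  shows "inj (path_code a b)"
proof (rule injI, rule ext)
  fix x y i
  let ?f = "\<lambda>x i s. if s = - real i - 1 \<or> s = exp (x i) then a else b"
  assume "path_code a b x = path_code a b y"
  then have "?f x i \<in> range (?f y)" unfolding path_code_def by blast
  then obtain j where j: "?f x i = ?f y j" by blast
  have neg: "\<not> - real m - 1 = exp t" for m t
    using exp_gt_zero[of t] by linarith
  have "i = j"
    using fun_cong[OF j, of "- real i - 1"] assms neg[of i] by (auto split: if_splits)
  moreover have "exp (x i) = exp (y j)"
    using fun_cong[OF j, of "exp (x i)"] assms neg[of j "x i"] by (auto split: if_splits)
  ultimately show "x i = y i" by simp
qed

context L_structure
begin

lemma charted_on_continuous_map:
  assumes "continuation_family n X \<G>" "charted_on X \<G> W f"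
  shows "continuous_map (subtopology X W) S f"
  unfolding continuous_map_def
proof (intro conjI allI impI)
  have W: "topspace (subtopology X W) = W"
    using openin_subset[OF charted_on_openin[OF assms(2)]] by auto
  show "f \<in> topspace (subtopology X W) \<rightarrow> topspace S"
    unfolding W using charted_on_in_topspace[OF assms(2)] by blast
  fix U assume "openin S U"
  from charted_on_preimage_open[OF assms this]
  show "openin (subtopology X W) {x \<in> topspace (subtopology X W). f x \<in> U}"
    unfolding W by (auto simp: openin_subtopology)
qed

text \<open>
  Take a box \<open>B\<close> in a chart \<open>c\<close>.  Over the corresponding set \<open>W\<close>, the sheets are the convex sets \<open>g\<inverse> B\<close> for
  those \<open>g\<close> with \<open>c \<circ> F = g\<close> there: a germ of \<open>F\<close> determines such a \<open>g\<close>, and unique continuation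
  spreads the equation over \<open>g\<inverse> B\<close>.  Two sheets that meet have the same \<open>g\<close> by rigidity.
\<close>

lemma evenly_covered:
  assumes F: "charted_on model (L_group n) (topspace model) F" and q: "q \<in> topspace S"
  obtains W \<V> where "q \<in> W" "openin S W" "\<Union>\<V> = {e \<in> topspace model. F e \<in> W}"
    "\<And>V. V \<in> \<V> \<Longrightarrow> openin model V" "pairwise disjnt \<V>"
    "\<And>V. V \<in> \<V> \<Longrightarrow> homeomorphic_map (subtopology model V) (subtopology S W) F"
proof -
  note famL = continuation_family_L_group[of n]
  obtain P c where P: "(P, c) \<in> C" "q \<in> P" using charts_cover[OF q] by auto
  obtain r where r: "r > 0" "cube (Suc n) (c q) r \<subseteq> c ` P"
    by (rule cube_subset_open[OF chart_image_open[OF P(1)] imageI[OF P(2)]])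
  define B where "B = cube (Suc n) (c q) r"
  define W where "W = {p \<in> P. c p \<in> B}"
  have c_cont: "continuous_map (subtopology S P) model c"
    using homeomorphic_imp_continuous_map[OF chart_homeomorphic[OF P(1)]] by (simp add: continuous_map_in_subtopology)
  have P_top: "topspace (subtopology S P) = P" using openin_subset[OF chart_open[OF P(1)]] by auto
  have "openin (subtopology S P) W"
    using openin_continuous_map_preimage[OF c_cont openin_cube] unfolding W_def B_def P_top by blast
  then have W_open: "openin S W" using openin_trans_full chart_open[OF P(1)] by blast
  have qW: "q \<in> W" using P(2) r(1) chart_in_model[OF P] by (simp add: W_def B_def centre_in_cube)
  define V where "V g = {w \<in> topspace model. g w \<in> B}" for g
  define \<V> where "\<V> = {V g |g. g \<in> L_group n \<and> (\<forall>w\<in>V g. F w \<in> P \<and> c (F w) = g w)}"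
  have V_open: "openin model (V g)" if "g \<in> L_group n" for g
    unfolding V_def B_def by (rule openin_continuous_map_preimage[OF continuous_map_L_group[OF that] openin_cube])
  have V_convex: "lerp_closed (V g)" if "g \<in> L_group n" for g
    using lerp_closed_cube[of "Suc n" "c q" r]
    by (auto simp: lerp_closed_def V_def B_def L_group_lerp[OF that] lerp_in_topspace)
  have "\<Union>\<V> = {e \<in> topspace model. F e \<in> W}"
  proof
    show "\<Union>\<V> \<subseteq> {e \<in> topspace model. F e \<in> W}" by (auto simp: \<V>_def V_def W_def)
    show "{e \<in> topspace model. F e \<in> W} \<subseteq> \<Union>\<V>"
    proof
      fix e assume "e \<in> {e \<in> topspace model. F e \<in> W}"
      then have e: "e \<in> topspace model" "F e \<in> P" "c (F e) \<in> B" by (auto simp: W_def)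
      obtain g N where g: "g \<in> L_group n" and N: "openin model N" "e \<in> N" "N \<subseteq> topspace model"
        "\<And>w. w \<in> N \<Longrightarrow> F w \<in> P" "\<And>w. w \<in> N \<Longrightarrow> c (F w) = g w"
        by (rule charted_on_in_chart[where f = F and z = e, OF famL F e(1,2) P(1)], rule that)
      have eV: "e \<in> V g" using e N(2,5) by (simp add: V_def)
      have V_in: "g w \<in> c ` P" if "w \<in> V g" for w using that r(2) by (auto simp: V_def B_def)
      have 2: "charted_on model (L_group n) (V g) (\<lambda>w. inv_into P c (g w))"
        by (rule charted_on_chart_inv[OF P(1) g V_open[OF g] V_in])
      have "F w = inv_into P c (g w)" if w: "w \<in> V g" for w
      proof (rule charted_on_unique[OF famL F 2 V_open[OF g], of "N \<inter> V g"])
        show "connectedin model (V g)"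
          by (rule connectedin_lerp_closed[OF V_convex[OF g]]) (auto simp: V_def)
        show "openin model (N \<inter> V g)" using N(1) V_open[OF g] by blast
        show "N \<inter> V g \<noteq> {}" using N(2) eV by blast
        show "F x = inv_into P c (g x)" if "x \<in> N \<inter> V g" for x
          using that N(4,5)[of x] inv_into_f_f[OF chart_inj[OF P(1)]] by (metis IntD1)
      qed (use w in \<open>auto simp: V_def\<close>)
      then have "\<forall>w\<in>V g. F w \<in> P \<and> c (F w) = g w"
        using chart_inv[OF P(1) V_in] by simp
      then show "e \<in> \<Union>\<V>" using g eV unfolding \<V>_def by blast
    qed
  qed
  moreover have "pairwise disjnt \<V>"
  proof (rule pairwiseI)
    fix V\<^sub>1 V\<^sub>2 assume "V\<^sub>1 \<in> \<V>" "V\<^sub>2 \<in> \<V>" and ne: "V\<^sub>1 \<noteq> V\<^sub>2"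
    then obtain g\<^sub>1 g\<^sub>2 where g: "V\<^sub>1 = V g\<^sub>1" "g\<^sub>1 \<in> L_group n" "\<forall>w\<in>V g\<^sub>1. F w \<in> P \<and> c (F w) = g\<^sub>1 w"
      "V\<^sub>2 = V g\<^sub>2" "g\<^sub>2 \<in> L_group n" "\<forall>w\<in>V g\<^sub>2. F w \<in> P \<and> c (F w) = g\<^sub>2 w"
      unfolding \<V>_def by blast
    show "disjnt V\<^sub>1 V\<^sub>2"
    proof (rule ccontr)
      assume "\<not> disjnt V\<^sub>1 V\<^sub>2"
      then obtain w where w: "w \<in> V g\<^sub>1 \<inter> V g\<^sub>2" by (auto simp: disjnt_def g(1,4))
      have "g\<^sub>1 x = g\<^sub>2 x" if "x \<in> topspace model" for x
      proof (rule continuation_family_eq[OF famL g(2,5) _ w _ that])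
        show "openin model (V g\<^sub>1 \<inter> V g\<^sub>2)" using V_open g(2,5) by blast
        show "g\<^sub>1 x = g\<^sub>2 x" if "x \<in> V g\<^sub>1 \<inter> V g\<^sub>2" for x using that g(3,6) by (metis IntD1 IntD2)
      qed
      then have "V g\<^sub>1 = V g\<^sub>2" by (auto simp: V_def)
      then show False using ne g(1,4) by simp
    qed
  qed
  moreover have "openin model X" if "X \<in> \<V>" for X using that V_open by (auto simp: \<V>_def)
  moreover have "homeomorphic_map (subtopology model X) (subtopology S W) F" if "X \<in> \<V>" for X
  proof -
    from that obtain g where g: "X = V g" "g \<in> L_group n" "\<forall>w\<in>V g. F w \<in> P \<and> c (F w) = g w"
      unfolding \<V>_def by blast
    obtain h where h: "h \<in> L_group n" "\<And>x. x \<in> topspace model \<Longrightarrow> g (h x) = x"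
      "\<And>x. x \<in> topspace model \<Longrightarrow> h (g x) = x"
      by (rule L_group_inverse[OF g(2)], rule that)
    have hc: "h (c p) \<in> V g" "F (h (c p)) = p" if p: "p \<in> W" for p
    proof -
      have cp: "p \<in> P" "c p \<in> topspace model" "c p \<in> B" using p chart_in_model[OF P(1)] by (auto simp: W_def)
      then show "h (c p) \<in> V g" using h(2) L_group_in_topspace[OF h(1)] by (simp add: V_def)
      then have "F (h (c p)) \<in> P" "c (F (h (c p))) = c p" using g(3) h(2)[OF cp(2)] by auto
      then show "F (h (c p)) = p" using inj_onD[OF chart_inj[OF P(1)]] cp(1) by blast
    qed
    have "homeomorphic_maps (subtopology model (V g)) (subtopology S W) F (h \<circ> c)"
      unfolding homeomorphic_maps_def
    proof (intro conjI ballI)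
      have "continuous_map (subtopology model (V g)) S F"
        by (rule charted_on_continuous_map[OF famL charted_on_subset[OF F V_open[OF g(2)]]]) (auto simp: V_def)
      then show "continuous_map (subtopology model (V g)) (subtopology S W) F"
        using g(3) by (auto simp: continuous_map_in_subtopology W_def V_def)
      have "continuous_map (subtopology S W) model c"
        using continuous_map_from_subtopology_mono[OF c_cont, of W] by (auto simp: W_def)
      then have "continuous_map (subtopology S W) model (h \<circ> c)"
        by (rule continuous_map_compose[OF _ continuous_map_L_group[OF h(1)]])
      then show "continuous_map (subtopology S W) (subtopology model (V g)) (h \<circ> c)"
        using hc(1) by (auto simp: continuous_map_in_subtopology)
    next
      fix x assume "x \<in> topspace (subtopology model (V g))"
      then show "(h \<circ> c) (F x) = x" using g(3) h(3) by (auto simp: V_def)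
    next
      fix p assume "p \<in> topspace (subtopology S W)"
      then show "F ((h \<circ> c) p) = p" using hc(2) by simp
    qed
    then show ?thesis unfolding g(1) by (auto simp: homeomorphic_map_maps)
  qed
  ultimately show thesis using qW W_open by (intro that[of W \<V>])
qed

text \<open>
  An evenly covered set meeting the image of \<open>F\<close> is contained in it, so the image is open and closed.
\<close>

lemma covering_map_of_global:
  assumes F: "charted_on model (L_group n) (topspace model) F"
  shows "covering_map_of model S F"
  unfolding covering_map_of_def
proof (intro conjI ballI)
  note famL = continuation_family_L_group[of n]
  show "continuous_map model S F"
    using charted_on_continuous_map[OF famL F] by simp
  show "\<exists>W. q \<in> W \<and> openin S W \<and> (\<exists>\<V>. \<Union> \<V> = {e \<in> topspace model. F e \<in> W} \<and>
      (\<forall>V\<in>\<V>. openin model V) \<and> pairwise disjnt \<V> \<and>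
      (\<forall>V\<in>\<V>. homeomorphic_map (subtopology model V) (subtopology S W) F))" if "q \<in> topspace S" for q
  proof -
    obtain W \<V> where "q \<in> W" "openin S W" "\<Union>\<V> = {e \<in> topspace model. F e \<in> W}"
      "\<And>V. V \<in> \<V> \<Longrightarrow> openin model V" "pairwise disjnt \<V>"
      "\<And>V. V \<in> \<V> \<Longrightarrow> homeomorphic_map (subtopology model V) (subtopology S W) F"
      by (rule evenly_covered[OF F \<open>q \<in> topspace S\<close>], rule that)
    then show ?thesis by (intro exI[of _ W] conjI exI[of _ \<V>]) auto
  qed
  define A where "A = F ` topspace model"
  have local: "\<exists>W. q \<in> W \<and> openin S W \<and> (W \<subseteq> A \<or> W \<inter> A = {})"
    if q: "q \<in> topspace S" for q
  proof -
    obtain W \<V> where W: "q \<in> W" "openin S W" "\<Union>\<V> = {e \<in> topspace model. F e \<in> W}"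
      "\<And>V. V \<in> \<V> \<Longrightarrow> openin model V" "pairwise disjnt \<V>"
      "\<And>V. V \<in> \<V> \<Longrightarrow> homeomorphic_map (subtopology model V) (subtopology S W) F"
      by (rule evenly_covered[OF F q], rule that)
    have "W \<subseteq> A" if ne: "W \<inter> A \<noteq> {}"
    proof -
      from ne obtain e where "e \<in> topspace model" "F e \<in> W" unfolding A_def by blast
      then obtain V where V: "V \<in> \<V>" using W(3) by blast
      have "F ` (topspace model \<inter> V) = topspace S \<inter> W"
        using homeomorphic_imp_surjective_map[OF W(6)[OF V]] by simp
      then show ?thesis using openin_subset[OF W(2)] unfolding A_def by blast
    qed
    then show ?thesis using W(1,2) by blast
  qed
  have sub: "A \<subseteq> topspace S" using charted_on_in_topspace[OF F] unfolding A_def by blast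
  have "openin S (A)"
  proof (subst openin_subopen, intro ballI)
    fix q assume q: "q \<in> A"
    then obtain W where "q \<in> W" "openin S W" "W \<subseteq> A \<or> W \<inter> A = {}"
      using local sub by blast
    then show "\<exists>T. openin S T \<and> q \<in> T \<and> T \<subseteq> A" using q by blast
  qed
  moreover have "openin S (topspace S - A)"
  proof (subst openin_subopen, intro ballI)
    fix q assume q: "q \<in> topspace S - A"
    then obtain W where "q \<in> W" "openin S W" "W \<subseteq> A \<or> W \<inter> A = {}"
      using local by blast
    then show "\<exists>T. openin S T \<and> q \<in> T \<and> T \<subseteq> topspace S - A"
      using q openin_subset by blast
  qed
  then have "closedin S (A)" using sub by (simp add: closedin_def)
  ultimately have "A = {} \<or> A = topspace S"
    using connected connected_space_clopen_in by blast
  moreover have "(\<lambda>_. 0) \<in> topspace model" by (simp add: topspace_Euclidean_space)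
  ultimately show "F ` topspace model = topspace S" unfolding A_def by blast
qed

text \<open>
  Take as universal covering the copy \<open>E\<close> of \<open>\<real>\<^sup>n\<^sup>+\<^sup>1\<close> transported by \<open>path_code\<close>, with \<open>F\<close> as projection and the
  identification with \<open>\<real>\<^sup>n\<^sup>+\<^sup>1\<close> as developing map.  The encoding needs two distinct points of the manifold, which
  exist because a chart image is open in a space of positive dimension.
\<close>

lemma GX_complete_if_global:
  assumes F: "charted_on model (L_group n) (topspace model) F"
  shows "GX_complete (L_group n) (n + 1) S C"
proof -
  let ?o = "\<lambda>_::nat. 0::real"
  have o: "?o \<in> topspace model" by (simp add: topspace_Euclidean_space)
  obtain P c where P: "(P, c) \<in> C" "F ?o \<in> P"
    using charts_cover[OF charted_on_in_topspace[where f = F and z = ?o, OF F o]] by auto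
  have "\<exists>b\<in>P. b \<noteq> F ?o"
  proof -
    obtain r where r: "r > 0" "cube (Suc n) (c (F ?o)) r \<subseteq> c ` P"
      by (rule cube_subset_open[OF chart_image_open[OF P(1)] imageI[OF P(2)]])
    let ?x = "c (F ?o)"
    have "?x(0 := ?x 0 + r / 2) \<in> cube (Suc n) ?x r"
      using chart_in_model[OF P] r(1) fun_upd_in_model by (auto simp: cube_def)
    then obtain b where b: "b \<in> P" "c b = ?x(0 := ?x 0 + r / 2)" using r(2) by force
    then have "c b 0 \<noteq> ?x 0" using r(1) by simp
    then have "b \<noteq> F ?o" by auto
    then show ?thesis using b(1) by blast
  qed
  then obtain b where b: "F ?o \<noteq> b" by metis
  define code where "code = path_code (F ?o) b"
  have code: "inj code" unfolding code_def by (rule inj_path_code[OF b])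
  define h where "h = inv_into UNIV code"
  have h_code: "h (code x) = x" for x unfolding h_def by (rule inv_f_f[OF code])
  define E where "E = pullback_topology (code ` topspace model) h model"
  have E_top: "topspace E = code ` topspace model"
    by (auto simp: E_def topspace_pullback_topology h_code)
  have maps: "homeomorphic_maps E model h code"
    unfolding homeomorphic_maps_def
  proof (intro conjI ballI)
    show "continuous_map E model h"
      using continuous_map_pullback[OF continuous_map_id[of model], of "code ` topspace model" h] by (simp add: E_def)
    show "continuous_map model E code"
      unfolding E_def by (rule continuous_map_pullback') (auto simp: o_def h_code)
  qed (auto simp: E_top h_code)
  then have hom: "homeomorphic_map E model h" by (auto simp: homeomorphic_map_maps)
  have "universal_covering E S (F \<circ> h)"
    unfolding universal_covering_def
    using simply_connected_space_of_homeomorphic[OF simply_connected_Euclidean_space maps]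
      covering_map_of_comp_homeomorphic[OF covering_map_of_global[OF F] hom] by blast
  moreover have "developing_map (L_group n) C E (F \<circ> h) h"
    unfolding developing_map_def
  proof
    fix e assume e: "e \<in> topspace E"
    have he: "h e \<in> topspace model" using e by (auto simp: E_top h_code)
    obtain Q d g N where Q: "(Q, d) \<in> C" "g \<in> L_group n" "openin model N" "h e \<in> N" "N \<subseteq> topspace model"
      "\<And>w. w \<in> N \<Longrightarrow> F w \<in> Q" "\<And>w. w \<in> N \<Longrightarrow> d (F w) = g w"
      by (rule charted_onE[OF F he], rule that)
    obtain k where k: "k \<in> L_group n" "\<And>x. x \<in> topspace model \<Longrightarrow> g (k x) = x"
      "\<And>x. x \<in> topspace model \<Longrightarrow> k (g x) = x"
      by (rule L_group_inverse[OF Q(2)], rule that)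
    let ?W = "{w \<in> topspace E. h w \<in> N}"
    have "openin E ?W"
      by (rule openin_continuous_map_preimage[OF homeomorphic_imp_continuous_map[OF hom] Q(3)])
    moreover have "h w = k (d ((F \<circ> h) w))" if "w \<in> ?W" for w
    proof -
      have "h w \<in> N" using that by simp
      then show ?thesis using Q(7)[of "h w"] k(3)[OF subsetD[OF Q(5)]] by simp
    qed
    moreover have "(F \<circ> h) ` ?W \<subseteq> Q" using Q(6) by auto
    ultimately have W: "e \<in> ?W" "openin E ?W" "\<exists>g\<in>L_group n. (F \<circ> h) ` ?W \<subseteq> Q \<and> (\<forall>w\<in>?W. h w = g (d ((F \<circ> h) w)))"
      using e Q(4) k(1) by blast+
    show "\<exists>W. e \<in> W \<and> openin E W \<and> (\<exists>(P, c)\<in>C. \<exists>g\<in>L_group n. (F \<circ> h) ` W \<subseteq> P \<and>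
        (\<forall>w\<in>W. h w = g (c ((F \<circ> h) w))))"
      by (intro exI[of _ ?W] conjI W bexI[OF _ Q(1)] case_prodI)
  qed
  moreover have "covering_map_of E (Euclidean_space (n + 1)) h"
    using covering_map_of_homeomorphic[OF hom] by simp
  ultimately show ?thesis unfolding GX_complete_def by blast
qed

end

section \<open>Extension to the whole model space\<close>

context vertically_complete_L_structure
begin

text \<open>
  The extensions of the germs of \<open>f\<close> at the points \<open>z\<close> of the cylinder agree with each other: if two of
  their domains meet, their axes are at distance less than \<open>2 * \<eta>\<close>, so the midpoint lies in both
  domains and in the domain of \<open>f\<close>, where both extensions equal \<open>f\<close>.
\<close>

lemma cylinder_extends:
  assumes f: "charted_on model (L_group n) (cylinder n x r) f" and x: "x \<in> topspace model" and r: "r > 0"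
  obtains f' where "charted_on model (L_group n) (cylinder n x (r + \<eta>)) f'"
    "\<And>w. w \<in> cylinder n x r \<Longrightarrow> f' w = f w"
proof -
  note famL = continuation_family_L_group[of n]
  have conn: "connectedin model (cylinder n z s \<inter> cylinder n z' s')" for z z' s s'
    by (rule connectedin_lerp_closed[OF lerp_closed_Int[OF lerp_closed_cylinder lerp_closed_cylinder]])
      (auto simp: cylinder_def)
  define extends where "extends z G O' \<longleftrightarrow> charted_on model (L_group n) (cylinder n z \<eta>) G \<and> openin model O' \<and> z \<in> O' \<and>
      O' \<subseteq> cylinder n x r \<and> O' \<subseteq> cylinder n z \<eta> \<and> (\<forall>w\<in>O'. G w = f w)" for z G O'
  have "\<forall>z\<in>cylinder n x r. \<exists>G. \<exists>O'. extends z G O'"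
  proof
    fix z assume z: "z \<in> cylinder n x r"
    show "\<exists>G. \<exists>O'. extends z G O'"
      unfolding extends_def by (rule germ_extends_to_cylinder[OF f z]) blast
  qed
  from bchoice[OF this] obtain G where "\<forall>z\<in>cylinder n x r. \<exists>O'. extends z (G z) O'" by (rule exE)
  from bchoice[OF this] obtain D where "\<forall>z\<in>cylinder n x r. extends z (G z) (D z)" by (rule exE)
  then have G: "\<And>z. z \<in> cylinder n x r \<Longrightarrow> charted_on model (L_group n) (cylinder n z \<eta>) (G z)"
    and D: "\<And>z. z \<in> cylinder n x r \<Longrightarrow> openin model (D z)" "\<And>z. z \<in> cylinder n x r \<Longrightarrow> z \<in> D z"
    "\<And>z. z \<in> cylinder n x r \<Longrightarrow> D z \<subseteq> cylinder n x r" "\<And>z. z \<in> cylinder n x r \<Longrightarrow> D z \<subseteq> cylinder n z \<eta>"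
    "\<And>z w. z \<in> cylinder n x r \<Longrightarrow> w \<in> D z \<Longrightarrow> G z w = f w" unfolding extends_def by auto
  have Gf: "G z w = f w" if z: "z \<in> cylinder n x r" and w: "w \<in> cylinder n z \<eta>" "w \<in> cylinder n x r" for z w
  proof (rule charted_on_unique[OF famL G[OF z] f _ conn[of z \<eta> x r], of "D z"])
    show "openin model (cylinder n z \<eta> \<inter> cylinder n x r)" by (simp add: openin_cylinder openin_Int)
    show "D z \<noteq> {}" using D(2)[OF z] by blast
  qed (use D[OF z] w in auto)
  have GG: "G z w = G z' w" if z: "z \<in> cylinder n x r" "z' \<in> cylinder n x r"
    and w: "w \<in> cylinder n z \<eta>" "w \<in> cylinder n z' \<eta>" for z z' w
  proof (rule charted_on_unique[OF famL G[OF z(1)] G[OF z(2)] _ conn[of z \<eta> z' \<eta>],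
        of "cylinder n z \<eta> \<inter> cylinder n z' \<eta> \<inter> cylinder n x r"])
    show "openin model (cylinder n z \<eta> \<inter> cylinder n z' \<eta>)"
      "openin model (cylinder n z \<eta> \<inter> cylinder n z' \<eta> \<inter> cylinder n x r)"
      by (simp_all add: openin_cylinder openin_Int)
    let ?m = "lerp z z' (1 / 2)"
    have "hdist n z z' < 2 * \<eta>"
      using w hdist_triangle[of n z z' w] hdist_commute[of n w z'] by (auto simp: cylinder_def)
    then have "hdist n z ?m < \<eta>" "hdist n z' ?m < \<eta>" by (auto simp: hdist_lerp)
    moreover have m: "?m \<in> cylinder n x r"
      using lerp_closed_cylinder[of n x r] z unfolding lerp_closed_def by auto
    moreover have "?m \<in> topspace model" using m by (auto simp: cylinder_def)
    ultimately have "?m \<in> cylinder n z \<eta> \<inter> cylinder n z' \<eta> \<inter> cylinder n x r"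
      by (auto simp: cylinder_def)
    then show "cylinder n z \<eta> \<inter> cylinder n z' \<eta> \<inter> cylinder n x r \<noteq> {}" by blast
  qed (use w Gf z in auto)
  obtain f' where f': "charted_on model (L_group n) (\<Union>z\<in>cylinder n x r. cylinder n z \<eta>) f'"
    "\<And>z w. z \<in> cylinder n x r \<Longrightarrow> w \<in> cylinder n z \<eta> \<Longrightarrow> f' w = G z w"
    by (rule charted_on_glue[of "cylinder n x r", OF G GG], assumption, assumption, assumption,
        assumption, assumption, rule that)
  have "cylinder n x (r + \<eta>) \<subseteq> (\<Union>z\<in>cylinder n x r. cylinder n z \<eta>)"
  proof
    fix w assume w: "w \<in> cylinder n x (r + \<eta>)"
    then have w_model: "w \<in> topspace model" and d: "hdist n x w < r + \<eta>" by (auto simp: cylinder_def)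
    \<comment> \<open>This ratio places the centre \<open>?z\<close> at distance less than \<open>r\<close> from \<open>x\<close> and less than \<open>\<eta>\<close> from \<open>w\<close>.\<close>
    let ?t = "r / (r + \<eta>)"
    let ?z = "lerp x w ?t"
    have pos: "r + \<eta> > 0" using r \<eta>_pos by simp
    have t: "0 < ?t" "?t < 1" "1 - ?t = \<eta> / (r + \<eta>)" using r \<eta>_pos by (auto simp: field_simps)
    have "?t * hdist n x w < ?t * (r + \<eta>)" by (rule mult_strict_left_mono[OF d t(1)])
    then have 1: "hdist n x ?z < r" using t pos r by (simp add: hdist_lerp)
    have "\<eta> / (r + \<eta>) * hdist n x w < \<eta> / (r + \<eta>) * (r + \<eta>)"
      by (rule mult_strict_left_mono[OF d]) (use \<eta>_pos pos in simp)
    then have 2: "hdist n ?z w < \<eta>"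
      using t pos by (simp add: hdist_commute[of n ?z w] hdist_lerp)
    show "w \<in> (\<Union>z\<in>cylinder n x r. cylinder n z \<eta>)"
      using 1 2 w_model lerp_in_topspace[OF x w_model] by (auto simp: cylinder_def intro!: bexI[of _ ?z])
  qed
  then have "charted_on model (L_group n) (cylinder n x (r + \<eta>)) f'"
    by (rule charted_on_subset[OF f'(1) openin_cylinder])
  moreover have "f' w = f w" if w: "w \<in> cylinder n x r" for w
  proof -
    have "w \<in> cylinder n w \<eta>" using w \<eta>_pos by (simp add: cylinder_def)
    then show ?thesis using f'(2)[OF w] Gf[OF w _ w] by simp
  qed
  ultimately show thesis by (rule that)
qed

lemma global_chart_inverse:
  assumes "topspace S \<noteq> {}"
  obtains F where "charted_on model (L_group n) (topspace model) F"
proof -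
  note famL = continuation_family_L_group[of n]
  obtain q where "q \<in> topspace S" using assms by blast
  then obtain P c where P: "(P, c) \<in> C" "q \<in> P" "cube (Suc n) (c q) \<eta> \<subseteq> c ` P"
    using uniform_chart[of q] by auto
  define x where "x = c q"
  have x: "x \<in> topspace model" using chart_in_model[OF P(1,2)] by (simp add: x_def)
  obtain f where f: "charted_on model (L_group n) (cylinder n x \<eta>) f"
    by (rule flow_chart_to_cylinder[OF P]) (use that x_def in auto)
  define R where "R m = real (Suc m) * \<eta>" for m
  have R_ge: "\<eta> \<le> R m" for m using \<eta>_pos by (simp add: R_def)
  have cyl_mono: "cylinder n x s \<subseteq> cylinder n x t" if "s \<le> t" for s t
    using that by (auto simp: cylinder_def)
  have "\<exists>g. charted_on model (L_group n) (cylinder n x (R m)) g \<and> (\<forall>w\<in>cylinder n x \<eta>. g w = f w)" for m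
  proof (induction m)
    case 0
    then show ?case using f by (auto simp: R_def)
  next
    case (Suc m)
    then obtain g where g: "charted_on model (L_group n) (cylinder n x (R m)) g"
      "\<forall>w\<in>cylinder n x \<eta>. g w = f w" by blast
    have "R m > 0" using R_ge[of m] \<eta>_pos by linarith
    obtain g' where g': "charted_on model (L_group n) (cylinder n x (R m + \<eta>)) g'"
      "\<And>w. w \<in> cylinder n x (R m) \<Longrightarrow> g' w = g w"
      by (rule cylinder_extends[OF g(1) x \<open>R m > 0\<close>], rule that)
    have "R (Suc m) = R m + \<eta>" by (simp add: R_def algebra_simps)
    moreover have "\<forall>w\<in>cylinder n x \<eta>. g' w = f w"
      using g(2) g'(2) cyl_mono[OF R_ge[of m]] by auto
    ultimately show ?case using g'(1) by auto
  qed
  then obtain g where g: "\<And>m. charted_on model (L_group n) (cylinder n x (R m)) (g m)"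
    "\<And>m w. w \<in> cylinder n x \<eta> \<Longrightarrow> g m w = f w" by metis
  have agree: "g m w = g m' w" if w: "w \<in> cylinder n x (R m)" "w \<in> cylinder n x (R m')" for m m' w
  proof (rule charted_on_unique[OF famL g(1) g(1), of "cylinder n x (R m) \<inter> cylinder n x (R m')" m m' "cylinder n x \<eta>"])
    show "connectedin model (cylinder n x (R m) \<inter> cylinder n x (R m'))"
      by (rule connectedin_lerp_closed[OF lerp_closed_Int[OF lerp_closed_cylinder lerp_closed_cylinder]])
        (auto simp: cylinder_def)
    have "x \<in> cylinder n x \<eta>" using x \<eta>_pos by (simp add: cylinder_def)
    then show "cylinder n x \<eta> \<noteq> {}" by blast
  qed (use w g(2) cyl_mono[OF R_ge] openin_cylinder in auto)
  obtain F where F: "charted_on model (L_group n) (\<Union>m\<in>UNIV. cylinder n x (R m)) F"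
    "\<And>m w. m \<in> UNIV \<Longrightarrow> w \<in> cylinder n x (R m) \<Longrightarrow> F w = g m w"
    by (rule charted_on_glue[of UNIV, OF g(1) agree], assumption, assumption, rule that)
  have "w \<in> (\<Union>m\<in>UNIV. cylinder n x (R m))" if "w \<in> topspace model" for w
  proof -
    obtain m where "hdist n x w < real m * \<eta>" using reals_Archimedean3[OF \<eta>_pos] by blast
    then have "hdist n x w < R m" using \<eta>_pos by (simp add: R_def algebra_simps)
    then show ?thesis using that by (auto simp: cylinder_def)
  qed
  then have "(\<Union>m\<in>UNIV. cylinder n x (R m)) = topspace model" by (auto simp: cylinder_def)
  with F(1) show thesis using that by simp
qed

theorem GX_complete_if_vertically_complete:
  assumes "topspace S \<noteq> {}"
  shows "GX_complete (L_group n) (n + 1) S C"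
  by (rule global_chart_inverse[OF assms]) (rule GX_complete_if_global)

end

section \<open>The leaf topology\<close>

lemma topspace_leaf_topology:
  assumes "L \<subseteq> topspace T"
  shows "topspace (leaf_topology T L) = L"
proof -
  have "\<Union>(\<Union>U\<in>{U. openin T U}. path_components_of (subtopology T (L \<inter> U))) =
      (\<Union>U\<in>{U. openin T U}. \<Union>(path_components_of (subtopology T (L \<inter> U))))" by blast
  also have "\<dots> = (\<Union>U\<in>{U. openin T U}. topspace T \<inter> (L \<inter> U))"
    by (simp add: Union_path_components_of)
  also have "\<dots> = L" using assms by blast
  finally show ?thesis by (simp add: leaf_topology_def)
qed

lemma openin_leaf_topology_plaque:
  "openin T U \<Longrightarrow> P \<in> path_components_of (subtopology T (L \<inter> U)) \<Longrightarrow> openin (leaf_topology T L) P"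
  unfolding leaf_topology_def by (rule topology_generated_by_Basis) blast

lemma openin_leaf_topology_Int:
  assumes "openin T U"
  shows "openin (leaf_topology T L) (L \<inter> U)"
proof -
  have "openin (leaf_topology T L) (\<Union>(path_components_of (subtopology T (L \<inter> U))))"
    using openin_leaf_topology_plaque[OF assms] by blast
  moreover have "topspace T \<inter> (L \<inter> U) = L \<inter> U" using openin_subset[OF assms] by blast
  ultimately show ?thesis by (simp add: Union_path_components_of)
qed

lemma Hausdorff_leaf_topology:
  assumes "Hausdorff_space T" "L \<subseteq> topspace T"
  shows "Hausdorff_space (leaf_topology T L)"
  unfolding Hausdorff_space_def topspace_leaf_topology[OF assms(2)]
proof (intro allI impI)
  fix x y assume xy: "x \<in> L \<and> y \<in> L \<and> x \<noteq> y"
  then have "x \<in> topspace T \<and> y \<in> topspace T \<and> x \<noteq> y" using assms(2) by blast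
  from assms(1)[unfolded Hausdorff_space_def, rule_format, OF this]
  obtain U V where "openin T U" "openin T V" "x \<in> U" "y \<in> V" "disjnt U V" by blast
  with xy show "\<exists>U V. openin (leaf_topology T L) U \<and> openin (leaf_topology T L) V \<and> x \<in> U \<and> y \<in> V \<and> disjnt U V"
    by (intro exI[of _ "L \<inter> U"] exI[of _ "L \<inter> V"]) (auto simp: openin_leaf_topology_Int disjnt_def)
qed

text \<open>
  The plaques are a subbasis, so continuity can be checked locally on preimages of plaques.
\<close>

lemma continuous_map_into_leaf_topology:
  assumes "L \<subseteq> topspace T" "f ` topspace X \<subseteq> L"
    and "\<And>U P x. openin T U \<Longrightarrow> P \<in> path_components_of (subtopology T (L \<inter> U)) \<Longrightarrow> x \<in> topspace X \<Longrightarrow> f x \<in> P \<Longrightarrow>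
      \<exists>N. openin X N \<and> x \<in> N \<and> f ` N \<subseteq> P"
  shows "continuous_map X (leaf_topology T L) f"
  unfolding leaf_topology_def continuous_on_generated_topo_iff
proof (intro conjI allI impI)
  fix P assume "P \<in> (\<Union>U\<in>{U. openin T U}. path_components_of (subtopology T (L \<inter> U)))"
  then obtain U where U: "openin T U" "P \<in> path_components_of (subtopology T (L \<inter> U))" by blast
  show "openin X (f -` P \<inter> topspace X)"
  proof (subst openin_subopen, intro ballI)
    fix x assume "x \<in> f -` P \<inter> topspace X"
    then obtain N where "openin X N" "x \<in> N" "f ` N \<subseteq> P" using assms(3)[OF U, of x] by blast
    then show "\<exists>N. openin X N \<and> x \<in> N \<and> N \<subseteq> f -` P \<inter> topspace X"
      using openin_subset by (intro exI[of _ N]) blast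
  qed
next
  show "f ` topspace X \<subseteq> \<Union>(\<Union>U\<in>{U. openin T U}. path_components_of (subtopology T (L \<inter> U)))"
    using assms(2) topspace_leaf_topology[OF assms(1)] by (simp add: leaf_topology_def)
qed

text \<open>
  A path of the ambient manifold inside \<open>L\<close> is continuous for the leaf topology: the part of it that stays
  in an open set \<open>U\<close> during an interval lies in a single path component of \<open>L \<inter> U\<close>.
\<close>

lemma path_connected_leaf_topology:
  assumes "path_connectedin T L"
  shows "path_connected_space (leaf_topology T L)"
proof -
  have L: "L \<subseteq> topspace T" using assms path_connectedin_subset_topspace by blast
  have "\<exists>g. pathin (leaf_topology T L) g \<and> g 0 = x \<and> g 1 = y" if "x \<in> L" "y \<in> L" for x y
  proof -
    obtain g where g: "pathin T g" "g \<in> {0..1} \<rightarrow> L" "g 0 = x" "g 1 = y"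
      using assms \<open>x \<in> L\<close> \<open>y \<in> L\<close> unfolding path_connectedin by blast
    have cont: "continuous_map (top_of_set {0..1}) T g" using g(1) by (simp add: pathin_def)
    have "continuous_map (top_of_set {0..1}) (leaf_topology T L) g"
    proof (rule continuous_map_into_leaf_topology[OF L])
      show "g ` topspace (top_of_set {0..1}) \<subseteq> L" using g(2) by auto
      fix U P s
      assume U: "openin T U" and P: "P \<in> path_components_of (subtopology T (L \<inter> U))"
        and s: "s \<in> topspace (top_of_set {0..1::real})" "g s \<in> P"
      have "openin (top_of_set {0..1}) {r \<in> topspace (top_of_set {0..1}). g r \<in> U}"
        by (rule openin_continuous_map_preimage[OF cont U])
      then obtain W where W: "open W" "{r \<in> {0..1}. g r \<in> U} = {0..1} \<inter> W" by (auto simp: openin_open)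
      have "g s \<in> U" using s(2) path_components_of_subset[OF P] by auto
      then have "s \<in> W" using W(2) s(1) by auto
      then obtain d where d: "d > 0" "ball s d \<subseteq> W" using W(1) open_contains_ball by blast
      define J where "J = {0..1} \<inter> ball s d"
      have JU: "g r \<in> U" if "r \<in> J" for r
        using eqset_imp_iff[OF W(2), of r] that d(2) by (auto simp: J_def)
      have "convex J" unfolding J_def by (intro convex_Int convex_ball convex_real_interval)
      then have "path_connectedin (top_of_set {0..1}) J"
        by (simp add: path_connectedin_subtopology convex_imp_path_connected J_def)
      then have "path_connectedin T (g ` J)"
        by (rule path_connectedin_continuous_map_image[OF cont])
      moreover have "g ` J \<subseteq> L \<inter> U" using JU g(2) by (auto simp: J_def)
      ultimately have "path_connectedin (subtopology T (L \<inter> U)) (g ` J)"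
        by (simp add: path_connectedin_subtopology)
      moreover have "s \<in> J" using s(1) d(1) by (simp add: J_def)
      then have "\<not> disjnt P (g ` J)" using s(2) by (auto simp: disjnt_def)
      ultimately have "g ` J \<subseteq> P" using path_components_of_maximal[OF P] by blast
      moreover have "openin (top_of_set {0..1}) J" by (auto simp: J_def openin_open)
      ultimately show "\<exists>N. openin (top_of_set {0..1}) N \<and> s \<in> N \<and> g ` N \<subseteq> P" using \<open>s \<in> J\<close> by blast
    qed
    then show ?thesis using g(3,4) by (auto simp: pathin_def)
  qed
  then show ?thesis
    unfolding path_connected_space_def topspace_leaf_topology[OF L] by blast
qed

text \<open>
  A set modelled on an open subset of \<open>\<real>\<^sup>N\<close> is locally path connected, so a plaque of any other open set meets
  \<open>P\<close> in a set that is open for the topology induced by \<open>T\<close>.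
\<close>

lemma leaf_topology_on_plaque:
  assumes L: "L \<subseteq> topspace T" and P: "P \<subseteq> L"
    and c: "homeomorphic_map (subtopology T P) (subtopology (Euclidean_space N) V) c"
    and V: "openin (Euclidean_space N) V"
  shows "subtopology (leaf_topology T L) P = subtopology T P"
proof -
  have P_top: "topspace (subtopology T P) = P" using L P by auto
  have V_top: "topspace (subtopology (Euclidean_space N) V) = V" using openin_subset[OF V] by auto
  obtain d where d: "homeomorphic_maps (subtopology T P) (subtopology (Euclidean_space N) V) c d"
    using c by (auto simp: homeomorphic_map_maps)
  then have dc: "\<And>x. x \<in> P \<Longrightarrow> d (c x) = x" and cd: "\<And>v. v \<in> V \<Longrightarrow> c (d v) = v"
    and c_cont: "continuous_map (subtopology T P) (subtopology (Euclidean_space N) V) c"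
    and d_cont: "continuous_map (subtopology (Euclidean_space N) V) (subtopology T P) d"
    unfolding homeomorphic_maps_def P_top V_top by auto
  have dP: "d v \<in> P" if "v \<in> V" for v
    using d_cont that unfolding continuous_map_def P_top V_top by blast
  have cV: "c x \<in> V" if "x \<in> P" for x
    using c_cont that unfolding continuous_map_def P_top V_top by blast
  have id: "continuous_map (subtopology T P) (leaf_topology T L) (\<lambda>x. x)"
  proof (rule continuous_map_into_leaf_topology[OF L])
    show "(\<lambda>x. x) ` topspace (subtopology T P) \<subseteq> L" using P P_top by auto
    fix U Q x
    assume U: "openin T U" and Q: "Q \<in> path_components_of (subtopology T (L \<inter> U))"
      and "x \<in> topspace (subtopology T P)" and xQ: "x \<in> Q"
    then have xP: "x \<in> P" by (simp add: P_top)
    have xU: "x \<in> U" using xQ path_components_of_subset[OF Q] by auto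
    have "openin (subtopology (Euclidean_space N) V) {v \<in> topspace (subtopology (Euclidean_space N) V). d v \<in> P \<inter> U}"
      by (rule openin_continuous_map_preimage[OF d_cont]) (use U in \<open>auto simp: openin_subtopology\<close>)
    then have "openin (Euclidean_space N) {v \<in> V. d v \<in> P \<inter> U}"
      using V openin_trans_full unfolding V_top by blast
    moreover have "c x \<in> {v \<in> V. d v \<in> P \<inter> U}" using cV[OF xP] dc[OF xP] xP xU by simp
    ultimately obtain r where r: "r > 0" "cube N (c x) r \<subseteq> {v \<in> V. d v \<in> P \<inter> U}"
      by (rule cube_subset_open)
    let ?N = "{y \<in> P. c y \<in> cube N (c x) r}"
    have "c x \<in> topspace (Euclidean_space N)" using cV[OF xP] openin_subset[OF V] by blast
    then have cx: "c x \<in> cube N (c x) r" using r(1) by (rule centre_in_cube)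
    have "openin (subtopology (Euclidean_space N) V) (V \<inter> cube N (c x) r)"
      using openin_cube by (auto simp: openin_subtopology)
    from openin_continuous_map_preimage[OF c_cont this] have "openin (subtopology T P) ?N"
      unfolding P_top using cV by (simp add: Collect_conj_eq cong: conj_cong)
    moreover have "?N \<subseteq> Q"
    proof -
      have "path_connectedin (subtopology (Euclidean_space N) V) (cube N (c x) r)"
        using path_connectedin_lerp_closed[OF lerp_closed_cube, of N "c x" r] r(2)
        by (auto simp: path_connectedin_subtopology cube_def)
      then have "path_connectedin (subtopology T P) (d ` cube N (c x) r)"
        by (rule path_connectedin_continuous_map_image[OF d_cont])
      then have "path_connectedin (subtopology T (L \<inter> U)) (d ` cube N (c x) r)"
        using r(2) P by (auto simp: path_connectedin_subtopology)
      moreover have "x \<in> d ` cube N (c x) r" using cx dc[OF xP] by force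
      then have "\<not> disjnt Q (d ` cube N (c x) r)" using xQ by (auto simp: disjnt_def)
      ultimately have "d ` cube N (c x) r \<subseteq> Q" using path_components_of_maximal[OF Q] by blast
      then show ?thesis using dc by force
    qed
    ultimately show "\<exists>N. openin (subtopology T P) N \<and> x \<in> N \<and> (\<lambda>x. x) ` N \<subseteq> Q"
      using xP cx by (intro exI[of _ ?N]) auto
  qed
  show ?thesis
  proof (rule topology_eq[THEN iffD2], intro allI iffI)
    fix X assume "openin (subtopology (leaf_topology T L) P) X"
    then obtain W where W: "openin (leaf_topology T L) W" "X = W \<inter> P" by (auto simp: openin_subtopology)
    from openin_continuous_map_preimage[OF id W(1)] have "openin (subtopology T P) {x \<in> P. x \<in> W}"
      unfolding P_top .
    moreover have "{x \<in> P. x \<in> W} = X" using W(2) by auto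
    ultimately show "openin (subtopology T P) X" by simp
  next
    fix X assume "openin (subtopology T P) X"
    then obtain W where W: "openin T W" "X = W \<inter> P" by (auto simp: openin_subtopology)
    then have "X = (L \<inter> W) \<inter> P" using P by auto
    then show "openin (subtopology (leaf_topology T L) P) X"
      using openin_leaf_topology_Int[OF W(1)] by (auto simp: openin_subtopology)
  qed
qed

section \<open>Plaques as charts of the leaves\<close>

lemma smooth_prod_chartD:
  assumes "smooth_prod_chart k p T \<A> (U, \<phi>)"
  shows "openin T U" "openin (Euclidean_space (k + p)) ((append_coords k \<circ> \<phi>) ` U)"
    "homeomorphic_map (subtopology T U) (subtopology (Euclidean_space (k + p)) ((append_coords k \<circ> \<phi>) ` U)) (append_coords k \<circ> \<phi>)"
    "\<And>q. q \<in> U \<Longrightarrow> fst (\<phi> q) \<in> topspace (Euclidean_space k)"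
    "\<And>q. q \<in> U \<Longrightarrow> snd (\<phi> q) \<in> topspace (Euclidean_space p)"
  using assms by (auto simp: smooth_prod_chart_def smooth_chart_def topological_chart_def image_subset_iff mem_Times_iff)

lemma append_coords_in_topspace:
  "x \<in> topspace (Euclidean_space p) \<Longrightarrow> append_coords k (t, x) \<in> topspace (Euclidean_space (k + p))"
  by (auto simp: topspace_Euclidean_space append_coords_def)

lemma append_coords_inject:
  assumes "t \<in> topspace (Euclidean_space k)" "t' \<in> topspace (Euclidean_space k)"
    and "append_coords k (t, x) = append_coords k (t', x')"
  shows "t = t'" "x = x'"
proof -
  have "t i = t' i" for i
    using fun_cong[OF assms(3), of i] assms(1,2) by (cases "i < k") (auto simp: append_coords_def topspace_Euclidean_space)
  then show "t = t'" by auto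
  have "x i = x' i" for i using fun_cong[OF assms(3), of "k + i"] by (simp add: append_coords_def)
  then show "x = x'" by auto
qed

text \<open>
  The slice \<open>{t} \<times> V\<close> of a product chart is parametrised continuously by \<open>V\<close>.
\<close>

lemma slice_inverse:
  assumes U: "smooth_prod_chart k p T \<A> (U, \<phi>)" and V: "V \<subseteq> topspace (Euclidean_space p)"
    and sub: "{t} \<times> V \<subseteq> \<phi> ` U"
  obtains d where "continuous_map (subtopology (Euclidean_space p) V) (subtopology T U) d"
    "\<And>x. x \<in> V \<Longrightarrow> d x \<in> U \<and> \<phi> (d x) = (t, x)" "\<And>q. q \<in> U \<Longrightarrow> fst (\<phi> q) = t \<Longrightarrow> snd (\<phi> q) \<in> V \<Longrightarrow> d (snd (\<phi> q)) = q"
proof -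
  note U = smooth_prod_chartD[OF U]
  define a where "a = append_coords k \<circ> \<phi>"
  have U_top: "topspace (subtopology T U) = U" using openin_subset[OF U(1)] by auto
  have V_top: "topspace (subtopology (Euclidean_space p) V) = V" using V by auto
  have aU_top: "topspace (subtopology (Euclidean_space (k + p)) (a ` U)) = a ` U"
    using openin_subset[OF U(2)] by (auto simp: a_def)
  obtain b where b: "homeomorphic_maps (subtopology T U) (subtopology (Euclidean_space (k + p)) (a ` U)) a b"
    using U(3) by (auto simp: homeomorphic_map_maps a_def)
  then have b_cont: "continuous_map (subtopology (Euclidean_space (k + p)) (a ` U)) (subtopology T U) b"
    and ba: "\<And>q. q \<in> U \<Longrightarrow> b (a q) = q"
    unfolding homeomorphic_maps_def U_top by auto
  have a_eq: "append_coords k (\<phi> q) = a q" for q by (simp add: a_def)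
  have in_image: "append_coords k (t, x) \<in> a ` U" if "x \<in> V" for x
    using sub that unfolding a_def image_comp[symmetric] by blast
  have "continuous_map (subtopology (Euclidean_space p) V) (Euclidean_space (k + p)) (\<lambda>x. append_coords k (t, x))"
    unfolding continuous_map_into_Euclidean_space V_top
  proof (intro conjI allI impI)
    show "(\<lambda>x. append_coords k (t, x)) ` V \<subseteq> topspace (Euclidean_space (k + p))"
      using V append_coords_in_topspace by blast
    fix i
    show "continuous_map (subtopology (Euclidean_space p) V) euclideanreal (\<lambda>x. append_coords k (t, x) i)"
      by (cases "i < k") (auto simp: append_coords_def intro: continuous_map_from_subtopology continuous_map_coordinate)
  qed
  then have "continuous_map (subtopology (Euclidean_space p) V) (subtopology (Euclidean_space (k + p)) (a ` U)) (\<lambda>x. append_coords k (t, x))"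
    using in_image V_top by (auto simp: continuous_map_in_subtopology)
  then have "continuous_map (subtopology (Euclidean_space p) V) (subtopology T U) (b \<circ> (\<lambda>x. append_coords k (t, x)))"
    by (rule continuous_map_compose[OF _ b_cont])
  moreover have "(b \<circ> (\<lambda>x. append_coords k (t, x))) x \<in> U \<and> \<phi> ((b \<circ> (\<lambda>x. append_coords k (t, x))) x) = (t, x)" if x: "x \<in> V" for x
  proof -
    have "(t, x) \<in> \<phi> ` U" using sub x by blast
    then obtain q where q: "q \<in> U" "\<phi> q = (t, x)" by auto
    then have "b (append_coords k (t, x)) = q" using ba[OF q(1)] a_eq[of q] by simp
    then show ?thesis using q by simp
  qed
  moreover have "(b \<circ> (\<lambda>x. append_coords k (t, x))) (snd (\<phi> q)) = q" if "q \<in> U" "fst (\<phi> q) = t" for q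
    using ba[OF that(1)] that(2) by (simp add: a_def) (metis prod.collapse)
  ultimately show thesis using that by blast
qed

lemma prod_chart_inj:
  assumes "smooth_prod_chart k p T \<A> (U, \<phi>)"
  shows "inj_on \<phi> U"
proof -
  note U = smooth_prod_chartD[OF assms]
  have "inj_on (append_coords k \<circ> \<phi>) U"
    using homeomorphic_imp_injective_map[OF U(3)] openin_subset[OF U(1)] by (simp add: Int_absorb1)
  then show ?thesis by (rule inj_on_imageI2)
qed

lemma plaque_chart_homeomorphic:
  assumes U: "smooth_prod_chart k p T \<A> (U, \<phi>)" and P: "P \<subseteq> U" "\<phi> ` P = {t} \<times> V" and V: "openin (Euclidean_space p) V"
  shows "homeomorphic_map (subtopology T P) (subtopology (Euclidean_space p) V) (snd \<circ> \<phi>)"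
proof -
  note UD = smooth_prod_chartD[OF U]
  have V_sub: "V \<subseteq> topspace (Euclidean_space p)" using openin_subset[OF V] .
  have sub: "{t} \<times> V \<subseteq> \<phi> ` U" using P by blast
  obtain d where d: "continuous_map (subtopology (Euclidean_space p) V) (subtopology T U) d"
    "\<And>x. x \<in> V \<Longrightarrow> d x \<in> U \<and> \<phi> (d x) = (t, x)"
    "\<And>q. q \<in> U \<Longrightarrow> fst (\<phi> q) = t \<Longrightarrow> snd (\<phi> q) \<in> V \<Longrightarrow> d (snd (\<phi> q)) = q"
    by (rule slice_inverse[OF U V_sub sub], rule that)
  have \<phi>P: "fst (\<phi> q) = t" "snd (\<phi> q) \<in> V" if "q \<in> P" for q
    using imageI[OF that, of \<phi>] unfolding P(2) by auto
  have dP: "d x \<in> P" if x: "x \<in> V" for x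
  proof -
    have "(t, x) \<in> \<phi> ` P" using x P(2) by blast
    then obtain q where q: "q \<in> P" "\<phi> q = (t, x)" by force
    then show ?thesis using d(3)[of q] P(1) \<phi>P[OF q(1)] by auto
  qed
  have P_top: "topspace (subtopology T P) = P" using openin_subset[OF UD(1)] P(1) by auto
  have V_top: "topspace (subtopology (Euclidean_space p) V) = V" using V_sub by auto
  have "homeomorphic_maps (subtopology T P) (subtopology (Euclidean_space p) V) (snd \<circ> \<phi>) d"
    unfolding homeomorphic_maps_def P_top V_top
  proof (intro conjI ballI)
    have "continuous_map (subtopology T U) (Euclidean_space (k + p)) (append_coords k \<circ> \<phi>)"
      using homeomorphic_imp_continuous_map[OF UD(3)] by (simp add: continuous_map_in_subtopology)
    then have "continuous_map (subtopology T P) (Euclidean_space (k + p)) (append_coords k \<circ> \<phi>)"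
      using P(1) by (rule continuous_map_from_subtopology_mono)
    then have "continuous_map (subtopology T P) euclideanreal (\<lambda>q. (append_coords k \<circ> \<phi>) q (k + i))" if "i < p" for i
      using that by (simp add: continuous_map_into_Euclidean_space)
    moreover have "(append_coords k \<circ> \<phi>) q (k + i) = snd (\<phi> q) i" for q i
      by (cases "\<phi> q") (simp add: append_coords_def)
    ultimately have "continuous_map (subtopology T P) (Euclidean_space p) (snd \<circ> \<phi>)"
      unfolding continuous_map_into_Euclidean_space P_top using \<phi>P V_sub by auto
    then show "continuous_map (subtopology T P) (subtopology (Euclidean_space p) V) (snd \<circ> \<phi>)"
      using \<phi>P P_top by (auto simp: continuous_map_in_subtopology)
    show "continuous_map (subtopology (Euclidean_space p) V) (subtopology T P) d"
      using d(1) dP V_top by (auto simp: continuous_map_in_subtopology)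
  next
    fix x assume "x \<in> P"
    then show "d ((snd \<circ> \<phi>) x) = x" using d(3)[of x] P(1) \<phi>P by auto
  next
    fix y assume "y \<in> V"
    then show "(snd \<circ> \<phi>) (d y) = y" using d(2) by simp
  qed
  then show ?thesis by (auto simp: homeomorphic_map_maps)
qed

lemma snd_image_slice: "\<phi> ` P = {t} \<times> V \<Longrightarrow> (snd \<circ> \<phi>) ` P = V"
  by (simp only: image_comp[symmetric]) force

locale foliated_structure =
  fixes G :: "((nat \<Rightarrow> real) \<Rightarrow> (nat \<Rightarrow> real)) set" and p k :: nat
    and T :: "'m topology" and \<A> :: "'m chart set" and \<FF> :: "'m set set" and \<Phi> :: "'m prod_chart set"
  assumes foliated: "GX_foliated_manifold G p k T \<A> \<FF> \<Phi>"
begin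

lemma Hausdorff: "Hausdorff_space T"
  using foliated by (simp add: GX_foliated_manifold_def smooth_manifold_def)

lemma leaves: "\<Union>\<FF> = topspace T" "{} \<notin> \<FF>" "pairwise disjnt \<FF>" "\<And>L. L \<in> \<FF> \<Longrightarrow> path_connectedin T L"
  using foliated by (auto simp: GX_foliated_manifold_def foliation_def)

lemma leaf_subset: "L \<in> \<FF> \<Longrightarrow> L \<subseteq> topspace T"
  using leaves(1) by blast

lemma leaf_unique: "L \<in> \<FF> \<Longrightarrow> L' \<in> \<FF> \<Longrightarrow> q \<in> L \<Longrightarrow> q \<in> L' \<Longrightarrow> L = L'"
  using leaves(3) by (auto simp: pairwise_def disjnt_def)

lemma charts_cover: "q \<in> topspace T \<Longrightarrow> \<exists>(U, \<phi>)\<in>\<Phi>. q \<in> U"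
  using foliated unfolding GX_foliated_manifold_def by (elim conjE) (erule bspec)

lemma chart_smooth: "(U, \<phi>) \<in> \<Phi> \<Longrightarrow> smooth_prod_chart k p T \<A> (U, \<phi>)"
proof -
  have "\<forall>(U, \<phi>)\<in>\<Phi>. smooth_prod_chart k p T \<A> (U, \<phi>) \<and>
        (\<forall>P\<in>induced_leaves T \<FF> U. \<exists>t V. openin (Euclidean_space p) V \<and> \<phi> ` P = {t} \<times> V)"
    using foliated unfolding GX_foliated_manifold_def by (elim conjE)
  then show "(U, \<phi>) \<in> \<Phi> \<Longrightarrow> smooth_prod_chart k p T \<A> (U, \<phi>)" by auto
qed

lemma plaque_image:
  assumes "(U, \<phi>) \<in> \<Phi>" "L \<in> \<FF>" "P \<in> path_components_of (subtopology T (L \<inter> U))"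
  obtains t V where "openin (Euclidean_space p) V" "\<phi> ` P = {t} \<times> V"
proof -
  have "\<forall>(U, \<phi>)\<in>\<Phi>. smooth_prod_chart k p T \<A> (U, \<phi>) \<and>
        (\<forall>P\<in>induced_leaves T \<FF> U. \<exists>t V. openin (Euclidean_space p) V \<and> \<phi> ` P = {t} \<times> V)"
    using foliated unfolding GX_foliated_manifold_def by (elim conjE)
  from bspec[OF this assms(1)] have "\<forall>P\<in>induced_leaves T \<FF> U. \<exists>t V. openin (Euclidean_space p) V \<and> \<phi> ` P = {t} \<times> V"
    by simp
  moreover have "P \<in> induced_leaves T \<FF> U" using assms(2,3) by (auto simp: induced_leaves_def)
  ultimately have "\<exists>t V. openin (Euclidean_space p) V \<and> \<phi> ` P = {t} \<times> V" by (rule bspec)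
  then show thesis using that by blast
qed

lemma chart_transition:
  assumes "(U, \<phi>) \<in> \<Phi>" "(V, \<psi>) \<in> \<Phi>"
  obtains h g where "\<And>t. g t \<in> G" "\<And>q. q \<in> U \<Longrightarrow> q \<in> V \<Longrightarrow> \<psi> q = (h (fst (\<phi> q)), g (fst (\<phi> q)) (snd (\<phi> q)))"
proof -
  have "\<forall>(U, \<phi>)\<in>\<Phi>. \<forall>(V, \<psi>)\<in>\<Phi>. \<exists>h g. (\<forall>t. g t \<in> G) \<and>
        (\<forall>q\<in>U \<inter> V. \<psi> q = (h (fst (\<phi> q)), g (fst (\<phi> q)) (snd (\<phi> q))))"
    using foliated unfolding GX_foliated_manifold_def by (elim conjE)
  from bspec[OF this assms(1)] have "\<forall>(V, \<psi>)\<in>\<Phi>. \<exists>h g. (\<forall>t. g t \<in> G) \<and>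
        (\<forall>q\<in>U \<inter> V. \<psi> q = (h (fst (\<phi> q)), g (fst (\<phi> q)) (snd (\<phi> q))))" by simp
  from bspec[OF this assms(2)] have "\<exists>h g. (\<forall>t. g t \<in> G) \<and>
        (\<forall>q\<in>U \<inter> V. \<psi> q = (h (fst (\<phi> q)), g (fst (\<phi> q)) (snd (\<phi> q))))" by simp
  then obtain h g where "\<forall>t. g t \<in> G" "\<forall>q\<in>U \<inter> V. \<psi> q = (h (fst (\<phi> q)), g (fst (\<phi> q)) (snd (\<phi> q)))"
    by (elim exE conjE) (rule that)
  then show thesis by (intro that[of g h]) auto
qed

lemma plaque_subset:
  "P \<in> path_components_of (subtopology T (L \<inter> U)) \<Longrightarrow> P \<subseteq> L \<and> P \<subseteq> U"
  using path_components_of_subset by fastforce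

lemma plaque_through:
  assumes "(U, \<phi>) \<in> \<Phi>" "q \<in> U"
  obtains L P where "L \<in> \<FF>" "P \<in> path_components_of (subtopology T (L \<inter> U))" "q \<in> P"
proof -
  have "q \<in> topspace T" using openin_subset[OF smooth_prod_chartD(1)[OF chart_smooth[OF assms(1)]]] assms(2) by blast
  then obtain L where L: "L \<in> \<FF>" "q \<in> L" using leaves(1) by blast
  then have "q \<in> topspace (subtopology T (L \<inter> U))" using \<open>q \<in> topspace T\<close> assms(2) by simp
  then have "q \<in> \<Union>(path_components_of (subtopology T (L \<inter> U)))" by (simp only: Union_path_components_of)
  then show thesis using L(1) that by blast
qed

lemma plaque_unique:
  assumes "L \<in> \<FF>" "P \<in> path_components_of (subtopology T (L \<inter> U))"
    and "L' \<in> \<FF>" "P' \<in> path_components_of (subtopology T (L' \<inter> U))"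
    and "q \<in> P" "q \<in> P'"
  shows "P = P'"
proof -
  have "L = L'" using leaf_unique[OF assms(1,3)] plaque_subset[OF assms(2)] plaque_subset[OF assms(4)] assms(5,6) by blast
  then show ?thesis using path_components_of_overlap[OF assms(2), of P'] assms(4,5,6) by blast
qed

text \<open>
  The plaques with transverse coordinate \<open>t\<close> cut the slice of \<open>\<phi> ` U\<close> at \<open>t\<close> into disjoint open sets, so a
  connected part of the slice lies in the image of one plaque.
\<close>

lemma plaque_contains_slice:
  assumes U: "(U, \<phi>) \<in> \<Phi>" and P: "L \<in> \<FF>" "P \<in> path_components_of (subtopology T (L \<inter> U))" "q \<in> P"
    and K: "connectedin (Euclidean_space p) K" "{fst (\<phi> q)} \<times> K \<subseteq> \<phi> ` U" "snd (\<phi> q) \<in> K"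
  shows "K \<subseteq> (snd \<circ> \<phi>) ` P"
proof -
  define t where "t = fst (\<phi> q)"
  define W where "W = \<Union>{V. openin (Euclidean_space p) V \<and> (\<exists>L'\<in>\<FF>. \<exists>P'\<in>path_components_of (subtopology T (L' \<inter> U)).
     P' \<noteq> P \<and> \<phi> ` P' = {t} \<times> V)}"
  obtain t' V where V: "openin (Euclidean_space p) V" "\<phi> ` P = {t'} \<times> V" by (rule plaque_image[OF U P(1,2)])
  have "\<phi> q \<in> {t'} \<times> V" using V(2) P(3) by blast
  then have t': "t' = t" and qV: "snd (\<phi> q) \<in> V" by (auto simp: t_def)
  have "openin (Euclidean_space p) W" by (auto simp: W_def)
  moreover have "K \<subseteq> V \<union> W"
  proof
    fix x assume x: "x \<in> K"
    then have "(t, x) \<in> \<phi> ` U" using K(2) by (auto simp: t_def)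
    then obtain m where m: "m \<in> U" "\<phi> m = (t, x)" by force
    obtain L' P' where P': "L' \<in> \<FF>" "P' \<in> path_components_of (subtopology T (L' \<inter> U))" "m \<in> P'"
      by (rule plaque_through[OF U m(1)])
    obtain t'' V' where V': "openin (Euclidean_space p) V'" "\<phi> ` P' = {t''} \<times> V'" by (rule plaque_image[OF U P'(1,2)])
    have "\<phi> m \<in> {t''} \<times> V'" using V'(2) P'(3) by blast
    then have *: "t'' = t" "x \<in> V'" using m(2) by auto
    show "x \<in> V \<union> W"
    proof (cases "P' = P")
      case True
      then have "{t''} \<times> V' = {t'} \<times> V" using V(2) V'(2) by simp
      then show ?thesis using * by auto
    next
      case False
      then have "V' \<subseteq> W" unfolding W_def using V' P'(1,2) *(1) by blast
      then show ?thesis using *(2) by blast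
    qed
  qed
  moreover have "V \<inter> W = {}"
  proof (rule ccontr)
    assume "V \<inter> W \<noteq> {}"
    then obtain x V' L' P' where x: "x \<in> V" "x \<in> V'" and P': "L' \<in> \<FF>" "P' \<in> path_components_of (subtopology T (L' \<inter> U))"
      "P' \<noteq> P" "\<phi> ` P' = {t} \<times> V'" unfolding W_def by blast
    have "(t, x) \<in> \<phi> ` P" "(t, x) \<in> \<phi> ` P'" using x V(2) P'(4) t' by auto
    then obtain m m' where m: "m \<in> P" "\<phi> m = (t, x)" "m' \<in> P'" "\<phi> m' = (t, x)" by (metis imageE)
    then have "m = m'"
      using inj_onD[OF prod_chart_inj[OF chart_smooth[OF U]], of m m'] plaque_subset[OF P(2)] plaque_subset[OF P'(2)] by auto
    then have "P = P'" using plaque_unique[OF P(1,2) P'(1,2)] m(1,3) by blast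
    then show False using P'(3) by simp
  qed
  moreover have "V \<inter> K \<noteq> {}" using qV K(3) by blast
  ultimately have "W \<inter> K = {}" using K(1) V(1) unfolding connectedin by blast
  then have "K \<subseteq> V" using \<open>K \<subseteq> V \<union> W\<close> by blast
  moreover have "(snd \<circ> \<phi>) ` P = V" using V(2) by (rule snd_image_slice)
  ultimately show ?thesis by simp
qed

text \<open>
  If the box of radius \<open>r\<close> around the image of \<open>q\<close> fits into a foliated chart, then for all \<open>q'\<close> mapped to the
  box of radius \<open>r / 2\<close> the slice through \<open>q'\<close> contains a box of radius \<open>r / 2\<close>.  Finitely many such neighbourhoods
  cover the compact manifold.
\<close>

lemma uniform_plaque_size:
  assumes "compact_space T"
  obtains \<eta> where "\<eta> > 0"
    "\<And>q. q \<in> topspace T \<Longrightarrow> \<exists>(U, \<phi>)\<in>\<Phi>. q \<in> U \<and> (\<forall>L\<in>\<FF>. \<forall>P\<in>path_components_of (subtopology T (L \<inter> U)).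
       q \<in> P \<longrightarrow> cube p (snd (\<phi> q)) \<eta> \<subseteq> (snd \<circ> \<phi>) ` P)"
proof -
  define fits_chart where "fits_chart U \<phi> q e \<longleftrightarrow> q \<in> U \<and> (\<forall>L\<in>\<FF>. \<forall>P\<in>path_components_of (subtopology T (L \<inter> U)).
       q \<in> P \<longrightarrow> cube p (snd (\<phi> q)) e \<subseteq> (snd \<circ> \<phi>) ` P)" for U and \<phi> :: "'m \<Rightarrow> (nat \<Rightarrow> real) \<times> (nat \<Rightarrow> real)" and q e
  define fits where "fits q e \<longleftrightarrow> (\<exists>(U, \<phi>)\<in>\<Phi>. fits_chart U \<phi> q e)" for q e
  have fits_mono: "fits q e'" if "fits q e" "e' \<le> e" for q e e'
  proof -
    have "cube p x e' \<subseteq> cube p x e" for x using that(2) by (auto simp: cube_def intro: less_le_trans)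
    then have "fits_chart U \<phi> q e'" if "fits_chart U \<phi> q e" for U and \<phi> :: "'m \<Rightarrow> (nat \<Rightarrow> real) \<times> (nat \<Rightarrow> real)"
      using that unfolding fits_chart_def by (meson subset_trans)
    then show ?thesis using that(1) unfolding fits_def by auto
  qed
  have local: "\<exists>N e. openin T N \<and> q \<in> N \<and> e > 0 \<and> (\<forall>q'\<in>N. fits q' e)" if q: "q \<in> topspace T" for q
  proof -
    obtain U \<phi> where U: "(U, \<phi>) \<in> \<Phi>" "q \<in> U" using charts_cover[OF q] by auto
    note UD = smooth_prod_chartD[OF chart_smooth[OF U(1)]]
    define a where "a = append_coords k \<circ> \<phi>"
    obtain r where r: "r > 0" "cube (k + p) (a q) r \<subseteq> a ` U"
      by (rule cube_subset_open[of "k + p" "a ` U" "a q"]) (use UD(2) U(2) in \<open>auto simp: a_def\<close>)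
    define N where "N = {q' \<in> U. a q' \<in> cube (k + p) (a q) (r / 2)}"
    have U_top: "topspace (subtopology T U) = U" using openin_subset[OF UD(1)] by auto
    have "continuous_map (subtopology T U) (Euclidean_space (k + p)) a"
      using homeomorphic_imp_continuous_map[OF UD(3)] by (simp add: continuous_map_in_subtopology a_def)
    from openin_continuous_map_preimage[OF this openin_cube[of "k + p" "a q" "r / 2"]] have "openin (subtopology T U) N"
      unfolding U_top N_def .
    then have "openin T N" using UD(1) openin_trans_full by blast
    moreover have "a q \<in> topspace (Euclidean_space (k + p))" using UD(2) U(2) openin_subset by (auto simp: a_def)
    then have "q \<in> N" using U(2) r(1) by (simp add: N_def centre_in_cube)
    moreover have "fits q' (r / 2)" if q': "q' \<in> N" for q'
    proof -
      have q'U: "q' \<in> U" and aq': "a q' \<in> cube (k + p) (a q) (r / 2)" using q' by (auto simp: N_def)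
      have slice: "{fst (\<phi> q')} \<times> cube p (snd (\<phi> q')) (r / 2) \<subseteq> \<phi> ` U"
      proof (clarify)
        fix x assume x: "x \<in> cube p (snd (\<phi> q')) (r / 2)"
        let ?t = "fst (\<phi> q')"
        have aq'_eq: "a q' i = (if i < k then ?t i else snd (\<phi> q') (i - k))" for i
          by (cases "\<phi> q'") (simp add: a_def append_coords_def)
        have "\<bar>append_coords k (?t, x) i - a q i\<bar> < r" if i: "i < k + p" for i
        proof -
          have 1: "\<bar>a q' i - a q i\<bar> < r / 2" using aq' i by (simp add: cube_def)
          have 2: "\<bar>append_coords k (?t, x) i - a q' i\<bar> < r / 2"
          proof (cases "i < k")
            case True
            then show ?thesis using r(1) by (simp add: aq'_eq append_coords_def)
          next
            case False
            then have "i - k < p" using i by simp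
            then show ?thesis using False x by (simp add: aq'_eq append_coords_def cube_def)
          qed
          show ?thesis using 1 2 by linarith
        qed
        then have "append_coords k (?t, x) \<in> cube (k + p) (a q) r"
          using x append_coords_in_topspace[of x p k] by (simp add: cube_def)
        then obtain m where m: "m \<in> U" "append_coords k (?t, x) = append_coords k (\<phi> m)" using r(2) by (auto simp: a_def)
        then have "append_coords k (?t, x) = append_coords k (fst (\<phi> m), snd (\<phi> m))" by simp
        from append_coords_inject[OF UD(4)[OF q'U] UD(4)[OF m(1)] this] have "\<phi> m = (?t, x)"
          by (metis prod.collapse)
        then show "(?t, x) \<in> \<phi> ` U" using m(1) by (metis imageI)
      qed
      have "cube p (snd (\<phi> q')) (r / 2) \<subseteq> (snd \<circ> \<phi>) ` P"
        if "L \<in> \<FF>" "P \<in> path_components_of (subtopology T (L \<inter> U))" "q' \<in> P" for L P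
      proof (rule plaque_contains_slice[OF U(1) that _ slice])
        show "connectedin (Euclidean_space p) (cube p (snd (\<phi> q')) (r / 2))"
          by (rule connectedin_lerp_closed[OF lerp_closed_cube]) (auto simp: cube_def)
        show "snd (\<phi> q') \<in> cube p (snd (\<phi> q')) (r / 2)"
          using UD(5)[OF q'U] r(1) by (simp add: centre_in_cube)
      qed
      then have "fits_chart U \<phi> q' (r / 2)" unfolding fits_chart_def using q'U by blast
      then show ?thesis unfolding fits_def using U(1) by (intro bexI[OF _ U(1)] case_prodI)
    qed
    ultimately show ?thesis using r(1) by (intro exI[of _ N] exI[of _ "r / 2"]) auto
  qed
  define \<U> where "\<U> = {N. openin T N \<and> (\<exists>e>0. \<forall>q\<in>N. fits q e)}"
  have "topspace T \<subseteq> \<Union>\<U>"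
  proof
    fix q assume "q \<in> topspace T"
    from local[OF this] show "q \<in> \<Union>\<U>" unfolding \<U>_def by blast
  qed
  moreover have "\<forall>N\<in>\<U>. openin T N" by (simp add: \<U>_def)
  ultimately obtain \<N> where \<N>: "finite \<N>" "\<N> \<subseteq> \<U>" "topspace T \<subseteq> \<Union>\<N>"
    using assms unfolding compact_space_def compactin_def by meson
  have "\<forall>N\<in>\<N>. \<exists>e. e > 0 \<and> (\<forall>q\<in>N. fits q e)" using \<N>(2) by (auto simp: \<U>_def)
  from bchoice[OF this] obtain e where e: "\<forall>N\<in>\<N>. e N > 0 \<and> (\<forall>q\<in>N. fits q (e N))" by (rule exE)
  define \<eta> where "\<eta> = Min (insert 1 (e ` \<N>))"
  have "\<eta> > 0" using \<N>(1) e by (simp add: \<eta>_def)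
  moreover have "fits q \<eta>" if q: "q \<in> topspace T" for q
  proof -
    obtain N where N: "N \<in> \<N>" "q \<in> N" using \<N>(3) q by blast
    have "\<eta> \<le> e N" using \<N>(1) N(1) by (auto simp: \<eta>_def intro: Min_le)
    then show ?thesis using fits_mono e N by blast
  qed
  ultimately show thesis using that unfolding fits_def fits_chart_def by blast
qed

lemma leaf_atlasE:
  assumes "(P, c) \<in> leaf_atlas T \<Phi> L"
  obtains U \<phi> where "(U, \<phi>) \<in> \<Phi>" "P \<in> path_components_of (subtopology T (L \<inter> U))" "c = snd \<circ> \<phi>"
  using assms unfolding leaf_atlas_def by blast

lemma topological_chart_leaf:
  assumes L: "L \<in> \<FF>" and P: "(P, c) \<in> leaf_atlas T \<Phi> L"
  shows "topological_chart p (leaf_topology T L) (P, c)"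
proof -
  obtain U \<phi> where U: "(U, \<phi>) \<in> \<Phi>" "P \<in> path_components_of (subtopology T (L \<inter> U))" "c = snd \<circ> \<phi>"
    by (rule leaf_atlasE[OF P])
  obtain t V where V: "openin (Euclidean_space p) V" "\<phi> ` P = {t} \<times> V" by (rule plaque_image[OF U(1) L U(2)])
  have hom: "homeomorphic_map (subtopology T P) (subtopology (Euclidean_space p) V) c"
    unfolding U(3) by (rule plaque_chart_homeomorphic[OF chart_smooth[OF U(1)] _ V(2,1)]) (use plaque_subset[OF U(2)] in blast)
  have "c ` P = V" unfolding U(3) using V(2) by (rule snd_image_slice)
  moreover have "subtopology (leaf_topology T L) P = subtopology T P"
    by (rule leaf_topology_on_plaque[OF leaf_subset[OF L] _ hom V(1)]) (use plaque_subset[OF U(2)] in blast)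
  moreover have "openin (leaf_topology T L) P"
    by (rule openin_leaf_topology_plaque[OF smooth_prod_chartD(1)[OF chart_smooth[OF U(1)]] U(2)])
  ultimately show ?thesis using hom V(1) by (simp add: topological_chart_def)
qed

text \<open>
  The transverse coordinate is constant on a plaque, so the transition map of foliated charts restricts to
  a single group element on the overlap of two plaques.
\<close>

lemma leaf_transition:
  assumes L: "L \<in> \<FF>" and P: "(P, c) \<in> leaf_atlas T \<Phi> L" and Q: "(Q, d) \<in> leaf_atlas T \<Phi> L"
  shows "\<exists>g\<in>G. \<forall>q\<in>P \<inter> Q. d q = g (c q)"
proof -
  obtain U \<phi> where U: "(U, \<phi>) \<in> \<Phi>" "P \<in> path_components_of (subtopology T (L \<inter> U))" "c = snd \<circ> \<phi>"
    by (rule leaf_atlasE[OF P])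
  obtain U' \<psi> where U': "(U', \<psi>) \<in> \<Phi>" "Q \<in> path_components_of (subtopology T (L \<inter> U'))" "d = snd \<circ> \<psi>"
    by (rule leaf_atlasE[OF Q])
  obtain t V where V: "openin (Euclidean_space p) V" "\<phi> ` P = {t} \<times> V" by (rule plaque_image[OF U(1) L U(2)])
  obtain h g where g: "\<And>t. g t \<in> G" "\<And>q. q \<in> U \<Longrightarrow> q \<in> U' \<Longrightarrow> \<psi> q = (h (fst (\<phi> q)), g (fst (\<phi> q)) (snd (\<phi> q)))"
    by (rule chart_transition[OF U(1) U'(1)], rule that)
  have "d q = g t (c q)" if q: "q \<in> P \<inter> Q" for q
  proof -
    have "q \<in> U" "q \<in> U'" using q plaque_subset[OF U(2)] plaque_subset[OF U'(2)] by auto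
    moreover have "\<phi> q \<in> {t} \<times> V" using q V(2) by blast
    then have "fst (\<phi> q) = t" by auto
    ultimately show ?thesis using g(2)[of q] by (simp add: U(3) U'(3))
  qed
  then show ?thesis using g(1) by blast
qed

lemma leaf_atlas_cover:
  assumes "L \<in> \<FF>" "q \<in> L" "(U, \<phi>) \<in> \<Phi>" "q \<in> U"
  obtains P where "P \<in> path_components_of (subtopology T (L \<inter> U))" "q \<in> P" "(P, snd \<circ> \<phi>) \<in> leaf_atlas T \<Phi> L"
proof -
  have "q \<in> topspace (subtopology T (L \<inter> U))" using assms(2,4) leaf_subset[OF assms(1)] by auto
  then have "q \<in> \<Union>(path_components_of (subtopology T (L \<inter> U)))" by (simp only: Union_path_components_of)
  then obtain P where P: "P \<in> path_components_of (subtopology T (L \<inter> U))" "q \<in> P" by blast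
  then have "(P, snd \<circ> \<phi>) \<in> leaf_atlas T \<Phi> L" unfolding leaf_atlas_def using assms(3) by blast
  then show thesis using P that by blast
qed

end

section \<open>Completeness of the leaves\<close>

theorem theorem1p13:
  fixes n k :: nat
    and T :: "'m topology"
    and \<A> :: "'m chart set"
    and \<FF> :: "'m set set"
    and \<Phi> :: "'m prod_chart set"
  assumes "compact_space T"
    and "GX_foliated_manifold (L_group n) (n + 1) k T \<A> \<FF> \<Phi>"
  shows "(\<forall>L\<in>\<FF>. GX_complete (L_group n) (n + 1) (leaf_topology T L) (leaf_atlas T \<Phi> L)) \<longleftrightarrow>
    (\<forall>L\<in>\<FF>. \<forall>I \<gamma>.
       affine_geodesic (n + 1) (leaf_atlas T \<Phi> L) I \<gamma> \<and>
       tangent_to_line_field (n + 1) (leaf_atlas T \<Phi> L) I \<gamma> \<longrightarrow>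
       geodesically_complete (n + 1) (leaf_atlas T \<Phi> L) I \<gamma>)"
    (is "?complete \<longleftrightarrow> ?geodesics")
proof -
  interpret foliated_structure "L_group n" "Suc n" k T \<A> \<FF> \<Phi>
    using assms(2) by unfold_locales simp
  have leaf: "L_structure n (leaf_topology T L) (leaf_atlas T \<Phi> L)" if L: "L \<in> \<FF>" for L
  proof
    show "Hausdorff_space (leaf_topology T L)"
      by (rule Hausdorff_leaf_topology[OF Hausdorff leaf_subset[OF L]])
    show "connected_space (leaf_topology T L)"
      using path_connected_leaf_topology[OF leaves(4)[OF L]] path_connected_imp_connected_space by blast
    show "topological_chart (Suc n) (leaf_topology T L) (P, c)" if "(P, c) \<in> leaf_atlas T \<Phi> L" for P c
      by (rule topological_chart_leaf[OF L that])
    show "\<exists>g\<in>L_group n. \<forall>q\<in>P \<inter> Q. d q = g (c q)"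
      if "(P, c) \<in> leaf_atlas T \<Phi> L" "(Q, d) \<in> leaf_atlas T \<Phi> L" for P c Q d
      by (rule leaf_transition[OF L that])
    fix q assume "q \<in> topspace (leaf_topology T L)"
    then have q: "q \<in> L" by (simp add: topspace_leaf_topology[OF leaf_subset[OF L]])
    then obtain U \<phi> where U: "(U, \<phi>) \<in> \<Phi>" "q \<in> U" using charts_cover[of q] leaf_subset[OF L] by auto
    show "\<exists>(P, c)\<in>leaf_atlas T \<Phi> L. q \<in> P"
      by (rule leaf_atlas_cover[OF L q U]) auto
  qed
  show ?thesis
  proof
    assume complete: ?complete
    show ?geodesics
    proof (intro ballI allI impI, elim conjE)
      fix L I \<gamma>
      assume L: "L \<in> \<FF>" and \<gamma>: "affine_geodesic (n + 1) (leaf_atlas T \<Phi> L) I \<gamma>"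
      interpret L_structure n "leaf_topology T L" "leaf_atlas T \<Phi> L" by (rule leaf[OF L])
      from bspec[OF complete L] obtain E :: "(real \<Rightarrow> 'm) set topology" and \<pi> Dev
        where E: "universal_covering E (leaf_topology T L) \<pi>" "developing_map (L_group n) (leaf_atlas T \<Phi> L) E \<pi> Dev"
          "covering_map_of E (Euclidean_space (n + 1)) Dev"
        unfolding GX_complete_def by (elim exE conjE) (rule that)
      have surj: "\<pi> ` topspace E = topspace (leaf_topology T L)"
        using E(1) unfolding universal_covering_def covering_map_of_def by (elim conjE)
      have cov: "covering_map_of E model Dev" using E(3) by simp
      have I: "is_interval I" "I \<noteq> {}" and ch: "charted_on euclideanreal (lines n) I \<gamma>"
        using \<gamma> by (simp_all only: affine_geodesic_iff simp_thms)
      obtain s where s: "s \<in> I" using I(2) by blast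
      obtain \<delta> where \<delta>: "charted_on euclideanreal (lines n) UNIV \<delta>" "\<And>s. s \<in> I \<Longrightarrow> \<delta> s = \<gamma> s"
        by (rule geodesic_extends_if_developing_covering[OF surj E(2) cov I(1) s ch], rule that)
      have "affine_geodesic (n + 1) (leaf_atlas T \<Phi> L) UNIV \<delta>"
        unfolding affine_geodesic_iff using \<delta>(1) by (simp add: is_interval_univ)
      then show "geodesically_complete (n + 1) (leaf_atlas T \<Phi> L) I \<gamma>"
        unfolding geodesically_complete_def using \<delta>(2) by blast
    qed
  next
    assume geodesics: ?geodesics
    obtain \<eta> where \<eta>: "\<eta> > 0"
      "\<And>q. q \<in> topspace T \<Longrightarrow> \<exists>(U, \<phi>)\<in>\<Phi>. q \<in> U \<and> (\<forall>L\<in>\<FF>. \<forall>P\<in>path_components_of (subtopology T (L \<inter> U)).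
         q \<in> P \<longrightarrow> cube (Suc n) (snd (\<phi> q)) \<eta> \<subseteq> (snd \<circ> \<phi>) ` P)"
      by (rule uniform_plaque_size[OF assms(1)], rule that)
    show ?complete
    proof
      fix L assume L: "L \<in> \<FF>"
      interpret vertically_complete_L_structure n "leaf_topology T L" "leaf_atlas T \<Phi> L" \<eta>
      proof (intro vertically_complete_L_structure.intro leaf[OF L] vertically_complete_L_structure_axioms.intro)
        show "\<eta> > 0" by (rule \<eta>(1))
        show "geodesically_complete (n + 1) (leaf_atlas T \<Phi> L) I \<gamma>"
          if "affine_geodesic (n + 1) (leaf_atlas T \<Phi> L) I \<gamma>" "tangent_to_line_field (n + 1) (leaf_atlas T \<Phi> L) I \<gamma>" for I \<gamma>
          using geodesics L that by blast
        fix q assume "q \<in> topspace (leaf_topology T L)"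
        then have q: "q \<in> L" by (simp add: topspace_leaf_topology[OF leaf_subset[OF L]])
        then have "q \<in> topspace T" using leaf_subset[OF L] by blast
        from \<eta>(2)[OF this] obtain U \<phi> where U: "(U, \<phi>) \<in> \<Phi>" "q \<in> U"
          "\<forall>L\<in>\<FF>. \<forall>P\<in>path_components_of (subtopology T (L \<inter> U)). q \<in> P \<longrightarrow> cube (Suc n) (snd (\<phi> q)) \<eta> \<subseteq> (snd \<circ> \<phi>) ` P"
          by auto
        obtain P where P: "P \<in> path_components_of (subtopology T (L \<inter> U))" "q \<in> P" "(P, snd \<circ> \<phi>) \<in> leaf_atlas T \<Phi> L"
          by (rule leaf_atlas_cover[OF L q U(1,2)])
        have "cube (Suc n) ((snd \<circ> \<phi>) q) \<eta> \<subseteq> (snd \<circ> \<phi>) ` P" using U(3) L P(1,2) by simp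
        then show "\<exists>(P, c)\<in>leaf_atlas T \<Phi> L. q \<in> P \<and> cube (Suc n) (c q) \<eta> \<subseteq> c ` P"
          using P(2,3) by (intro bexI[of _ "(P, snd \<circ> \<phi>)"]) auto
      qed
      have "L \<noteq> {}" using L leaves(2) by blast
      then have "topspace (leaf_topology T L) \<noteq> {}" by (simp add: topspace_leaf_topology[OF leaf_subset[OF L]])
      then show "GX_complete (L_group n) (n + 1) (leaf_topology T L) (leaf_atlas T \<Phi> L)"
        by (rule GX_complete_if_vertically_complete)
    qed
  qed
qed

end
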